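(* Let $G$ be a connected, simply connected semisimple Lie group and let $K=T_{s,t}$ be the torus knot, with $s,t\ge 2$ coprime. Let $F^G_{T_{s,t}}(\mathbf x,q)$ be the series attached to the complement of $T_{s,t}$ (described in the context), written as $$F^G_{T_{s,t}}(\mathbf x,q)=\frac1{|W|}\sum_{\beta\in P_+\cap(Q+\rho)}f^G_\beta(q)\sum_{w\in W}(-1)^{l(w)}x^{w(\beta)}.$$ Then $f_\beta^G(q)$ is a monomial of degree $\frac{(\beta,\beta)}{2st}$, up to an overall $q$-power. More precisely, $$F_{T_{s,t}}^G \cong \frac{1}{|W|}\sum_{\beta\in P_+ \cap (Q+\rho)}\ \sum_{w\in W}(-1)^{l(w)}x^{w(\beta)}\sum_{(w_1,w_2)\in W^2}(-1)^{l(w_1w_2)}\,\mathbf{1}(\beta,w_1,w_2)\,N_{\frac{1}{st}(\beta + tw_1(\rho)+sw_2(\rho))}\; q^{\frac{(\beta,\beta)}{2st}},$$ where $$\mathbf{1}(\beta,w_1,w_2):=\begin{cases} 1, &\text{if }\frac{1}{st}(\beta + tw_1(\rho) + sw_2(\rho)) \in P_+\cap (Q+\rho),\\ 0,&\text{otherwise.}\end{cases}$$ Here $\cong$ means equality up to sign and an overall power of $q$.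
   Context: **Lie theory.** $G$ has root system $\Delta$, rank $r$, root lattice $Q$, weight lattice $P$, dominant weights $P_+$, Weyl group $W$ with length function $l$, positive roots $\Delta^+$, fundamental weights $\omega_1,\dots,\omega_r$, and Weyl vector $\rho$ (half-sum of the positive roots). The inner product $(\cdot,\cdot)$ is the standard one, normalized by $(\alpha,\alpha)=2$ for short roots $\alpha$. For $\mathbf x=(x_1,\dots,x_r)$ and $\beta\in P$, $x^\beta:=\prod_{1\le j\le r}x_j^{(\beta,\omega_j)}$. **The numbers $N_\ell$.** $N_\ell:=\sum_{w\in W}(-1)^{l(w)}K(w(\ell))$, where $K(\beta)$ denotes the Kostant partition function. For example, $N_\ell$ is $\operatorname{sgn}((\ell,\alpha_1))$ for ${\rm SU}(2)$, and $\operatorname{sgn}\big(\prod_{\alpha\in\Delta^+}(\ell,\alpha)\big)\min\{|(\ell,\alpha_1)|,|(\ell,\alpha_2)|\}$ for ${\rm SU}(3)$, with $\alpha_i$ the simple roots. These numbers are used as the coefficients in the expansion (averaged over Weyl chambers) $\big(\sum_{w\in W}(-1)^{l(w)}x^{w(\rho)}\big)^{-1}=\frac1{|W|}\sum_{\ell\in P_+\cap(Q+\rho)}N_\ell\sum_{w\in W}(-1)^{l(w)}x^{w(\ell)}$. **Plumbing description of the torus knot complement.** Choose $0<t'<t$ and $0<s'<s$ with $st'\equiv-1\ (\mathrm{mod}\ t)$ and $ts'\equiv-1\ (\mathrm{mod}\ s)$. The complement of $T_{s,t}$ is described by a star-shaped plumbing tree with a central vertex $v_{-1}$ of weight $-1$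 and three legs: two legs given by the continued fractions of $-\frac t{t'}$ and $-\frac s{s'}$ (each a chain of integer-weighted vertices), and one leg consisting of a single vertex $v_{-st}$ of weight $-st$, which represents the knot and is not surgered. Let $V$ be the set of all vertices, $V'=V\setminus\{v_{-st}\}$, and let ${\rm B}'$ be the linking matrix restricted to $V'$ (weights on the diagonal, $1$ for adjacent vertices, $0$ otherwise). Degrees are taken in the whole tree (so $\deg v_{-1}=3$), and $\delta_v=(2-\deg v)\rho$. Pairings of elements of $Q^{V'}$ etc. are sums over vertices of $(\cdot,\cdot)$. **The series.** $F^G_{T_{s,t}}$ is the plumbing integral for this tree in which the variable $x=x_{-st}$ attached to $v_{-st}$ is left unintegrated. That is, up to sign and an overall power of $q$, it is the constant term, with respect to all variables $x_v$ with $v\in V'$, of the product of $$\prod_{v\in V'}\Big(\sum_{w\in W}(-1)^{l(w)}x_v^{w(\rho)}\Big)^{2-\deg v}$$ and $$\Theta^{-{\rm B}'}(x^{-1},q)\cong\sum_{\alpha\in Q^{V'}}q^{-\frac12(\alpha,{\rm B}'\alpha)-(\alpha,\delta)}\prod_{v\in V'}x_v^{-({\rm B}'\alpha+\delta)_v}\cdot x_{-st}^{-\alpha_{-1}-\rho},$$ where $\alpha_{-1}$ is the component of $\alpha$ at $v_{-1}$. Negative powers are expanded by averaging over the $|W|$ expansions, one for each Weyl chamber (principal value).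
   Formalization: F is divided by x^{(st-s-t-1)ρ} so that the expansion exists; the indicator tests Q+ρ, with P_+∩(Q+ρ) kept only if (s+t)·2(ρ,α)/(α,α) ≤ st for all positive α (printed form fails for SU(3), trefoil, β=ω1+4ω2); K(β) counts partitions of β-ρ. *)

theory Defs
  imports "HOL-Analysis.Analysis" "HOL-Number_Theory.Cong"
begin

text \<open>
  A connected, simply connected semisimple group enters only through its root system
  \<open>\<Phi>\<close>, which spans the Euclidean space \<^typ>\<open>'a\<close>, and a choice \<open>S\<close> of simple roots;
  the inner product \<open>(\<cdot>,\<cdot>)\<close> is that of \<^typ>\<open>'a\<close>.
\<close>

definition coroot_pairing :: "'a::euclidean_space \<Rightarrow> 'a \<Rightarrow> real" where
  "coroot_pairing x \<alpha> = 2 * (x \<bullet> \<alpha>) / (\<alpha> \<bullet> \<alpha>)"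

definition reflection :: "'a::euclidean_space \<Rightarrow> 'a \<Rightarrow> 'a" where
  "reflection \<alpha> x = x - coroot_pairing x \<alpha> *\<^sub>R \<alpha>"

definition root_system :: "'a::euclidean_space set \<Rightarrow> bool" where
  "root_system \<Phi> \<longleftrightarrow>
     finite \<Phi> \<and> 0 \<notin> \<Phi> \<and> span \<Phi> = UNIV \<and>
     (\<forall>\<alpha>\<in>\<Phi>. \<forall>\<beta>\<in>\<Phi>. reflection \<alpha> \<beta> \<in> \<Phi>) \<and>
     (\<forall>\<alpha>\<in>\<Phi>. \<forall>\<beta>\<in>\<Phi>. coroot_pairing \<beta> \<alpha> \<in> \<int>) \<and>
     (\<forall>\<alpha>\<in>\<Phi>. \<forall>c. c *\<^sub>R \<alpha> \<in> \<Phi> \<longrightarrow> c = 1 \<or> c = -1)"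

text \<open>Shortness is relative to the irreducible component of a root.\<close>

definition short_roots :: "'a::euclidean_space set \<Rightarrow> 'a set" where
  "short_roots \<Phi> = {\<alpha>\<in>\<Phi>. \<forall>\<beta>. (\<alpha>, \<beta>) \<in> {(\<gamma>, \<delta>). \<gamma> \<in> \<Phi> \<and> \<delta> \<in> \<Phi> \<and> \<gamma> \<bullet> \<delta> \<noteq> 0}\<^sup>* \<longrightarrow> \<alpha> \<bullet> \<alpha> \<le> \<beta> \<bullet> \<beta>}"

definition standard_normalization :: "'a::euclidean_space set \<Rightarrow> bool" where
  "standard_normalization \<Phi> \<longleftrightarrow> (\<forall>\<alpha>\<in>short_roots \<Phi>. \<alpha> \<bullet> \<alpha> = 2)"

definition nonneg_cone :: "'a::euclidean_space set \<Rightarrow> 'a set" where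
  "nonneg_cone S = {\<Sum>\<sigma>\<in>S. real (c \<sigma>) *\<^sub>R \<sigma> | c :: 'a \<Rightarrow> nat. True}"

definition simple_system :: "'a::euclidean_space set \<Rightarrow> 'a set \<Rightarrow> bool" where
  "simple_system \<Phi> S \<longleftrightarrow>
     S \<subseteq> \<Phi> \<and> independent S \<and> (\<forall>\<alpha>\<in>\<Phi>. \<alpha> \<in> nonneg_cone S \<or> - \<alpha> \<in> nonneg_cone S)"

definition positive_roots :: "'a::euclidean_space set \<Rightarrow> 'a set \<Rightarrow> 'a set" where
  "positive_roots \<Phi> S = \<Phi> \<inter> nonneg_cone S"

definition weyl_vector :: "'a::euclidean_space set \<Rightarrow> 'a set \<Rightarrow> 'a" where
  "weyl_vector \<Phi> S = (1/2) *\<^sub>R (\<Sum>\<alpha>\<in>positive_roots \<Phi> S. \<alpha>)"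

definition root_lattice :: "'a::euclidean_space set \<Rightarrow> 'a set" where
  "root_lattice \<Phi> = {\<Sum>\<alpha>\<in>\<Phi>. real_of_int (c \<alpha>) *\<^sub>R \<alpha> | c :: 'a \<Rightarrow> int. True}"

definition weight_lattice :: "'a::euclidean_space set \<Rightarrow> 'a set" where
  "weight_lattice \<Phi> = {\<beta>. \<forall>\<alpha>\<in>\<Phi>. coroot_pairing \<beta> \<alpha> \<in> \<int>}"

definition dominant_weights :: "'a::euclidean_space set \<Rightarrow> 'a set \<Rightarrow> 'a set" where
  "dominant_weights \<Phi> S = {\<beta>\<in>weight_lattice \<Phi>. \<forall>\<alpha>\<in>S. \<beta> \<bullet> \<alpha> \<ge> 0}"

text \<open>The coset \<open>Q + \<rho>\<close>.\<close>

definition shifted_root_lattice :: "'a::euclidean_space set \<Rightarrow> 'a set \<Rightarrow> 'a set" where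
  "shifted_root_lattice \<Phi> S = (\<lambda>\<gamma>. \<gamma> + weyl_vector \<Phi> S) ` root_lattice \<Phi>"

inductive_set weyl_group :: "'a::euclidean_space set \<Rightarrow> ('a \<Rightarrow> 'a) set" for \<Phi> where
  weyl_group_id: "id \<in> weyl_group \<Phi>"
| weyl_group_step: "w \<in> weyl_group \<Phi> \<Longrightarrow> \<alpha> \<in> \<Phi> \<Longrightarrow> reflection \<alpha> \<circ> w \<in> weyl_group \<Phi>"

definition weyl_length :: "'a::euclidean_space set \<Rightarrow> ('a \<Rightarrow> 'a) \<Rightarrow> nat" where
  "weyl_length S w =
     (LEAST n. \<exists>\<sigma>s. set \<sigma>s \<subseteq> S \<and> length \<sigma>s = n \<and> w = foldr (\<lambda>\<sigma> v. reflection \<sigma> \<circ> v) \<sigma>s id)"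

definition weyl_sign :: "'a::euclidean_space set \<Rightarrow> ('a \<Rightarrow> 'a) \<Rightarrow> real" where
  "weyl_sign S w = (-1) ^ weyl_length S w"

definition partition_count :: "'a::euclidean_space set \<Rightarrow> 'a set \<Rightarrow> 'a \<Rightarrow> nat" where
  "partition_count \<Phi> S \<gamma> =
     card {m \<in> positive_roots \<Phi> S \<rightarrow>\<^sub>E (UNIV :: nat set).
             (\<Sum>\<alpha>\<in>positive_roots \<Phi> S. real (m \<alpha>) *\<^sub>R \<alpha>) = \<gamma>}"

text \<open>
  The partition function is indexed with a shift by \<open>\<rho>\<close>: \<open>K \<beta>\<close> is the number of ways to write
  \<open>\<beta> - \<rho>\<close> as a sum of positive roots, i.e. the coefficient of \<open>x\<^sup>\<beta>\<close> in
  \<open>\<Prod>\<^sub>\<alpha> (x\<^bsup>\<alpha>/2\<^esup> + x\<^bsup>3\<alpha>/2\<^esup> + \<dots>)\<close>. This is the convention under which \<open>N\<^sub>\<nu>\<close>, for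
  \<open>\<nu> \<in> Q + \<rho>\<close>, has the values \<open>sgn (\<nu>,\<alpha>\<^sub>1)\<close> for \<open>SU(2)\<close> and
  \<open>\<plusminus> min (\<bar>(\<nu>,\<alpha>\<^sub>1)\<bar>, \<bar>(\<nu>,\<alpha>\<^sub>2)\<bar>)\<close> for \<open>SU(3)\<close>.
\<close>

definition kostant_K :: "'a::euclidean_space set \<Rightarrow> 'a set \<Rightarrow> 'a \<Rightarrow> nat" where
  "kostant_K \<Phi> S \<beta> = partition_count \<Phi> S (\<beta> - weyl_vector \<Phi> S)"

definition N_coeff :: "'a::euclidean_space set \<Rightarrow> 'a set \<Rightarrow> 'a \<Rightarrow> real" where
  "N_coeff \<Phi> S \<nu> = (\<Sum>w\<in>weyl_group \<Phi>. weyl_sign S w * real (kostant_K \<Phi> S (w \<nu>)))"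


text \<open>
  A formal series in the \<open>x\<^sup>\<beta>\<close> is identified with its coefficient function \<open>\<beta> \<mapsto> [x\<^sup>\<beta>]\<close>;
  since the \<open>\<omega>\<^sub>j\<close> form a basis, the monomial \<open>\<Prod>\<^sub>j x\<^sub>j\<^bsup>(\<beta>,\<omega>\<^sub>j)\<^esup>\<close> determines \<open>\<beta>\<close>.
  The product is only used for series supported in a common cone, or when one factor is a
  finite sum, so that the sum below is finite.
\<close>

type_synonym 'a x_series = "'a \<Rightarrow> real"

definition series_one :: "'a::euclidean_space x_series" where
  "series_one \<mu> = (if \<mu> = 0 then 1 else 0)"

definition series_mult :: "'a::euclidean_space x_series \<Rightarrow> 'a x_series \<Rightarrow> 'a x_series" where
  "series_mult A B \<mu> = (\<Sum>\<nu> | A \<nu> \<noteq> 0 \<and> B (\<mu> - \<nu>) \<noteq> 0. A \<nu> * B (\<mu> - \<nu>))"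

primrec series_power :: "'a::euclidean_space x_series \<Rightarrow> nat \<Rightarrow> 'a x_series" where
  "series_power A 0 = series_one"
| "series_power A (Suc n) = series_mult A (series_power A n)"

definition weyl_denominator :: "'a::euclidean_space set \<Rightarrow> 'a set \<Rightarrow> 'a x_series" where
  "weyl_denominator \<Phi> S \<mu> = (\<Sum>w | w \<in> weyl_group \<Phi> \<and> w (weyl_vector \<Phi> S) = \<mu>. weyl_sign S w)"

text \<open>
  In the chamber of \<open>u\<close> the leading term of the denominator is \<open>\<plusminus>x\<^bsup>u \<rho>\<^esup>\<close>, and its inverse is
  expanded in powers of the \<open>x\<^bsup>-u \<sigma>\<^esup>\<close>, \<open>\<sigma> \<in> S\<close>.
\<close>

definition chamber_inverse :: "'a::euclidean_space set \<Rightarrow> 'a set \<Rightarrow> ('a \<Rightarrow> 'a) \<Rightarrow> 'a x_series" where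
  "chamber_inverse \<Phi> S u =
     (THE A. (\<forall>\<nu>. A \<nu> \<noteq> 0 \<longrightarrow> (\<exists>\<gamma>\<in>nonneg_cone S. \<nu> = - u (weyl_vector \<Phi> S + \<gamma>))) \<and>
             series_mult (weyl_denominator \<Phi> S) A = series_one)"

definition denominator_power :: "'a::euclidean_space set \<Rightarrow> 'a set \<Rightarrow> int \<Rightarrow> 'a x_series" where
  "denominator_power \<Phi> S k \<mu> =
     (if k \<ge> 0 then series_power (weyl_denominator \<Phi> S) (nat k) \<mu>
      else (\<Sum>u\<in>weyl_group \<Phi>. series_power (chamber_inverse \<Phi> S u) (nat (- k)) \<mu>)
             / real (card (weyl_group \<Phi>)))"


text \<open>
  Plumbing tree of the complement of \<open>T\<^sub>s\<^sub>,\<^sub>t\<close>: the legs are given by their weights, listed from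
  the central vertex outwards.
\<close>

fun neg_cont_frac :: "int list \<Rightarrow> real" where
  "neg_cont_frac [] = 0"
| "neg_cont_frac [k] = of_int k"
| "neg_cont_frac (k # l # ks) = of_int k - 1 / neg_cont_frac (l # ks)"

text \<open>With all entries at most \<open>-2\<close> the expansion of a rational number less than \<open>-1\<close> exists and
  is unique.\<close>

definition neg_cont_frac_expansion :: "int list \<Rightarrow> real \<Rightarrow> bool" where
  "neg_cont_frac_expansion ks x \<longleftrightarrow> (\<forall>k\<in>set ks. k \<le> -2) \<and> neg_cont_frac ks = x"

datatype tree_vertex = Center | Leg_t nat | Leg_s nat | Knot

definition inner_vertices :: "int list \<Rightarrow> int list \<Rightarrow> tree_vertex set" where
  "inner_vertices ks ls = {Center} \<union> Leg_t ` {..<length ks} \<union> Leg_s ` {..<length ls}"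

definition tree_vertices :: "int list \<Rightarrow> int list \<Rightarrow> tree_vertex set" where
  "tree_vertices ks ls = insert Knot (inner_vertices ks ls)"

definition tree_edges :: "int list \<Rightarrow> int list \<Rightarrow> tree_vertex set set" where
  "tree_edges ks ls =
     {{Center, Knot}, {Center, Leg_t 0}, {Center, Leg_s 0}}
     \<union> {{Leg_t i, Leg_t (Suc i)} | i. Suc i < length ks}
     \<union> {{Leg_s i, Leg_s (Suc i)} | i. Suc i < length ls}"

definition tree_degree :: "int list \<Rightarrow> int list \<Rightarrow> tree_vertex \<Rightarrow> nat" where
  "tree_degree ks ls v = card {u \<in> tree_vertices ks ls. {u, v} \<in> tree_edges ks ls}"

fun tree_weight :: "nat \<Rightarrow> nat \<Rightarrow> int list \<Rightarrow> int list \<Rightarrow> tree_vertex \<Rightarrow> int" where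
  "tree_weight s t ks ls Center = -1"
| "tree_weight s t ks ls (Leg_t i) = ks ! i"
| "tree_weight s t ks ls (Leg_s i) = ls ! i"
| "tree_weight s t ks ls Knot = - (int s * int t)"

definition linking :: "nat \<Rightarrow> nat \<Rightarrow> int list \<Rightarrow> int list \<Rightarrow> tree_vertex \<Rightarrow> tree_vertex \<Rightarrow> int" where
  "linking s t ks ls u v =
     (if u = v then tree_weight s t ks ls u else if {u, v} \<in> tree_edges ks ls then 1 else 0)"

definition linking_apply ::
  "nat \<Rightarrow> nat \<Rightarrow> int list \<Rightarrow> int list \<Rightarrow> (tree_vertex \<Rightarrow> 'a::euclidean_space) \<Rightarrow> tree_vertex \<Rightarrow> 'a" where
  "linking_apply s t ks ls \<alpha> v =
     (\<Sum>u\<in>inner_vertices ks ls. real_of_int (linking s t ks ls v u) *\<^sub>R \<alpha> u)"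

definition delta_vec ::
  "'a::euclidean_space set \<Rightarrow> 'a set \<Rightarrow> int list \<Rightarrow> int list \<Rightarrow> tree_vertex \<Rightarrow> 'a" where
  "delta_vec \<Phi> S ks ls v = real_of_int (2 - int (tree_degree ks ls v)) *\<^sub>R weyl_vector \<Phi> S"

definition theta_q_exponent ::
  "'a::euclidean_space set \<Rightarrow> 'a set \<Rightarrow> nat \<Rightarrow> nat \<Rightarrow> int list \<Rightarrow> int list \<Rightarrow> (tree_vertex \<Rightarrow> 'a) \<Rightarrow> real" where
  "theta_q_exponent \<Phi> S s t ks ls \<alpha> =
     - (1/2) * (\<Sum>v\<in>inner_vertices ks ls. \<alpha> v \<bullet> linking_apply s t ks ls \<alpha> v)
     - (\<Sum>v\<in>inner_vertices ks ls. \<alpha> v \<bullet> delta_vec \<Phi> S ks ls v)"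

text \<open>A series in \<open>x\<close> and real powers of \<open>q\<close>: \<open>F \<mu> e\<close> is the coefficient of \<open>x\<^sup>\<mu> q\<^sup>e\<close>.\<close>

type_synonym 'a xq_series = "'a \<Rightarrow> real \<Rightarrow> real"

text \<open>
  The constant term in all \<open>x\<^sub>v\<close>, \<open>v \<in> V'\<close>. The constant term of \<open>E(x\<^sub>v) x\<^sub>v\<^bsup>-n\<^esup>\<close> is the
  coefficient of \<open>x\<^sub>v\<^sup>n\<close> in \<open>E\<close>; the coefficient of \<open>x\<^sup>\<mu> q\<^sup>e\<close> receives a contribution from those
  \<open>\<alpha> \<in> Q\<^bsup>V'\<^esup>\<close> with \<open>-\<alpha>\<^sub>-\<^sub>1 - \<rho> = \<mu>\<close> and \<open>q\<close>-exponent \<open>e\<close>, all but finitely many of them zero.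
\<close>

definition plumbing_series ::
  "'a::euclidean_space set \<Rightarrow> 'a set \<Rightarrow> nat \<Rightarrow> nat \<Rightarrow> int list \<Rightarrow> int list \<Rightarrow> 'a xq_series" where
  "plumbing_series \<Phi> S s t ks ls \<mu> e =
     (let contribution = (\<lambda>\<alpha>. \<Prod>v\<in>inner_vertices ks ls.
            denominator_power \<Phi> S (2 - int (tree_degree ks ls v))
              (linking_apply s t ks ls \<alpha> v + delta_vec \<Phi> S ks ls v))
      in \<Sum>\<alpha> | \<alpha> \<in> inner_vertices ks ls \<rightarrow>\<^sub>E root_lattice \<Phi>
              \<and> - \<alpha> Center - weyl_vector \<Phi> S = \<mu>
              \<and> theta_q_exponent \<Phi> S s t ks ls \<alpha> = e
              \<and> contribution \<alpha> \<noteq> 0. contribution \<alpha>)"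

text \<open>
  With \<open>n = B'\<alpha> + \<delta>\<close>, the exponent of \<open>q\<close> is, up to a constant, \<open>-(n, B'\<^bsup>-1\<^esup>n)/2\<close>, and
  \<open>-\<alpha>\<^sub>-\<^sub>1 - \<rho> = -(B'\<^bsup>-1\<^esup>n)\<^sub>-\<^sub>1 + (st - s - t - 1)\<rho>\<close>, because \<open>(B'\<^bsup>-1\<^esup>\<delta>)\<^sub>-\<^sub>1 = (st - s - t)\<rho>\<close>.
  The variable conjugate to the symmetric quadratic form is thus off by the fixed monomial
  \<open>x\<^bsup>(st - s - t - 1)\<rho>\<^esup>\<close>, which is trivial for the trefoil. It is removed here: this is the
  normalization in which the series is anti-invariant under the Weyl group, as an expansion in
  the \<open>\<Sum>\<^sub>w (-1)\<^bsup>l(w)\<^esup> x\<^bsup>w \<beta>\<^esup>\<close> requires.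
\<close>

definition torus_knot_F ::
  "'a::euclidean_space set \<Rightarrow> 'a set \<Rightarrow> nat \<Rightarrow> nat \<Rightarrow> int list \<Rightarrow> int list \<Rightarrow> 'a xq_series" where
  "torus_knot_F \<Phi> S s t ks ls \<mu> =
     plumbing_series \<Phi> S s t ks ls (\<mu> + (real s * real t - real s - real t - 1) *\<^sub>R weyl_vector \<Phi> S)"

definition antisymmetric_expansion ::
  "'a::euclidean_space set \<Rightarrow> 'a set \<Rightarrow> ('a \<Rightarrow> real \<Rightarrow> real) \<Rightarrow> 'a xq_series" where
  "antisymmetric_expansion \<Phi> S f \<mu> e =
     (\<Sum>(\<beta>, w) | \<beta> \<in> dominant_weights \<Phi> S \<inter> shifted_root_lattice \<Phi> S \<and> w \<in> weyl_group \<Phi> \<and> w \<beta> = \<mu>.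
        weyl_sign S w * f \<beta> e) / real (card (weyl_group \<Phi>))"

definition q_monomial :: "real \<Rightarrow> real \<Rightarrow> real \<Rightarrow> real" where
  "q_monomial a d e = (if e = d then a else 0)"

definition eq_up_to_sign_qpower :: "'a xq_series \<Rightarrow> 'a xq_series \<Rightarrow> bool" (infix "\<cong>\<^sub>q" 50) where
  "F \<cong>\<^sub>q G \<longleftrightarrow> (\<exists>\<epsilon>\<in>{1, -1}. \<exists>c. \<forall>\<mu> e. F \<mu> e = \<epsilon> * G \<mu> (e - c))"

definition ell_arg ::
  "'a::euclidean_space set \<Rightarrow> 'a set \<Rightarrow> nat \<Rightarrow> nat \<Rightarrow> 'a \<Rightarrow> ('a \<Rightarrow> 'a) \<Rightarrow> ('a \<Rightarrow> 'a) \<Rightarrow> 'a" where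
  "ell_arg \<Phi> S s t \<beta> w1 w2 =
     (1 / (real s * real t)) *\<^sub>R
       (\<beta> + real t *\<^sub>R w1 (weyl_vector \<Phi> S) + real s *\<^sub>R w2 (weyl_vector \<Phi> S))"

text \<open>
  The coefficient of the monomial \<open>f\<^sub>\<beta>\<close>, the indicator being that of \<open>L\<close>. For dominant \<open>\<beta>\<close> the
  vector \<open>\<nu> = (\<beta> + t w\<^sub>1 \<rho> + s w\<^sub>2 \<rho>)/(st)\<close> may be a non-dominant element of \<open>Q + \<rho>\<close> with \<open>N\<^sub>\<nu> \<noteq> 0\<close> (for \<open>SU(3)\<close>, the trefoil
  and \<open>\<beta> = \<omega>\<^sub>1 + 4\<omega>\<^sub>2\<close> the only nonzero term has \<open>\<nu> = \<alpha>\<^sub>2\<close>), so in general \<open>L = Q + \<rho>\<close> is needed;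
  \<open>L = P\<^sub>+ \<inter> (Q + \<rho>)\<close> gives the same sum when \<open>s\<close> and \<open>t\<close> are large compared to the numbers
  \<open>2(\<rho>,\<alpha>)/(\<alpha>,\<alpha>)\<close>, and always for \<open>SU(2)\<close>.
\<close>

definition torus_coeff ::
  "'a::euclidean_space set \<Rightarrow> 'a set \<Rightarrow> nat \<Rightarrow> nat \<Rightarrow> 'a set \<Rightarrow> 'a \<Rightarrow> real" where
  "torus_coeff \<Phi> S s t L \<beta> =
     (\<Sum>(w1, w2) \<in> weyl_group \<Phi> \<times> weyl_group \<Phi>.
        weyl_sign S (w1 \<circ> w2) * of_bool (ell_arg \<Phi> S s t \<beta> w1 w2 \<in> L)
          * N_coeff \<Phi> S (ell_arg \<Phi> S s t \<beta> w1 w2))"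

end

theory Submission
  imports Defs
begin

text \<open>
  Away from the center the factors of the integrand are powers 0 and 1 of the Weyl denominator. Power 0 forces
  \<open>(B'\<alpha> + \<delta>)\<^sub>v = 0\<close> at the inner vertices of a leg and power 1 forces \<open>(B'\<alpha> + \<delta>)\<^sub>v = w\<^sub>i \<rho>\<close> at its end.
  These linear recursions, solved by the continuants of the two continued fractions, determine \<open>\<alpha>\<close> from its
  value at the center and \<open>(w\<^sub>1, w\<^sub>2)\<close>, and since \<open>s t' + t s' = s t - 1\<close>, the exponent at the center becomes
  \<open>\<nu> = (\<mu> - s w\<^sub>1 \<rho> - t w\<^sub>2 \<rho>)/(s t)\<close>. The same identity shows that \<open>\<alpha>\<close> lies in \<open>Q\<close> exactly when \<open>\<nu> \<in> Q + \<rho>\<close>,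
  and, because \<open>\<bar>w \<rho>\<bar> = \<bar>\<rho>\<bar>\<close>, that the exponent of \<open>q\<close> is \<open>(\<mu>, \<mu>)/(2 s t)\<close> up to a constant.
  The center contributes power \<open>-1\<close>. By the denominator identity the inverse of the denominator in the chamber
  of \<open>u\<close> has coefficients \<open>\<plusminus>K(-u\<^sup>-\<^sup>1 \<nu>)\<close>, and their average is \<open>\<plusminus>N\<^sub>\<nu>/\<bar>W\<bar>\<close>. Replacing \<open>w\<^sub>i\<close> by \<open>w\<^sub>i w\<^sub>0\<close>, with \<open>w\<^sub>0\<close>
  the longest element of the Weyl group, turns \<open>w\<^sub>i \<rho>\<close> into \<open>- w\<^sub>i \<rho>\<close>.
\<close>

section \<open>Root systems and Weyl groups\<close>

text \<open>The sign is defined through the length, so its multiplicativity has to be earned: the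
  parity of the number of inversions shows that every word for w has the parity of a shortest one. A
  second recurring device is that an antisymmetric function vanishes on the walls of the chambers,
  hence is determined by its values on strictly dominant vectors. It yields the denominator identity
  and the comparison of the final expansions, and it explains why the coefficients are read off only
  at regular \<beta>: terms on a wall cancel. The chamber inverse is given by a definite
  description, so besides an explicit inverse a uniqueness argument inside one cone is needed. In
  the constant term only one direction of the lattice condition has to be checked, from \<nu> to
  \<alpha>, since N at \<nu> vanishes for \<nu> outside Q + \<rho>. The pair of Weyl elements is
  recovered from \<alpha> because \<rho> has trivial stabiliser, so the sum over \<alpha> becomes a
  sum over pairs without multiplicities. The bound on s and t in the dominant case forces the
  pairings of \<nu> with the simple coroots above -1; being integers, they are nonnegative.\<close>

lemma linear_reflection: "linear (reflection \<alpha>)"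
  unfolding reflection_def coroot_pairing_def
  by (intro linearI) (simp_all add: inner_add_left algebra_simps add_divide_distrib)

lemma coroot_pairing_add: "coroot_pairing (x + y) \<alpha> = coroot_pairing x \<alpha> + coroot_pairing y \<alpha>"
  by (simp add: coroot_pairing_def inner_add_left algebra_simps add_divide_distrib)

lemma coroot_pairing_diff: "coroot_pairing (x - y) \<alpha> = coroot_pairing x \<alpha> - coroot_pairing y \<alpha>"
  by (simp add: coroot_pairing_def inner_diff_left algebra_simps diff_divide_distrib)

lemma coroot_pairing_scaleR: "coroot_pairing (c *\<^sub>R x) \<alpha> = c * coroot_pairing x \<alpha>"
  by (simp add: coroot_pairing_def)

lemma coroot_pairing_sum: "coroot_pairing (sum f A) \<alpha> = (\<Sum>i\<in>A. coroot_pairing (f i) \<alpha>)"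
  by (simp add: coroot_pairing_def inner_sum_left sum_distrib_left sum_divide_distrib)

lemma reflection_inner: "reflection \<alpha> x \<bullet> reflection \<alpha> y = x \<bullet> y"
\<comment> \<open>Division by zero makes the pairing with 0 vanish, so the reflection in 0 is the
  identity.\<close>
proof (cases "\<alpha> = 0")
  case False
  then have "\<alpha> \<bullet> \<alpha> \<noteq> 0" by simp
  then show ?thesis
    by (simp add: reflection_def coroot_pairing_def inner_diff_left inner_diff_right field_simps inner_commute)
qed (simp add: reflection_def)

lemma reflection_reflection [simp]: "reflection \<alpha> (reflection \<alpha> x) = x"
proof (cases "\<alpha> = 0")
  case False
  then have "\<alpha> \<bullet> \<alpha> \<noteq> 0" by simp
  then have "coroot_pairing (reflection \<alpha> x) \<alpha> = - coroot_pairing x \<alpha>"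
    by (simp add: reflection_def coroot_pairing_def inner_diff_left field_simps)
  then show ?thesis
    unfolding reflection_def[of \<alpha> "reflection \<alpha> x"] by (simp add: reflection_def[of \<alpha> x])
qed (simp add: reflection_def)

lemma reflection_comp_self [simp]: "reflection \<alpha> \<circ> reflection \<alpha> = id"
  by (simp add: fun_eq_iff)

lemma reflection_self [simp]: "reflection \<alpha> \<alpha> = - \<alpha>"
  by (cases "\<alpha> = 0") (simp_all add: reflection_def coroot_pairing_def algebra_simps scaleR_2)

lemma weyl_group_linear: "w \<in> weyl_group \<Phi> \<Longrightarrow> linear w"
proof (induction rule: weyl_group.induct)
  case weyl_group_id
  then show ?case by (simp add: linear_iff)
next
  case (weyl_group_step w \<alpha>)
  then show ?case by (intro linear_compose linear_reflection)
qed

lemma weyl_group_inner: "w \<in> weyl_group \<Phi> \<Longrightarrow> w x \<bullet> w y = x \<bullet> y"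
  by (induction rule: weyl_group.induct) (auto simp: reflection_inner)

lemma weyl_group_comp: "u \<in> weyl_group \<Phi> \<Longrightarrow> v \<in> weyl_group \<Phi> \<Longrightarrow> u \<circ> v \<in> weyl_group \<Phi>"
  by (induction rule: weyl_group.induct) (auto simp: comp_assoc intro: weyl_group.intros)

lemma weyl_group_reflection: "\<alpha> \<in> \<Phi> \<Longrightarrow> reflection \<alpha> \<in> weyl_group \<Phi>"
  using weyl_group_step[OF weyl_group_id] by fastforce

text \<open>The inductive definition only generates a monoid; inverses exist because every generator
  is an involution.\<close>

lemma weyl_group_inverse_ex: "w \<in> weyl_group \<Phi> \<Longrightarrow> \<exists>v\<in>weyl_group \<Phi>. v \<circ> w = id \<and> w \<circ> v = id"
proof (induction rule: weyl_group.induct)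
  case weyl_group_id
  show ?case by (intro bexI[of _ id]) (simp_all add: weyl_group.weyl_group_id)
next
  case (weyl_group_step w \<alpha>)
  then obtain v where v: "v \<in> weyl_group \<Phi>" "v \<circ> w = id" "w \<circ> v = id" by blast
  show ?case
  proof (intro bexI[of _ "v \<circ> reflection \<alpha>"] conjI)
    show "v \<circ> reflection \<alpha> \<in> weyl_group \<Phi>"
      using v weyl_group_step by (intro weyl_group_comp weyl_group_reflection)
  qed (use v in \<open>auto simp: fun_eq_iff\<close>)
qed

lemma weyl_group_bij: "w \<in> weyl_group \<Phi> \<Longrightarrow> bij w"
  using weyl_group_inverse_ex o_bij by blast

lemma weyl_group_inv: "w \<in> weyl_group \<Phi> \<Longrightarrow> inv w \<in> weyl_group \<Phi>"
  using weyl_group_inverse_ex[of w \<Phi>] inv_unique_comp by metis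

lemma weyl_inv_apply [simp]:
  assumes "w \<in> weyl_group \<Phi>"
  shows "inv w (w x) = x" "w (inv w x) = x"
  using weyl_group_bij[OF assms] by (auto simp: bij_def surj_f_inv_f)

lemma weyl_inv_comp [simp]:
  assumes "w \<in> weyl_group \<Phi>"
  shows "inv w \<circ> w = id" "w \<circ> inv w = id"
  using assms by (auto simp: fun_eq_iff)

lemmas weyl_simps = linear_add[OF weyl_group_linear] linear_diff[OF weyl_group_linear]
  linear_cmul[OF weyl_group_linear] linear_neg[OF weyl_group_linear]
  linear_sum[OF weyl_group_linear] linear_0[OF weyl_group_linear]

lemma sum_weyl_left:
  assumes "u \<in> weyl_group \<Phi>"
  shows "(\<Sum>w\<in>weyl_group \<Phi>. f (u \<circ> w)) = (\<Sum>w\<in>weyl_group \<Phi>. f w)"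
  by (rule sum.reindex_bij_witness[of _ "\<lambda>w. inv u \<circ> w" "\<lambda>w. u \<circ> w"])
     (use assms in \<open>auto intro: weyl_group_comp weyl_group_inv simp: comp_assoc[symmetric]\<close>)

lemma sum_weyl_right:
  assumes "u \<in> weyl_group \<Phi>"
  shows "(\<Sum>w\<in>weyl_group \<Phi>. f (w \<circ> u)) = (\<Sum>w\<in>weyl_group \<Phi>. f w)"
  by (rule sum.reindex_bij_witness[of _ "\<lambda>w. w \<circ> inv u" "\<lambda>w. w \<circ> u"])
     (use assms in \<open>auto intro: weyl_group_comp weyl_group_inv simp: comp_assoc\<close>)

lemma sum_weyl_inv: "(\<Sum>w\<in>weyl_group \<Phi>. f (inv w)) = (\<Sum>w\<in>weyl_group \<Phi>. f w)"
  by (rule sum.reindex_bij_witness[of _ inv inv])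
     (auto intro: weyl_group_inv simp: inv_inv_eq weyl_group_bij)

lemma coroot_pairing_weyl:
  "w \<in> weyl_group \<Phi> \<Longrightarrow> coroot_pairing (w x) (w \<alpha>) = coroot_pairing x \<alpha>"
  by (simp add: coroot_pairing_def weyl_group_inner)

lemma reflection_conjugate:
  "w \<in> weyl_group \<Phi> \<Longrightarrow> reflection (w \<alpha>) = w \<circ> reflection \<alpha> \<circ> inv w"
  by (auto simp: fun_eq_iff reflection_def weyl_simps)
     (metis coroot_pairing_weyl weyl_inv_apply(2))

section \<open>Closure properties of the cone and of the root lattice\<close>

lemma nonneg_cone_add: "x \<in> nonneg_cone S \<Longrightarrow> y \<in> nonneg_cone S \<Longrightarrow> x + y \<in> nonneg_cone S"
proof -
  assume "x \<in> nonneg_cone S" "y \<in> nonneg_cone S"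
  then obtain c d where "x = (\<Sum>\<sigma>\<in>S. real (c \<sigma>) *\<^sub>R \<sigma>)" "y = (\<Sum>\<sigma>\<in>S. real (d \<sigma>) *\<^sub>R \<sigma>)"
    by (auto simp: nonneg_cone_def)
  then have "x + y = (\<Sum>\<sigma>\<in>S. real (c \<sigma> + d \<sigma>) *\<^sub>R \<sigma>)"
    by (simp add: sum.distrib scaleR_add_left)
  then show ?thesis unfolding nonneg_cone_def by (intro CollectI exI[of _ "\<lambda>\<sigma>. c \<sigma> + d \<sigma>"]) simp
qed

lemma nonneg_cone_zero: "0 \<in> nonneg_cone S"
  unfolding nonneg_cone_def by (intro CollectI exI[of _ "\<lambda>\<sigma>. 0"]) simp

lemma nonneg_cone_sum: "(\<And>i. i \<in> A \<Longrightarrow> f i \<in> nonneg_cone S) \<Longrightarrow> sum f A \<in> nonneg_cone S"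
  by (induction A rule: infinite_finite_induct) (auto intro: nonneg_cone_add nonneg_cone_zero)

lemma nonneg_cone_scale: "x \<in> nonneg_cone S \<Longrightarrow> real n *\<^sub>R x \<in> nonneg_cone S"
  by (induction n) (auto intro: nonneg_cone_add nonneg_cone_zero simp: scaleR_add_left)

lemma root_lattice_add: "x \<in> root_lattice \<Phi> \<Longrightarrow> y \<in> root_lattice \<Phi> \<Longrightarrow> x + y \<in> root_lattice \<Phi>"
proof -
  assume "x \<in> root_lattice \<Phi>" "y \<in> root_lattice \<Phi>"
  then obtain c d where "x = (\<Sum>\<sigma>\<in>\<Phi>. real_of_int (c \<sigma>) *\<^sub>R \<sigma>)" "y = (\<Sum>\<sigma>\<in>\<Phi>. real_of_int (d \<sigma>) *\<^sub>R \<sigma>)"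
    by (auto simp: root_lattice_def)
  then have "x + y = (\<Sum>\<sigma>\<in>\<Phi>. real_of_int (c \<sigma> + d \<sigma>) *\<^sub>R \<sigma>)"
    by (simp add: sum.distrib scaleR_add_left)
  then show ?thesis unfolding root_lattice_def by (intro CollectI exI[of _ "\<lambda>\<sigma>. c \<sigma> + d \<sigma>"]) simp
qed

lemma root_lattice_scale:
  assumes "x \<in> root_lattice \<Phi>" "c \<in> \<int>"
  shows "c *\<^sub>R x \<in> root_lattice \<Phi>"
proof -
  from assms obtain a k where "x = (\<Sum>\<sigma>\<in>\<Phi>. real_of_int (a \<sigma>) *\<^sub>R \<sigma>)" "c = of_int k"
    by (auto simp: root_lattice_def elim: Ints_cases)
  then have "c *\<^sub>R x = (\<Sum>\<sigma>\<in>\<Phi>. real_of_int (k * a \<sigma>) *\<^sub>R \<sigma>)"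
    by (simp add: scaleR_sum_right)
  then show ?thesis unfolding root_lattice_def by (intro CollectI exI[of _ "\<lambda>\<sigma>. k * a \<sigma>"]) simp
qed

lemma root_lattice_zero: "0 \<in> root_lattice \<Phi>"
  unfolding root_lattice_def by (intro CollectI exI[of _ "\<lambda>\<sigma>. 0"]) simp

lemma root_lattice_uminus: "x \<in> root_lattice \<Phi> \<Longrightarrow> - x \<in> root_lattice \<Phi>"
  using root_lattice_scale[of x \<Phi> "-1"] by simp

lemma root_lattice_diff: "x \<in> root_lattice \<Phi> \<Longrightarrow> y \<in> root_lattice \<Phi> \<Longrightarrow> x - y \<in> root_lattice \<Phi>"
  using root_lattice_add[of x \<Phi> "- y"] root_lattice_uminus[of y \<Phi>] by simp

lemma root_lattice_sum: "(\<And>i. i \<in> A \<Longrightarrow> f i \<in> root_lattice \<Phi>) \<Longrightarrow> sum f A \<in> root_lattice \<Phi>"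
  by (induction A rule: infinite_finite_induct) (auto intro: root_lattice_add root_lattice_zero)

section \<open>Simple coordinates, height and positive roots\<close>

locale based_root_system =
  fixes \<Phi> S :: "'a::euclidean_space set"
  assumes root_system: "root_system \<Phi>" and simple_system: "simple_system \<Phi> S"
begin

abbreviation "Pos \<equiv> positive_roots \<Phi> S"
abbreviation "W \<equiv> weyl_group \<Phi>"
abbreviation "Q \<equiv> root_lattice \<Phi>"
abbreviation "\<rho> \<equiv> weyl_vector \<Phi> S"
abbreviation "coord x \<sigma> \<equiv> real_vector.representation S x \<sigma>"

text \<open>A natural number on \<open>nonneg_cone S\<close>, and at least 1 on its nonzero
  elements: the measure for inductions over the cone and the bound on partitions.\<close>

definition height :: "'a \<Rightarrow> real" where "height x = (\<Sum>\<sigma>\<in>S. coord x \<sigma>)"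

lemma finite_roots [simp]: "finite \<Phi>" and zero_not_root: "0 \<notin> \<Phi>"
  and span_roots: "span \<Phi> = UNIV"
  using root_system by (auto simp: root_system_def)

lemma simple_roots: "S \<subseteq> \<Phi>" and independent_simple: "independent S"
  using simple_system by (auto simp: simple_system_def)

lemma finite_simple [simp]: "finite S"
  using simple_roots finite_roots finite_subset by blast

lemma finite_pos [simp]: "finite Pos" by (simp add: positive_roots_def)

lemma reflection_root: "\<alpha> \<in> \<Phi> \<Longrightarrow> \<beta> \<in> \<Phi> \<Longrightarrow> reflection \<alpha> \<beta> \<in> \<Phi>"
  using root_system by (auto simp: root_system_def)

lemma uminus_root: "\<alpha> \<in> \<Phi> \<Longrightarrow> - \<alpha> \<in> \<Phi>"
  using reflection_root[of \<alpha> \<alpha>] by simp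

lemma nonneg_cone_span: "x \<in> nonneg_cone S \<Longrightarrow> x \<in> span S"
  by (auto simp: nonneg_cone_def intro: span_sum span_scale span_base)

lemma span_simple [simp]: "span S = UNIV"
proof -
  have "\<Phi> \<subseteq> span S"
    using simple_system nonneg_cone_span span_neg by (fastforce simp: simple_system_def)
  then show ?thesis using span_roots span_mono span_span by (metis top.extremum_uniqueI)
qed

lemma coord_add: "coord (x + y) \<sigma> = coord x \<sigma> + coord y \<sigma>"
  by (simp add: real_vector.representation_add independent_simple)

lemma coord_scale: "coord (c *\<^sub>R x) \<sigma> = c * coord x \<sigma>"
  by (simp add: real_vector.representation_scale independent_simple)

lemma coord_uminus: "coord (- x) \<sigma> = - coord x \<sigma>"
  using coord_scale[of "-1" x] by simp

lemma coord_diff: "coord (x - y) \<sigma> = coord x \<sigma> - coord y \<sigma>"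
  using coord_add[of x "-y"] by (simp add: coord_uminus)

lemma coord_sum: "coord (sum f A) \<sigma> = (\<Sum>i\<in>A. coord (f i) \<sigma>)"
  by (induction A rule: infinite_finite_induct) (simp_all add: coord_add real_vector.representation_zero)

lemma coord_simple: "\<sigma> \<in> S \<Longrightarrow> coord \<sigma> \<tau> = (if \<tau> = \<sigma> then 1 else 0)"
  by (simp add: real_vector.representation_basis independent_simple)

lemma sum_coord: "(\<Sum>\<sigma>\<in>S. coord x \<sigma> *\<^sub>R \<sigma>) = x"
  by (rule real_vector.sum_representation_eq) (simp_all add: independent_simple)

lemma coord_combination: "\<tau> \<in> S \<Longrightarrow> coord (\<Sum>\<sigma>\<in>S. c \<sigma> *\<^sub>R \<sigma>) \<tau> = c \<tau>"
  by (simp add: coord_sum coord_scale coord_simple if_distrib sum.delta cong: if_cong sum.cong)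

lemma nonneg_cone_iff: "x \<in> nonneg_cone S \<longleftrightarrow> (\<forall>\<sigma>\<in>S. coord x \<sigma> \<in> \<nat>)"
proof
  assume "x \<in> nonneg_cone S"
  then show "\<forall>\<sigma>\<in>S. coord x \<sigma> \<in> \<nat>"
    by (auto simp: nonneg_cone_def coord_combination)
next
  assume *: "\<forall>\<sigma>\<in>S. coord x \<sigma> \<in> \<nat>"
  then have "\<forall>\<sigma>\<in>S. \<exists>n. coord x \<sigma> = real n" by (auto elim: Nats_cases)
  then obtain c where "\<forall>\<sigma>\<in>S. coord x \<sigma> = real (c \<sigma>)" by metis
  then have "x = (\<Sum>\<sigma>\<in>S. real (c \<sigma>) *\<^sub>R \<sigma>)" using sum_coord[of x] by simp
  then show "x \<in> nonneg_cone S" by (auto simp: nonneg_cone_def)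
qed

lemma coord_nonneg: "x \<in> nonneg_cone S \<Longrightarrow> \<sigma> \<in> S \<Longrightarrow> coord x \<sigma> \<ge> 0"
  by (auto simp: nonneg_cone_iff elim!: Nats_cases)

lemma eq_zero_iff_coord: "x = 0 \<longleftrightarrow> (\<forall>\<sigma>\<in>S. coord x \<sigma> = 0)"
  using sum_coord[of x] by (auto simp: real_vector.representation_zero)

lemma height_add: "height (x + y) = height x + height y"
  and height_diff: "height (x - y) = height x - height y"
  and height_scale: "height (c *\<^sub>R x) = c * height x"
  and height_uminus: "height (- x) = - height x"
  by (simp_all add: height_def coord_add coord_scale coord_diff coord_uminus sum.distrib sum_subtractf
      sum_distrib_left sum_negf)

lemma height_sum: "height (sum f A) = (\<Sum>i\<in>A. height (f i))"
  unfolding height_def coord_sum by (rule sum.swap)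

lemma height_nat: "x \<in> nonneg_cone S \<Longrightarrow> height x \<in> \<nat>"
proof -
  assume "x \<in> nonneg_cone S"
  then obtain c where "x = (\<Sum>\<sigma>\<in>S. real (c \<sigma>) *\<^sub>R \<sigma>)" by (auto simp: nonneg_cone_def)
  then have "height x = real (\<Sum>\<sigma>\<in>S. c \<sigma>)" by (simp add: height_def coord_combination)
  then show ?thesis by (metis of_nat_in_Nats)
qed

lemma height_eq_0: "x \<in> nonneg_cone S \<Longrightarrow> height x = 0 \<longleftrightarrow> x = 0"
  unfolding height_def eq_zero_iff_coord by (intro sum_nonneg_eq_0_iff) (auto intro: coord_nonneg)

lemma height_ge_1: "x \<in> nonneg_cone S \<Longrightarrow> x \<noteq> 0 \<Longrightarrow> height x \<ge> 1"
  using height_nat[of x] height_eq_0[of x] by (auto elim!: Nats_cases)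

lemma pos_iff: "\<alpha> \<in> Pos \<longleftrightarrow> \<alpha> \<in> \<Phi> \<and> \<alpha> \<in> nonneg_cone S"
  by (simp add: positive_roots_def)

lemma pos_root: "\<alpha> \<in> Pos \<Longrightarrow> \<alpha> \<in> \<Phi>" by (simp add: pos_iff)

lemma pos_cone: "\<alpha> \<in> Pos \<Longrightarrow> \<alpha> \<in> nonneg_cone S" by (simp add: pos_iff)

lemma pos_height: "\<alpha> \<in> Pos \<Longrightarrow> height \<alpha> \<ge> 1"
  using height_ge_1 pos_iff zero_not_root by metis

lemma simple_pos: "\<sigma> \<in> S \<Longrightarrow> \<sigma> \<in> Pos"
  using simple_roots by (auto simp: pos_iff nonneg_cone_iff coord_simple)

lemma pos_or_neg: "\<alpha> \<in> \<Phi> \<Longrightarrow> \<alpha> \<in> Pos \<or> - \<alpha> \<in> Pos"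
  using simple_system uminus_root by (auto simp: simple_system_def pos_iff)

lemma not_pos_uminus: "\<alpha> \<in> Pos \<Longrightarrow> - \<alpha> \<notin> Pos"
  using pos_height[of \<alpha>] pos_height[of "- \<alpha>"] by (auto simp: height_uminus)

lemma neg_pos_iff: "\<alpha> \<in> \<Phi> \<Longrightarrow> - \<alpha> \<in> Pos \<longleftrightarrow> \<alpha> \<notin> Pos"
  using pos_or_neg not_pos_uminus by blast

text \<open>The reflection alters only the \<sigma>-coordinate. A positive root other than \<sigma>
  is no multiple of \<sigma>, so it has another positive coordinate; this one survives, and one
  positive coordinate makes a root positive.\<close>

lemma simple_reflection_pos:
  assumes "\<sigma> \<in> S" "\<beta> \<in> Pos" "\<beta> \<noteq> \<sigma>"
  shows "reflection \<sigma> \<beta> \<in> Pos" "reflection \<sigma> \<beta> \<noteq> \<sigma>"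
proof -
  have "\<exists>\<tau>\<in>S. \<tau> \<noteq> \<sigma> \<and> coord \<beta> \<tau> > 0"
  proof (rule ccontr)
    assume "\<not> ?thesis"
    then have z: "\<forall>\<tau>\<in>S - {\<sigma>}. coord \<beta> \<tau> = 0"
      using coord_nonneg[OF pos_cone[OF assms(2)]] by force
    have "\<beta> = (\<Sum>\<tau>\<in>S. coord \<beta> \<tau> *\<^sub>R \<tau>)" by (simp add: sum_coord)
    also have "\<dots> = coord \<beta> \<sigma> *\<^sub>R \<sigma> + (\<Sum>\<tau>\<in>S - {\<sigma>}. coord \<beta> \<tau> *\<^sub>R \<tau>)"
      using assms by (simp add: sum.remove)
    also have "\<dots> = coord \<beta> \<sigma> *\<^sub>R \<sigma>" using z by simp
    finally have e: "\<beta> = coord \<beta> \<sigma> *\<^sub>R \<sigma>" .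
    then have "coord \<beta> \<sigma> *\<^sub>R \<sigma> \<in> \<Phi>" using assms pos_root by metis
    then have "coord \<beta> \<sigma> = 1 \<or> coord \<beta> \<sigma> = -1"
      using root_system assms simple_roots by (auto simp: root_system_def)
    moreover have "coord \<beta> \<sigma> \<ge> 0" using assms coord_nonneg pos_cone by blast
    ultimately show False using e assms by auto
  qed
  then obtain \<tau> where t: "\<tau> \<in> S" "\<tau> \<noteq> \<sigma>" "coord \<beta> \<tau> > 0" by blast
  have c: "coord (reflection \<sigma> \<beta>) \<tau> > 0"
    using t assms by (simp add: reflection_def coord_diff coord_scale coord_simple)
  have "reflection \<sigma> \<beta> \<in> \<Phi>" using assms pos_root simple_pos reflection_root by blast
  moreover have "- reflection \<sigma> \<beta> \<notin> Pos"
    using c t coord_nonneg[OF pos_cone, of "- reflection \<sigma> \<beta>" \<tau>] by (auto simp: coord_uminus)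
  ultimately show "reflection \<sigma> \<beta> \<in> Pos" using neg_pos_iff by blast
  show "reflection \<sigma> \<beta> \<noteq> \<sigma>" using c t assms by (auto simp: coord_simple)
qed

lemma simple_reflection_neg:
  "\<sigma> \<in> S \<Longrightarrow> \<beta> \<in> Pos \<Longrightarrow> reflection \<sigma> \<beta> \<notin> Pos \<Longrightarrow> \<beta> = \<sigma>"
  using simple_reflection_pos by blast

lemma simple_reflection_bij:
  assumes "\<sigma> \<in> S"
  shows "bij_betw (reflection \<sigma>) (Pos - {\<sigma>}) (Pos - {\<sigma>})"
  by (rule bij_betw_byWitness[of _ "reflection \<sigma>"])
     (use assms simple_reflection_pos in auto)

text \<open>The reflection permutes the positive roots other than \<sigma> and negates \<sigma>, so
  half of their sum loses exactly \<sigma>.\<close>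

lemma reflection_weyl_vector:
  assumes "\<sigma> \<in> S"
  shows "reflection \<sigma> \<rho> = \<rho> - \<sigma>"
proof -
  let ?r = "reflection \<sigma>"
  have \<rho>: "\<rho> = (1/2) *\<^sub>R (\<sigma> + \<Sum>(Pos - {\<sigma>}))"
    unfolding weyl_vector_def using simple_pos[OF assms] by (simp add: sum.remove)
  have "?r (\<Sum>(Pos - {\<sigma>})) = (\<Sum>\<alpha>\<in>Pos - {\<sigma>}. ?r \<alpha>)"
    by (rule linear_sum[OF linear_reflection])
  also have "\<dots> = \<Sum>(Pos - {\<sigma>})"
    using sum.reindex_bij_betw[OF simple_reflection_bij[OF assms], of "\<lambda>x. x"] .
  finally have s: "?r (\<Sum>(Pos - {\<sigma>})) = \<Sum>(Pos - {\<sigma>})" .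
  have "?r \<rho> = (1/2) *\<^sub>R (- \<sigma> + \<Sum>(Pos - {\<sigma>}))"
    unfolding \<rho> by (simp add: linear_cmul[OF linear_reflection] linear_add[OF linear_reflection] s)
  also have "\<dots> = \<rho> - \<sigma>"
    unfolding \<rho> scaleR_add_right using scaleR_half_double[of \<sigma>] by (simp add: algebra_simps)
  finally show ?thesis .
qed

lemma coroot_pairing_weyl_vector: "\<sigma> \<in> S \<Longrightarrow> coroot_pairing \<rho> \<sigma> = 1"
  using reflection_weyl_vector[of \<sigma>] zero_not_root simple_roots
    scaleR_cancel_right[of "coroot_pairing \<rho> \<sigma>" \<sigma> 1]
  by (auto simp: reflection_def)

lemma inner_simple_self: "\<sigma> \<in> S \<Longrightarrow> \<sigma> \<bullet> \<sigma> > 0"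
  using zero_not_root simple_roots by auto

lemma inner_simple_sign:
  assumes "\<sigma> \<in> S"
  shows "x \<bullet> \<sigma> \<ge> 0 \<longleftrightarrow> coroot_pairing x \<sigma> \<ge> 0" "x \<bullet> \<sigma> > 0 \<longleftrightarrow> coroot_pairing x \<sigma> > 0"
    "x \<bullet> \<sigma> = 0 \<longleftrightarrow> coroot_pairing x \<sigma> = 0"
proof -
  have "\<sigma> \<noteq> 0" using inner_simple_self[OF assms] by auto
  then show "x \<bullet> \<sigma> \<ge> 0 \<longleftrightarrow> coroot_pairing x \<sigma> \<ge> 0" "x \<bullet> \<sigma> > 0 \<longleftrightarrow> coroot_pairing x \<sigma> > 0"
    "x \<bullet> \<sigma> = 0 \<longleftrightarrow> coroot_pairing x \<sigma> = 0"
    using inner_ge_zero[of \<sigma>]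
    using inner_simple_self[OF assms]
    by (auto simp: coroot_pairing_def zero_le_divide_iff zero_less_divide_iff simp del: inner_gt_zero_iff)
qed

lemma weyl_vector_inner_simple: "\<sigma> \<in> S \<Longrightarrow> \<rho> \<bullet> \<sigma> > 0"
  by (simp add: inner_simple_sign coroot_pairing_weyl_vector)

lemma weyl_root: "w \<in> W \<Longrightarrow> \<alpha> \<in> \<Phi> \<Longrightarrow> w \<alpha> \<in> \<Phi>"
  by (induction rule: weyl_group.induct) (auto intro: reflection_root)

lemma weyl_eqI:
  assumes "u \<in> W" "w \<in> W" "\<And>\<alpha>. \<alpha> \<in> \<Phi> \<Longrightarrow> u \<alpha> = w \<alpha>"
  shows "u = w"
  using linear_eq_on_span[of u w \<Phi>] assms span_roots by (auto simp: weyl_group_linear)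

text \<open>The roots span, so an element of W is determined by its restriction to \<Phi>, which it
  maps into itself.\<close>

lemma finite_weyl [simp]: "finite W"
proof (rule finite_imageD)
  show "finite ((\<lambda>w. restrict w \<Phi>) ` W)"
    by (rule finite_subset[of _ "\<Phi> \<rightarrow>\<^sub>E \<Phi>"]) (auto intro: weyl_root finite_PiE)
  show "inj_on (\<lambda>w. restrict w \<Phi>) W"
    by (rule inj_onI) (metis weyl_eqI restrict_apply')
qed

lemma card_weyl_pos: "card W > 0"
  using weyl_group_id by (auto simp: card_gt_0_iff)

section \<open>Words in simple reflections, length and sign\<close>

definition word :: "'a list \<Rightarrow> 'a \<Rightarrow> 'a" where
  "word \<sigma>s = foldr (\<lambda>\<sigma> v. reflection \<sigma> \<circ> v) \<sigma>s id"

lemma word_Nil [simp]: "word [] = id" and word_Cons [simp]: "word (\<sigma> # \<sigma>s) = reflection \<sigma> \<circ> word \<sigma>s"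
  by (simp_all add: word_def)

lemma word_append: "word (xs @ ys) = word xs \<circ> word ys"
  by (induction xs) (auto simp: comp_assoc)

lemma word_weyl: "set \<sigma>s \<subseteq> S \<Longrightarrow> word \<sigma>s \<in> W"
  using simple_roots by (induction \<sigma>s) (auto intro: weyl_group.intros)

lemma word_rev: "word (rev xs) \<circ> word xs = id"
proof (induction xs)
  case (Cons a xs)
  have "word (rev (a # xs)) \<circ> word (a # xs) = word (rev xs) \<circ> (reflection a \<circ> reflection a) \<circ> word xs"
    by (simp add: word_append comp_assoc del: reflection_comp_self)
  then show ?case using Cons by (simp del: word_Cons rev.simps)
qed simp

lemma word_inv: "set xs \<subseteq> S \<Longrightarrow> inv (word xs) = word (rev xs)"
  using word_rev[of xs] word_weyl[of xs] weyl_group_bij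
  by (metis inv_unique_comp word_rev rev_rev_ident)

text \<open>Expanding (\<beta>, \<beta>) > 0 in simple roots gives a \<sigma> with (\<beta>,
  \<sigma>) > 0. Unless \<beta> is simple, reflecting in \<sigma> keeps it positive and lowers its
  height.\<close>

lemma pos_conjugate_simple: "\<beta> \<in> Pos \<Longrightarrow> \<exists>\<sigma>s \<sigma>. set \<sigma>s \<subseteq> S \<and> \<sigma> \<in> S \<and> \<beta> = word \<sigma>s \<sigma>"
proof (induction "nat \<lfloor>height \<beta>\<rfloor>" arbitrary: \<beta> rule: less_induct)
  case less
  show ?case
  proof (cases "\<beta> \<in> S")
    case True
    then show ?thesis by (intro exI[of _ "[]"] exI[of _ \<beta>]) simp
  next
    case False
    have "\<beta> \<noteq> 0" using less pos_root zero_not_root by blast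
    have "\<beta> \<bullet> \<beta> = \<beta> \<bullet> (\<Sum>\<sigma>\<in>S. coord \<beta> \<sigma> *\<^sub>R \<sigma>)" by (simp add: sum_coord)
    also have "\<dots> = (\<Sum>\<sigma>\<in>S. coord \<beta> \<sigma> * (\<beta> \<bullet> \<sigma>))" by (simp add: inner_sum_right)
    finally have "(\<Sum>\<sigma>\<in>S. coord \<beta> \<sigma> * (\<beta> \<bullet> \<sigma>)) > 0" using \<open>\<beta> \<noteq> 0\<close> by (metis inner_gt_zero_iff)
    then obtain \<sigma> where s: "\<sigma> \<in> S" "coord \<beta> \<sigma> * (\<beta> \<bullet> \<sigma>) > 0"
      by (meson not_le sum_nonpos)
    moreover have "coord \<beta> \<sigma> \<ge> 0" using less s coord_nonneg pos_cone by blast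
    ultimately have "\<beta> \<bullet> \<sigma> > 0" by (simp add: zero_less_mult_iff)
    then have p: "coroot_pairing \<beta> \<sigma> > 0" using s by (simp add: inner_simple_sign)
    let ?b = "reflection \<sigma> \<beta>"
    have b: "?b \<in> Pos" using simple_reflection_pos s less False by blast
    have "height \<sigma> = 1" using s by (simp add: height_def coord_simple)
    then have h: "height ?b < height \<beta>"
      using p by (simp add: reflection_def height_diff height_scale)
    have "nat \<lfloor>height ?b\<rfloor> < nat \<lfloor>height \<beta>\<rfloor>"
      using h height_nat[OF pos_cone[OF b]] height_nat[OF pos_cone[OF less(2)]]
      by (auto elim!: Nats_cases)
    from less(1)[OF this b] obtain \<sigma>s \<tau> where "set \<sigma>s \<subseteq> S" "\<tau> \<in> S" "?b = word \<sigma>s \<tau>" by blast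
    moreover from this have "\<beta> = word (\<sigma> # \<sigma>s) \<tau>" by (simp add: \<open>?b = _\<close>[symmetric])
    ultimately show ?thesis using s by (intro exI[of _ "\<sigma> # \<sigma>s"] exI[of _ \<tau>]) simp
  qed
qed

lemma reflection_uminus: "reflection (- \<alpha>) = reflection \<alpha>"
  by (simp add: fun_eq_iff reflection_def coroot_pairing_def)

text \<open>Conjugating a simple reflection by a word gives a palindrome of odd length. Hence simple
  reflections generate W, and every reflection is odd.\<close>

lemma reflection_word:
  assumes "\<alpha> \<in> \<Phi>"
  obtains \<sigma>s where "set \<sigma>s \<subseteq> S" "reflection \<alpha> = word \<sigma>s" "odd (length \<sigma>s)"
proof -
  have "\<exists>\<beta>\<in>Pos. reflection \<alpha> = reflection \<beta>"
    using pos_or_neg[OF assms] reflection_uminus[of \<alpha>] by metis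
  then obtain \<beta> where "\<beta> \<in> Pos" and r: "reflection \<alpha> = reflection \<beta>" by blast
  then obtain \<sigma>s \<sigma> where w: "set \<sigma>s \<subseteq> S" "\<sigma> \<in> S" "\<beta> = word \<sigma>s \<sigma>" using pos_conjugate_simple by blast
  have "reflection \<alpha> = word (\<sigma>s @ [\<sigma>] @ rev \<sigma>s)"
    using w r reflection_conjugate[OF word_weyl[OF w(1)], of \<sigma>] by (simp add: word_append word_inv comp_assoc)
  then show ?thesis using that[of "\<sigma>s @ [\<sigma>] @ rev \<sigma>s"] w by simp
qed

lemma weyl_word: "w \<in> W \<Longrightarrow> \<exists>\<sigma>s. set \<sigma>s \<subseteq> S \<and> w = word \<sigma>s"
proof (induction rule: weyl_group.induct)
  case weyl_group_id
  then show ?case by (intro exI[of _ "[]"]) simp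
next
  case (weyl_group_step w \<alpha>)
  then show ?case using reflection_word[of \<alpha>] word_append by (metis set_append Un_least)
qed

text \<open>A quantity that depends on w alone and not on a word for it; its parity is what makes
  the sign a character.\<close>

definition inversions :: "('a \<Rightarrow> 'a) \<Rightarrow> 'a set" where
  "inversions w = {\<beta>\<in>Pos. w \<beta> \<notin> Pos}"

lemma finite_inversions [simp]: "finite (inversions w)"
  by (simp add: inversions_def)

text \<open>Since \<open>reflection \<sigma>\<close> permutes the positive roots other than
  \<sigma>, it matches the inversions other than \<sigma>; only the membership of \<sigma> itself is
  toggled.\<close>

lemma inversions_simple:
  assumes w: "w \<in> W" and s: "\<sigma> \<in> S"
  shows "card (inversions (w \<circ> reflection \<sigma>)) = (if w \<sigma> \<in> Pos then card (inversions w) + 1 else card (inversions w) - 1)"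
    and "w \<sigma> \<notin> Pos \<Longrightarrow> card (inversions w) > 0"
proof -
  let ?r = "reflection \<sigma>"
  let ?A = "inversions w - {\<sigma>}"
  have sp: "\<sigma> \<in> Pos" "\<sigma> \<in> \<Phi>" using s simple_pos pos_root by auto
  have img: "inversions (w \<circ> ?r) - {\<sigma>} = ?r ` ?A"
  proof (intro equalityI subsetI)
    fix x assume "x \<in> inversions (w \<circ> ?r) - {\<sigma>}"
    then have "?r x \<in> ?A" using simple_reflection_pos s by (auto simp: inversions_def)
    then show "x \<in> ?r ` ?A" by (metis imageI reflection_reflection)
  next
    fix x assume "x \<in> ?r ` ?A"
    then show "x \<in> inversions (w \<circ> ?r) - {\<sigma>}" using simple_reflection_pos s by (auto simp: inversions_def)
  qed
  have ca: "card (inversions (w \<circ> ?r) - {\<sigma>}) = card ?A"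
    unfolding img by (rule card_image) (metis inj_onI reflection_reflection)
  have neg: "(w \<circ> ?r) \<sigma> = - w \<sigma>" using w by (simp add: weyl_simps)
  have "\<sigma> \<in> inversions w \<longleftrightarrow> w \<sigma> \<notin> Pos" using sp by (simp add: inversions_def)
  moreover have "\<sigma> \<in> inversions (w \<circ> ?r) \<longleftrightarrow> w \<sigma> \<in> Pos"
    using sp neg neg_pos_iff[OF weyl_root[OF w sp(2)]] by (simp add: inversions_def)
  ultimately show "card (inversions (w \<circ> ?r)) = (if w \<sigma> \<in> Pos then card (inversions w) + 1 else card (inversions w) - 1)"
    using ca by (auto simp: card_Diff_singleton_if card_gt_0_iff split: if_splits)
       (metis Suc_pred card_gt_0_iff empty_iff finite_inversions)
  show "w \<sigma> \<notin> Pos \<Longrightarrow> card (inversions w) > 0"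
    using \<open>\<sigma> \<in> inversions w \<longleftrightarrow> w \<sigma> \<notin> Pos\<close> by (auto simp: card_gt_0_iff)
qed

lemma inversions_parity:
  assumes "w \<in> W" "\<sigma> \<in> S"
  shows "(-1::real) ^ card (inversions (w \<circ> reflection \<sigma>)) = - ((-1) ^ card (inversions w))"
  using inversions_simple[OF assms] by (cases "card (inversions w)") auto

lemma inversions_word: "set \<sigma>s \<subseteq> S \<Longrightarrow> (-1::real) ^ card (inversions (word \<sigma>s)) = (-1) ^ length \<sigma>s"
proof (induction \<sigma>s rule: rev_induct)
  case Nil
  then show ?case by (simp add: inversions_def)
next
  case (snoc x xs)
  then show ?case using inversions_parity[OF word_weyl, of xs x] by (simp add: word_append comp_def)
qed

lemma weyl_length_word:
  assumes "w \<in> W"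
  obtains \<sigma>s where "set \<sigma>s \<subseteq> S" "w = word \<sigma>s" "length \<sigma>s = weyl_length S w"
proof -
  have "\<exists>n \<sigma>s. set \<sigma>s \<subseteq> S \<and> length \<sigma>s = n \<and> w = foldr (\<lambda>\<sigma> v. reflection \<sigma> \<circ> v) \<sigma>s id"
    using weyl_word[OF assms] unfolding word_def by blast
  from LeastI_ex[OF this] show ?thesis using that unfolding weyl_length_def word_def by blast
qed

lemma weyl_length_le: "set \<sigma>s \<subseteq> S \<Longrightarrow> weyl_length S (word \<sigma>s) \<le> length \<sigma>s"
  unfolding weyl_length_def word_def by (rule Least_le) blast

text \<open>A shortest word and the given word have lengths of the same parity, namely that of the
  number of inversions.\<close>

lemma weyl_sign_word: "set \<sigma>s \<subseteq> S \<Longrightarrow> weyl_sign S (word \<sigma>s) = (-1) ^ length \<sigma>s"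
  using weyl_length_word[OF word_weyl] inversions_word unfolding weyl_sign_def by metis

lemma weyl_sign_comp:
  assumes "u \<in> W" "v \<in> W"
  shows "weyl_sign S (u \<circ> v) = weyl_sign S u * weyl_sign S v"
proof -
  obtain xs ys where "set xs \<subseteq> S" "u = word xs" "set ys \<subseteq> S" "v = word ys" using weyl_word assms by metis
  then show ?thesis using weyl_sign_word[of "xs @ ys"]
    by (simp add: word_append weyl_sign_word power_add del: comp_apply)
qed

lemma weyl_sign_id [simp]: "weyl_sign S id = 1"
  using weyl_sign_word[of "[]"] by simp

lemma weyl_sign_reflection: "\<alpha> \<in> \<Phi> \<Longrightarrow> weyl_sign S (reflection \<alpha>) = -1"
  by (erule reflection_word) (simp add: weyl_sign_word)

lemma weyl_sign_square [simp]: "weyl_sign S w * weyl_sign S w = 1"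
  by (simp add: weyl_sign_def flip: power_add)

lemma weyl_sign_cases: "weyl_sign S w = 1 \<or> weyl_sign S w = -1"
  unfolding weyl_sign_def by (metis neg_one_even_power neg_one_odd_power)

lemma weyl_sign_inv: 
  assumes "w \<in> W"
  shows "weyl_sign S (inv w) = weyl_sign S w"
proof -
  have "weyl_sign S (inv w) * weyl_sign S w = 1"
    using weyl_sign_comp[OF weyl_group_inv[OF assms] assms] assms by simp
  then show ?thesis using weyl_sign_cases[of w] by auto
qed

text \<open>The exchange condition. Applying the letters from the right, the image of \<sigma>
  starts positive and ends negative, so some letter turns a positive root negative. That root is the
  letter itself, and by conjugation the letter cancels against the extra
  \<open>reflection \<sigma>\<close>.\<close>

lemma word_exchange:
  assumes "set \<sigma>s \<subseteq> S" "\<sigma> \<in> S" "word \<sigma>s \<sigma> \<notin> Pos"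
  shows "\<exists>\<tau>s. set \<tau>s \<subseteq> S \<and> Suc (length \<tau>s) = length \<sigma>s \<and> word \<sigma>s \<circ> reflection \<sigma> = word \<tau>s"
  using assms
proof (induction \<sigma>s)
  case Nil
  then show ?case using simple_pos by simp
next
  case (Cons a xs)
  have xs: "set xs \<subseteq> S" "a \<in> S" using Cons by auto
  note x = word_weyl[OF xs(1)]
  show ?case
  proof (cases "word xs \<sigma> \<in> Pos")
    case True
    then have e: "word xs \<sigma> = a" using simple_reflection_neg[OF xs(2)] Cons(4) by simp
    have "reflection a \<circ> word xs \<circ> reflection \<sigma> = word xs \<circ> reflection \<sigma> \<circ> inv (word xs) \<circ> word xs \<circ> reflection \<sigma>"
      using reflection_conjugate[OF x, of \<sigma>] e by simp
    also have "\<dots> = word xs \<circ> reflection \<sigma> \<circ> (inv (word xs) \<circ> word xs) \<circ> reflection \<sigma>"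
      by (simp only: comp_assoc)
    also have "\<dots> = word xs \<circ> (reflection \<sigma> \<circ> reflection \<sigma>)"
      using x by (simp add: comp_assoc del: reflection_comp_self)
    finally show ?thesis using xs by (intro exI[of _ xs]) (simp add: comp_def)
  next
    case False
    then obtain \<tau>s where "set \<tau>s \<subseteq> S" "Suc (length \<tau>s) = length xs" "word xs \<circ> reflection \<sigma> = word \<tau>s"
      using Cons xs by blast
    then show ?thesis using xs by (intro exI[of _ "a # \<tau>s"]) (simp add: fun_eq_iff)
  qed
qed

text \<open>If a shortest word ends in \<sigma>, positivity of w \<sigma> means that the word
  without its last letter sends \<sigma> to a negative root. The exchange condition then produces a
  word shorter by two.\<close>

lemma weyl_pos_imp_id:
  assumes w: "w \<in> W" and p: "\<And>\<sigma>. \<sigma> \<in> S \<Longrightarrow> w \<sigma> \<in> Pos"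
  shows "w = id"
proof -
  obtain \<sigma>s where s: "set \<sigma>s \<subseteq> S" "w = word \<sigma>s" "length \<sigma>s = weyl_length S w"
    using weyl_length_word w by blast
  show ?thesis
  proof (cases \<sigma>s rule: rev_exhaust)
    case Nil
    then show ?thesis using s by simp
  next
    case (snoc ys \<sigma>)
    have ys: "set ys \<subseteq> S" "\<sigma> \<in> S" using s snoc by auto
    have "w \<sigma> = - word ys \<sigma>" using s snoc word_weyl[OF ys(1)] by (simp add: word_append weyl_simps)
    then have "word ys \<sigma> \<notin> Pos" using p[OF ys(2)] not_pos_uminus by fastforce
    then obtain \<tau>s where ts: "set \<tau>s \<subseteq> S" "Suc (length \<tau>s) = length ys" "word ys \<circ> reflection \<sigma> = word \<tau>s"
      using word_exchange ys by blast
    have "w = word \<tau>s" using s snoc ts(3) word_append[of ys "[\<sigma>]"] by simp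
    then have "weyl_length S w < length \<sigma>s"
      using weyl_length_le[of \<tau>s] snoc ts by simp
    then show ?thesis using s by simp
  qed
qed

section \<open>Dominant vectors, chambers and the longest element\<close>

lemma strictly_dominant_pos:
  assumes "\<And>\<sigma>. \<sigma> \<in> S \<Longrightarrow> x \<bullet> \<sigma> > 0" "\<beta> \<in> Pos"
  shows "x \<bullet> \<beta> > 0"
proof -
  have "x \<bullet> \<beta> = (\<Sum>\<sigma>\<in>S. coord \<beta> \<sigma> * (x \<bullet> \<sigma>))"
    by (subst sum_coord[of \<beta>, symmetric]) (simp add: inner_sum_right)
  moreover have "\<dots> \<ge> 0"
    using assms coord_nonneg[OF pos_cone] by (intro sum_nonneg mult_nonneg_nonneg) (auto intro: less_imp_le)
  moreover have "\<dots> \<noteq> 0"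
  proof
    assume "(\<Sum>\<sigma>\<in>S. coord \<beta> \<sigma> * (x \<bullet> \<sigma>)) = 0"
    then have "\<forall>\<sigma>\<in>S. coord \<beta> \<sigma> * (x \<bullet> \<sigma>) = 0"
      using assms coord_nonneg[OF pos_cone]
      by (subst (asm) sum_nonneg_eq_0_iff) (auto intro: mult_nonneg_nonneg less_imp_le)
    then have "\<beta> = 0" using assms eq_zero_iff_coord by force
    then show False using assms pos_root zero_not_root by blast
  qed
  ultimately show ?thesis by simp
qed

text \<open>Simple transitivity on chambers: (w x, w \<sigma>) = (x, \<sigma>) > 0 excludes that the
  root w \<sigma> is negative.\<close>

lemma weyl_strictly_dominant_eq:
  assumes w: "w \<in> W" and x: "\<And>\<sigma>. \<sigma> \<in> S \<Longrightarrow> x \<bullet> \<sigma> > 0" and y: "\<And>\<sigma>. \<sigma> \<in> S \<Longrightarrow> w x \<bullet> \<sigma> > 0"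
  shows "w = id"
proof (rule weyl_pos_imp_id[OF w])
  fix \<sigma> assume s: "\<sigma> \<in> S"
  have "w x \<bullet> w \<sigma> > 0" using x s w by (simp add: weyl_group_inner)
  then have "- w \<sigma> \<notin> Pos" using strictly_dominant_pos[OF y, of "- w \<sigma>"] by auto
  then show "w \<sigma> \<in> Pos" using neg_pos_iff weyl_root[OF w] s simple_roots by blast
qed

lemma weyl_fix_weyl_vector: "w \<in> W \<Longrightarrow> w \<rho> = \<rho> \<Longrightarrow> w = id"
  using weyl_strictly_dominant_eq[of w \<rho>] weyl_vector_inner_simple by simp

text \<open>\<rho> is strictly dominant, so its stabiliser is trivial. This makes the coefficients
  of the denominator signs, and it recovers a Weyl element from the exponent at the end of a
  leg.\<close>

lemma weyl_vector_orbit_inj: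
  assumes "u \<in> W" "w \<in> W" "u \<rho> = w \<rho>"
  shows "u = w"
proof -
  have "inv u \<circ> w = id"
    using weyl_fix_weyl_vector[of "inv u \<circ> w"] assms weyl_group_comp[OF weyl_group_inv]
    by (metis comp_apply weyl_inv_apply(1))
  then have "u \<circ> (inv u \<circ> w) = u" by simp
  then show ?thesis using assms by (simp add: comp_assoc[symmetric])
qed

text \<open>Maximise the pairing with \<rho> over the finite orbit:
  \<open>reflection \<sigma>\<close> changes it by -(w x, \<sigma>), which cannot be positive at a
  maximum.\<close>

lemma exists_dominant_translate: "\<exists>w\<in>W. \<forall>\<sigma>\<in>S. w x \<bullet> \<sigma> \<ge> 0"
proof -
  have "finite ((\<lambda>w. w x \<bullet> \<rho>) ` W)" "(\<lambda>w. w x \<bullet> \<rho>) ` W \<noteq> {}" using weyl_group_id by auto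
  then obtain w where w: "w \<in> W" and m: "\<And>u. u \<in> W \<Longrightarrow> u x \<bullet> \<rho> \<le> w x \<bullet> \<rho>"
    using Max_in Max_ge by (smt (verit) imageE imageI)
  have "w x \<bullet> \<sigma> \<ge> 0" if s: "\<sigma> \<in> S" for \<sigma>
  proof -
    have "reflection \<sigma> (w x) \<bullet> \<rho> = w x \<bullet> reflection \<sigma> \<rho>"
      using reflection_inner[of \<sigma> "w x" "reflection \<sigma> \<rho>"] by simp
    also have "\<dots> = w x \<bullet> \<rho> - w x \<bullet> \<sigma>" by (simp add: reflection_weyl_vector[OF s] inner_diff_right)
    finally show ?thesis using m[of "reflection \<sigma> \<circ> w"] weyl_group_step[OF w] s simple_roots by force
  qed
  then show ?thesis using w by blast
qed

text \<open>Choose w with w (-\<rho>) dominant. If w \<beta> were positive for a positive \<beta>,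
  pairing the two would give (\<rho>, \<beta>) \<le> 0.\<close>

lemma longest_element: "\<exists>w\<in>W. \<forall>\<beta>\<in>Pos. - w \<beta> \<in> Pos"
proof -
  obtain w where w: "w \<in> W" and d: "\<forall>\<sigma>\<in>S. w (- \<rho>) \<bullet> \<sigma> \<ge> 0" using exists_dominant_translate by blast
  have "- w \<beta> \<in> Pos" if b: "\<beta> \<in> Pos" for \<beta>
  proof (rule ccontr)
    assume "- w \<beta> \<notin> Pos"
    then have wb: "w \<beta> \<in> Pos" using neg_pos_iff weyl_root[OF w pos_root[OF b]] by blast
    have "w (- \<rho>) \<bullet> w \<beta> = (\<Sum>\<sigma>\<in>S. coord (w \<beta>) \<sigma> * (w (- \<rho>) \<bullet> \<sigma>))"
      by (subst sum_coord[of "w \<beta>", symmetric]) (simp add: inner_sum_right)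
    also have "\<dots> \<ge> 0" using d coord_nonneg[OF pos_cone[OF wb]] by (intro sum_nonneg) simp
    finally have "\<rho> \<bullet> \<beta> \<le> 0" by (simp add: weyl_group_inner[OF w])
    then show False using strictly_dominant_pos[OF weyl_vector_inner_simple b] by simp
  qed
  then show ?thesis using w by blast
qed

section \<open>The root lattice and its coset Q + \<rho>\<close>

lemma root_in_lattice: "\<alpha> \<in> \<Phi> \<Longrightarrow> \<alpha> \<in> Q"
  unfolding root_lattice_def
  by (intro CollectI exI[of _ "\<lambda>\<beta>. if \<beta> = \<alpha> then 1 else 0"])
     (simp add: if_distrib[of of_int] if_distrib[of "\<lambda>c. c *\<^sub>R _"] sum.delta cong: if_cong)

lemma weyl_root_lattice: 
  assumes "w \<in> W" "x \<in> Q"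
  shows "w x \<in> Q"
proof -
  from assms obtain c where "x = (\<Sum>\<alpha>\<in>\<Phi>. real_of_int (c \<alpha>) *\<^sub>R \<alpha>)" by (auto simp: root_lattice_def)
  then have "w x = (\<Sum>\<alpha>\<in>\<Phi>. real_of_int (c \<alpha>) *\<^sub>R w \<alpha>)" using assms by (simp add: weyl_simps)
  also have "\<dots> \<in> Q"
    by (rule root_lattice_sum, rule root_lattice_scale, rule root_in_lattice, rule weyl_root) (use assms in auto)
  finally show ?thesis .
qed

lemma nonneg_cone_lattice: "x \<in> nonneg_cone S \<Longrightarrow> x \<in> Q"
  unfolding nonneg_cone_def
  by clarify (rule root_lattice_sum, rule root_lattice_scale, rule root_in_lattice, use simple_roots in auto)

lemma double_weyl_vector_lattice: "2 *\<^sub>R \<rho> \<in> Q"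
  unfolding weyl_vector_def scaleR_scaleR
  by simp (rule root_lattice_sum, rule root_in_lattice, rule pos_root)

lemma weyl_vector_diff_lattice: "w \<in> W \<Longrightarrow> w \<rho> - \<rho> \<in> Q"
proof (induction rule: weyl_group.induct)
  case weyl_group_id
  then show ?case by (simp add: root_lattice_zero)
next
  case (weyl_group_step w \<alpha>)
  \<comment> \<open>A simple reflection moves \<rho> by a simple root; an arbitrary reflection is
    reached through a word.\<close>
  have r: "reflection \<alpha> \<rho> - \<rho> \<in> Q" if a: "\<alpha> \<in> \<Phi>" for \<alpha>
  proof -
    obtain \<sigma>s where s: "set \<sigma>s \<subseteq> S" "reflection \<alpha> = word \<sigma>s" using reflection_word[OF a] .
    have "set \<sigma>s \<subseteq> S \<Longrightarrow> word \<sigma>s \<rho> - \<rho> \<in> Q" for \<sigma>s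
    proof (induction \<sigma>s)
      case (Cons a xs)
      then have a: "a \<in> S" "a \<in> \<Phi>" using simple_roots by auto
      have "word (a # xs) \<rho> - \<rho> = reflection a (word xs \<rho> - \<rho>) - a"
        using a by (simp add: linear_diff[OF linear_reflection] reflection_weyl_vector)
      also have "\<dots> \<in> Q" using Cons a weyl_root_lattice[OF weyl_group_reflection[OF a(2)]]
        by (intro root_lattice_diff) (auto intro: root_in_lattice)
      finally show ?case .
    qed (simp add: root_lattice_zero)
    from this[OF s(1)] show ?thesis using s(2) by simp
  qed
  have "(reflection \<alpha> \<circ> w) \<rho> - \<rho> = reflection \<alpha> (w \<rho> - \<rho>) + (reflection \<alpha> \<rho> - \<rho>)"
    by (simp add: linear_diff[OF linear_reflection])
  also have "\<dots> \<in> Q"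
    using weyl_group_step weyl_root_lattice[OF weyl_group_reflection] by (intro root_lattice_add r) auto
  finally show ?case .
qed

lemma coroot_pairing_root: "\<alpha> \<in> \<Phi> \<Longrightarrow> \<beta> \<in> \<Phi> \<Longrightarrow> coroot_pairing \<beta> \<alpha> \<in> \<int>"
  using root_system by (auto simp: root_system_def)

lemma coroot_pairing_lattice: "\<alpha> \<in> \<Phi> \<Longrightarrow> x \<in> Q \<Longrightarrow> coroot_pairing x \<alpha> \<in> \<int>"
  unfolding root_lattice_def
  by clarify (simp only: coroot_pairing_sum coroot_pairing_scaleR,
      rule Ints_sum, rule Ints_mult, rule Ints_of_int, rule coroot_pairing_root)

text \<open>Move the root to a simple one: \<rho> pairs to 1 with a simple coroot, and the
  displacement of \<rho> lies in Q, which pairs integrally.\<close>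

lemma weyl_vector_weight:
  assumes "\<alpha> \<in> \<Phi>"
  shows "coroot_pairing \<rho> \<alpha> \<in> \<int>"
proof -
  have pos: "coroot_pairing \<rho> \<beta> \<in> \<int>" if b: "\<beta> \<in> Pos" for \<beta>
  proof -
    obtain \<sigma>s \<sigma> where w: "set \<sigma>s \<subseteq> S" "\<sigma> \<in> S" "\<beta> = word \<sigma>s \<sigma>" using pos_conjugate_simple[OF b] by blast
    define u where "u = word \<sigma>s"
    have u: "u \<in> W" using w word_weyl u_def by blast
    have "coroot_pairing \<rho> \<beta> = coroot_pairing (u (inv u \<rho>)) (u \<sigma>)" using u w u_def by simp
    also have "\<dots> = coroot_pairing (\<rho> + (inv u \<rho> - \<rho>)) \<sigma>" using u by (simp only: coroot_pairing_weyl) simp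
    also have "\<dots> = 1 + coroot_pairing (inv u \<rho> - \<rho>) \<sigma>" using w by (simp only: coroot_pairing_add coroot_pairing_weyl_vector)
    also have "\<dots> \<in> \<int>"
      using w simple_roots weyl_vector_diff_lattice[OF weyl_group_inv[OF u]]
      by (intro Ints_add Ints_1 coroot_pairing_lattice) auto
    finally show ?thesis .
  qed
  have "coroot_pairing \<rho> (- \<alpha>) = - coroot_pairing \<rho> \<alpha>" by (simp add: coroot_pairing_def)
  then show ?thesis using pos_or_neg[OF assms] pos[of \<alpha>] pos[of "- \<alpha>"] by (metis Ints_minus minus_minus)
qed

lemma shifted_iff: "x \<in> shifted_root_lattice \<Phi> S \<longleftrightarrow> x - \<rho> \<in> Q"
  unfolding shifted_root_lattice_def by (auto intro: image_eqI[of _ _ "x - \<rho>"])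

lemma shifted_weyl_iff:
  assumes "w \<in> W"
  shows "w x \<in> shifted_root_lattice \<Phi> S \<longleftrightarrow> x \<in> shifted_root_lattice \<Phi> S"
proof -
  have *: "u x \<in> shifted_root_lattice \<Phi> S" if u: "u \<in> W" and "x \<in> shifted_root_lattice \<Phi> S" for u x
  proof -
    have "u x - \<rho> = u (x - \<rho>) + (u \<rho> - \<rho>)" using u by (simp add: weyl_simps)
    also have "\<dots> \<in> Q" using that weyl_root_lattice[OF u] by (intro root_lattice_add weyl_vector_diff_lattice) (auto simp: shifted_iff)
    finally show ?thesis by (simp add: shifted_iff)
  qed
  show ?thesis using *[OF assms] *[OF weyl_group_inv[OF assms]] weyl_inv_apply(1)[OF assms, of x] by fastforce
qed

lemma shifted_weight: "x \<in> shifted_root_lattice \<Phi> S \<Longrightarrow> x \<in> weight_lattice \<Phi>"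
proof -
  assume "x \<in> shifted_root_lattice \<Phi> S"
  then have "coroot_pairing (\<rho> + (x - \<rho>)) \<alpha> \<in> \<int>" if "\<alpha> \<in> \<Phi>" for \<alpha>
    unfolding coroot_pairing_add using that
    by (intro Ints_add weyl_vector_weight coroot_pairing_lattice) (simp_all add: shifted_iff)
  then show ?thesis by (simp add: weight_lattice_def)
qed

end

section \<open>The Weyl denominator and its inverses\<close>

context based_root_system
begin

lemma antisymmetric_weylI:
  fixes f :: "'a \<Rightarrow> real"
  assumes "\<And>\<sigma> x. \<sigma> \<in> S \<Longrightarrow> f (reflection \<sigma> x) = - f x" and w: "w \<in> W"
  shows "f (w x) = weyl_sign S w * f x"
proof -
  have "set \<sigma>s \<subseteq> S \<Longrightarrow> f (word \<sigma>s x) = (-1) ^ length \<sigma>s * f x" for \<sigma>s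
    by (induction \<sigma>s) (auto simp: assms(1))
  then show ?thesis using weyl_word[OF w] weyl_sign_word by metis
qed

text \<open>The reflection in \<sigma> fixes x and has sign -1.\<close>

lemma antisymmetric_singular:
  fixes f :: "'a \<Rightarrow> real"
  assumes "\<And>w x. w \<in> W \<Longrightarrow> f (w x) = weyl_sign S w * f x" "\<sigma> \<in> S" "x \<bullet> \<sigma> = 0"
  shows "f x = 0"
proof -
  have "reflection \<sigma> x = x" using assms by (simp add: reflection_def coroot_pairing_def)
  then have "f x = - f x"
    using assms(1)[of "reflection \<sigma>" x] assms(2) simple_roots
    by (simp add: weyl_sign_reflection weyl_group_reflection subset_iff)
  then show ?thesis by simp
qed

text \<open>A dominant translate of x cannot lie on a wall, where an antisymmetric function
  vanishes.\<close>

lemma antisymmetric_regular: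
  fixes f :: "'a \<Rightarrow> real"
  assumes f: "\<And>w x. w \<in> W \<Longrightarrow> f (w x) = weyl_sign S w * f x" and "f x \<noteq> 0"
  obtains w where "w \<in> W" "\<And>\<sigma>. \<sigma> \<in> S \<Longrightarrow> w x \<bullet> \<sigma> > 0"
proof -
  obtain w where w: "w \<in> W" "\<forall>\<sigma>\<in>S. w x \<bullet> \<sigma> \<ge> 0" using exists_dominant_translate by blast
  have "f (w x) \<noteq> 0" using assms w weyl_sign_cases[of w] by auto
  then have "w x \<bullet> \<sigma> \<noteq> 0" if "\<sigma> \<in> S" for \<sigma> using antisymmetric_singular[of f \<sigma> "w x"] f that by blast
  then show ?thesis using that[OF w(1)] w(2) by (simp add: order_less_le)
qed

text \<open>The coefficients of \<open>x\<^bsup>\<rho>\<^esup> \<Prod>\<^sub>\<alpha> (1 - x\<^bsup>-\<alpha>\<^esup>)\<close>, expanded over subsets of the positive roots.\<close>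

definition product_coeff :: "'a \<Rightarrow> real" where
  "product_coeff k = (\<Sum>A | A \<subseteq> Pos \<and> \<rho> - \<Sum>A = k. (-1) ^ card A)"

text \<open>Toggling \<sigma> in A and reflecting the other members is an involution on the subsets
  of the positive roots. It reverses the parity of A and carries the exponent to its
  reflection.\<close>

lemma product_coeff_reflection:
  assumes s: "\<sigma> \<in> S"
  shows "product_coeff (reflection \<sigma> k) = - product_coeff k"
proof -
  let ?r = "reflection \<sigma>"
  define flip where "flip A = ?r ` (A - {\<sigma>}) \<union> (if \<sigma> \<in> A then {} else {\<sigma>})" for A
  have inj: "inj_on ?r B" for B by (metis inj_onI reflection_reflection)
  have ns: "\<sigma> \<notin> ?r ` (A - {\<sigma>})" if "A \<subseteq> Pos" for A
    using simple_reflection_pos[OF s] that by fastforce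
  have sub: "flip A \<subseteq> Pos" if "A \<subseteq> Pos" for A
    using simple_reflection_pos[OF s] simple_pos[OF s] that unfolding flip_def by auto
  have mem: "\<sigma> \<in> flip A \<longleftrightarrow> \<sigma> \<notin> A" if "A \<subseteq> Pos" for A
    using ns[OF that] unfolding flip_def by (cases "\<sigma> \<in> A") auto
  have rem: "flip A - {\<sigma>} = ?r ` (A - {\<sigma>})" if "A \<subseteq> Pos" for A
    using ns[OF that] unfolding flip_def by (cases "\<sigma> \<in> A") auto
  have flip2: "flip (flip A) = A" if A: "A \<subseteq> Pos" for A
  proof -
    have "flip (flip A) = ?r ` ?r ` (A - {\<sigma>}) \<union> (if \<sigma> \<in> A then {\<sigma>} else {})"
      unfolding flip_def[of "flip A"] rem[OF A] using mem[OF A] by simp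
    then show ?thesis by (auto simp: image_image)
  qed
  have fin: "finite A" if "A \<subseteq> Pos" for A using that finite_pos finite_subset by blast
  have card: "(-1::real) ^ card (flip A) = - ((-1) ^ card A)" if A: "A \<subseteq> Pos" for A
  proof (cases "\<sigma> \<in> A")
    case True
    then have "card A = Suc (card (flip A))"
      using card.remove[OF fin[OF A] True] by (simp add: flip_def card_image[OF inj])
    then show ?thesis by simp
  next
    case False
    then show ?thesis using ns[OF A] fin[OF A] by (simp add: flip_def card_image[OF inj])
  qed
  have sum: "\<rho> - \<Sum>(flip A) = ?r (\<rho> - \<Sum>A)" if A: "A \<subseteq> Pos" for A
  proof -
    have i: "\<Sum>(?r ` B) = ?r (\<Sum>B)" for B
      by (simp add: sum.reindex[OF inj] linear_sum[OF linear_reflection])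
    show ?thesis
    proof (cases "\<sigma> \<in> A")
      case True
      then have "?r (\<Sum>A) = - \<sigma> + ?r (\<Sum>(A - {\<sigma>}))"
        using fin[OF A] by (simp add: sum.remove linear_add[OF linear_reflection])
      then show ?thesis using True
        by (simp add: flip_def i linear_diff[OF linear_reflection] reflection_weyl_vector[OF s])
    next
      case False
      then show ?thesis using ns[OF A] fin[OF A]
        by (simp add: flip_def i linear_diff[OF linear_reflection] reflection_weyl_vector[OF s])
    qed
  qed
  have "product_coeff (?r k) = (\<Sum>A | A \<subseteq> Pos \<and> \<rho> - \<Sum>A = k. (-1) ^ card (flip A))"
    unfolding product_coeff_def
  proof (rule sum.reindex_bij_witness[of _ flip flip])
    fix A assume "A \<in> {A. A \<subseteq> Pos \<and> \<rho> - \<Sum>A = ?r k}"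
    then show "flip (flip A) = A" "flip A \<in> {A. A \<subseteq> Pos \<and> \<rho> - \<Sum>A = k}"
       "(-1::real) ^ card (flip (flip A)) = (-1) ^ card A"
      using flip2[of A] sub[of A] sum[of A] by auto
  next
    fix A assume "A \<in> {A. A \<subseteq> Pos \<and> \<rho> - \<Sum>A = k}"
    then show "flip (flip A) = A" "flip A \<in> {A. A \<subseteq> Pos \<and> \<rho> - \<Sum>A = ?r k}"
      using flip2[of A] sub[of A] sum[of A] by auto
  qed
  also have "\<dots> = - product_coeff k"
    unfolding product_coeff_def sum_negf[symmetric] by (rule sum.cong) (auto simp: card)
  finally show ?thesis .
qed

lemma product_coeff_weyl: "w \<in> W \<Longrightarrow> product_coeff (w k) = weyl_sign S w * product_coeff k"
  by (rule antisymmetric_weylI) (auto simp: product_coeff_reflection)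

lemma subset_pos_cone: "A \<subseteq> Pos \<Longrightarrow> \<Sum>A \<in> nonneg_cone S"
  by (rule nonneg_cone_sum) (auto intro: pos_cone)

lemma subset_pos_zero:
  assumes "A \<subseteq> Pos" "\<Sum>A = 0"
  shows "A = {}"
proof (rule ccontr)
  assume "A \<noteq> {}"
  have "finite A" using assms finite_pos finite_subset by blast
  then have "(\<Sum>\<alpha>\<in>A. height \<alpha>) > 0"
    using \<open>A \<noteq> {}\<close> assms pos_height by (intro sum_pos) force+
  then show False using height_sum[of "\<lambda>x. x" A] assms height_scale[of 0 0] by simp
qed

lemma product_coeff_nonzero:
  assumes "product_coeff k \<noteq> 0"
  obtains A where "A \<subseteq> Pos" "\<rho> - \<Sum>A = k"
  using assms unfolding product_coeff_def by (rule sum.not_neutral_contains_not_neutral) (use that in blast)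

text \<open>Let g be the sum of A. Integrality turns strict dominance of \<rho> - g into (g,
  \<sigma>) \<le> 0 for every simple \<sigma>. As g is itself a nonnegative combination of simple
  roots, (g, g) \<le> 0.\<close>

lemma product_coeff_dominant:
  assumes nz: "product_coeff k \<noteq> 0" and d: "\<And>\<sigma>. \<sigma> \<in> S \<Longrightarrow> k \<bullet> \<sigma> > 0"
  shows "k = \<rho>"
proof -
  obtain A where A: "A \<subseteq> Pos" "\<rho> - \<Sum>A = k" using product_coeff_nonzero[OF nz] .
  let ?g = "\<Sum>A"
  note g = subset_pos_cone[OF A(1)]
  have "?g \<bullet> \<sigma> \<le> 0" if s: "\<sigma> \<in> S" for \<sigma>
  proof -
    have "\<sigma> \<in> \<Phi>" using s simple_roots by auto
    then have "coroot_pairing ?g \<sigma> \<in> \<int>" using coroot_pairing_lattice nonneg_cone_lattice[OF g] by blast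
    moreover have "coroot_pairing (\<rho> - ?g) \<sigma> > 0" using d[OF s] A inner_simple_sign(2)[OF s] by simp
    then have "coroot_pairing ?g \<sigma> < 1" by (simp add: coroot_pairing_diff coroot_pairing_weyl_vector[OF s])
    ultimately have "coroot_pairing ?g \<sigma> \<le> 0" by (auto elim!: Ints_cases)
    then show ?thesis using inner_simple_sign(2)[OF s] by (simp add: not_less[symmetric])
  qed
  then have "(\<Sum>\<sigma>\<in>S. coord ?g \<sigma> * (?g \<bullet> \<sigma>)) \<le> 0"
    using coord_nonneg[OF g] by (intro sum_nonpos mult_nonneg_nonpos) auto
  also have "(\<Sum>\<sigma>\<in>S. coord ?g \<sigma> * (?g \<bullet> \<sigma>)) = ?g \<bullet> (\<Sum>\<sigma>\<in>S. coord ?g \<sigma> *\<^sub>R \<sigma>)"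
    by (simp add: inner_sum_right)
  also have "\<dots> = ?g \<bullet> ?g" by (simp add: sum_coord)
  finally have "?g = 0" by (metis inner_eq_zero_iff inner_ge_zero order_antisym)
  then show ?thesis using A by simp
qed

lemma product_coeff_weyl_vector: "product_coeff \<rho> = 1"
proof -
  have "{A. A \<subseteq> Pos \<and> \<rho> - \<Sum>A = \<rho>} = {{}}" using subset_pos_zero by auto
  then show ?thesis by (simp add: product_coeff_def)
qed

lemma weyl_denominator_orbit:
  assumes "w \<in> W"
  shows "weyl_denominator \<Phi> S (w \<rho>) = weyl_sign S w"
proof -
  have "{u. u \<in> W \<and> u \<rho> = w \<rho>} = {w}" using weyl_vector_orbit_inj assms by auto
  then show ?thesis by (simp add: weyl_denominator_def)
qed

lemma weyl_denominator_nonzero: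
  assumes "weyl_denominator \<Phi> S k \<noteq> 0"
  obtains w where "w \<in> W" "k = w \<rho>"
  using assms unfolding weyl_denominator_def by (rule sum.not_neutral_contains_not_neutral) (use that in blast)

text \<open>The Weyl denominator identity. Both sides are antisymmetric, and the only strictly
  dominant exponent of the product is \<rho>, with coefficient 1.\<close>

lemma weyl_denominator_product: "weyl_denominator \<Phi> S k = product_coeff k"
proof (cases "product_coeff k = 0")
  case True
  have "weyl_denominator \<Phi> S k = 0"
  proof (rule ccontr)
    assume "weyl_denominator \<Phi> S k \<noteq> 0"
    then obtain w where "w \<in> W" "k = w \<rho>" using weyl_denominator_nonzero by blast
    then show False using True product_coeff_weyl[of w \<rho>] weyl_sign_cases[of w]
      by (auto simp: product_coeff_weyl_vector)
  qed
  then show ?thesis using True by simp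
next
  case False
  then obtain w where w: "w \<in> W" "\<And>\<sigma>. \<sigma> \<in> S \<Longrightarrow> w k \<bullet> \<sigma> > 0"
    using antisymmetric_regular[OF product_coeff_weyl] by blast
  have "product_coeff (w k) \<noteq> 0" using False w product_coeff_weyl[of w k] weyl_sign_cases[of w] by auto
  then have "w k = \<rho>" using product_coeff_dominant w by blast
  then have k: "k = inv w \<rho>" using w(1) by (metis weyl_inv_apply(1))
  have "inv w \<in> W" using w weyl_group_inv by blast
  then show ?thesis using k product_coeff_weyl[of "inv w" \<rho>] weyl_denominator_orbit[of "inv w"]
    by (simp add: product_coeff_weyl_vector)
qed

text \<open>By the denominator identity w \<rho> occurs in the expanded product, so it is \<rho>
  minus a sum of distinct positive roots.\<close>

lemma weyl_vector_orbit_cone: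
  assumes "w \<in> W"
  shows "\<rho> - w \<rho> \<in> nonneg_cone S"
proof -
  have "product_coeff (w \<rho>) \<noteq> 0"
    using weyl_denominator_orbit[OF assms] weyl_denominator_product weyl_sign_cases[of w] by force
  then obtain A where "A \<subseteq> Pos" "\<rho> - \<Sum>A = w \<rho>" using product_coeff_nonzero by blast
  then have "\<rho> - w \<rho> = \<Sum>A" by (auto simp: algebra_simps)
  then show ?thesis using subset_pos_cone \<open>A \<subseteq> Pos\<close> by simp
qed

text \<open>The denominator identity tested against an arbitrary f, obtained by grouping both sums
  by the exponent.\<close>

lemma sum_sign_orbit:
  fixes f :: "'a \<Rightarrow> real"
  shows "(\<Sum>w\<in>W. weyl_sign S w * f (w \<rho>)) = (\<Sum>A\<in>Pow Pos. (-1) ^ card A * f (\<rho> - \<Sum>A))"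
proof -
  let ?K = "(\<lambda>w. w \<rho>) ` W \<union> (\<lambda>A. \<rho> - \<Sum>A) ` Pow Pos"
  have K: "finite ?K" by simp
  have "(\<Sum>w\<in>W. weyl_sign S w * f (w \<rho>)) = (\<Sum>k\<in>?K. \<Sum>w\<in>{w\<in>W. w \<rho> = k}. weyl_sign S w * f (w \<rho>))"
    by (rule sum.group[symmetric]) (use K in auto)
  also have "\<dots> = (\<Sum>k\<in>?K. weyl_denominator \<Phi> S k * f k)"
    by (rule sum.cong) (auto simp: weyl_denominator_def sum_distrib_right intro!: sum.cong)
  also have "\<dots> = (\<Sum>k\<in>?K. product_coeff k * f k)" by (simp add: weyl_denominator_product)
  also have "\<dots> = (\<Sum>k\<in>?K. \<Sum>A\<in>{A\<in>Pow Pos. \<rho> - \<Sum>A = k}. (-1) ^ card A * f (\<rho> - \<Sum>A))"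
    by (rule sum.cong) (auto simp: product_coeff_def sum_distrib_right intro!: sum.cong)
  also have "\<dots> = (\<Sum>A\<in>Pow Pos. (-1) ^ card A * f (\<rho> - \<Sum>A))"
    by (rule sum.group) (use K in auto)
  finally show ?thesis .
qed

section \<open>The Kostant partition function and the numbers N\<close>

definition partitions :: "'a set \<Rightarrow> 'a \<Rightarrow> ('a \<Rightarrow> nat) set" where
  "partitions R \<gamma> = {m \<in> R \<rightarrow>\<^sub>E (UNIV :: nat set). (\<Sum>\<alpha>\<in>R. real (m \<alpha>) *\<^sub>R \<alpha>) = \<gamma>}"

lemma partition_count_eq: "partition_count \<Phi> S \<gamma> = card (partitions Pos \<gamma>)"
  by (simp add: partition_count_def partitions_def)

text \<open>Positive roots have height at least 1, so each multiplicity is at most the height of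
  \<gamma>. As \<open>card\<close> of an infinite set is 0, finiteness is what allows cardinalities
  to be added.\<close>

lemma finite_partitions:
  assumes R: "R \<subseteq> Pos"
  shows "finite (partitions R \<gamma>)"
proof (rule finite_subset)
  have fin: "finite R" using R finite_pos finite_subset by blast
  show "finite (R \<rightarrow>\<^sub>E {..nat \<lceil>height \<gamma>\<rceil>})" using fin by (intro finite_PiE) auto
  show "partitions R \<gamma> \<subseteq> R \<rightarrow>\<^sub>E {..nat \<lceil>height \<gamma>\<rceil>}"
  proof
    fix m assume m: "m \<in> partitions R \<gamma>"
    have "m \<alpha> \<le> nat \<lceil>height \<gamma>\<rceil>" if a: "\<alpha> \<in> R" for \<alpha>
    proof -
      have h: "height \<beta> \<ge> 1" if "\<beta> \<in> R" for \<beta> using pos_height R that by blast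
      have "real (m \<alpha>) \<le> real (m \<alpha>) * height \<alpha>" using h[OF a] by (simp add: mult_le_cancel_left1)
      also have "\<dots> \<le> (\<Sum>\<beta>\<in>R. real (m \<beta>) * height \<beta>)"
        using h fin a by (intro member_le_sum[of \<alpha> R "\<lambda>\<beta>. real (m \<beta>) * height \<beta>"]) (force intro!: mult_nonneg_nonneg)+
      also have "\<dots> = height \<gamma>" using m by (auto simp: partitions_def height_sum height_scale)
      finally show ?thesis by linarith
    qed
    then show "m \<in> R \<rightarrow>\<^sub>E {..nat \<lceil>height \<gamma>\<rceil>}" using m by (auto simp: partitions_def PiE_iff)
  qed
qed

text \<open>A partition either uses a, and one copy is removed, or it does not. In terms of
  generating functions, multiplying by 1 - x^a removes the factor of a. The set R is general so that
  roots can be added one at a time.\<close>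

lemma card_partitions_insert:
  assumes R: "insert a R \<subseteq> Pos" and a: "a \<notin> R"
  shows "card (partitions (insert a R) \<gamma>) = card (partitions (insert a R) (\<gamma> - a)) + card (partitions R \<gamma>)"
proof -
  have fin: "finite R" using R finite_subset[OF _ finite_pos, of R] by simp
  let ?f = "\<lambda>m::'a \<Rightarrow> nat. m(a := Suc (m a))" and ?g = "\<lambda>m::'a \<Rightarrow> nat. m(a := 0)"
  define s where "s m = (\<Sum>\<alpha>\<in>R. real (m \<alpha>) *\<^sub>R \<alpha>)" for m :: "'a \<Rightarrow> nat"
  have upd: "s (m(a := c)) = s m" for m c
    unfolding s_def by (rule sum.cong) (use a in auto)
  \<comment> \<open>Partitions are extensional: not using a means the value 0 over
    \<open>insert a R\<close> but \<open>undefined\<close> over R, so an update at a translates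
    between the two.\<close>
  have ext: "m(a := c) \<in> extensional (insert a R)" if "m \<in> extensional R \<or> m \<in> extensional (insert a R)" for m c
    using that by (auto simp: extensional_def)
  have ext': "m(a := undefined) \<in> extensional R" if "m \<in> extensional (insert a R)" for m
    using that by (auto simp: extensional_def)
  have R_iff: "m \<in> partitions R \<gamma> \<longleftrightarrow> m \<in> extensional R \<and> s m = \<gamma>" for m \<gamma>
    by (simp add: partitions_def PiE_def s_def)
  have aR_iff: "m \<in> partitions (insert a R) \<gamma> \<longleftrightarrow> m \<in> extensional (insert a R) \<and> real (m a) *\<^sub>R a + s m = \<gamma>" for m \<gamma>
    using fin a by (simp add: partitions_def PiE_def s_def)
  have split: "partitions (insert a R) \<gamma> = ?f ` partitions (insert a R) (\<gamma> - a) \<union> ?g ` partitions R \<gamma>"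
  proof (intro equalityI subsetI)
    fix m assume m: "m \<in> partitions (insert a R) \<gamma>"
    show "m \<in> ?f ` partitions (insert a R) (\<gamma> - a) \<union> ?g ` partitions R \<gamma>"
    proof (cases "m a")
      case 0
      have "m = ?g (m(a := undefined))" using 0 by (simp add: fun_eq_iff)
      moreover have "m(a := undefined) \<in> partitions R \<gamma>"
        using m 0 ext' unfolding R_iff aR_iff upd by simp
      ultimately show ?thesis by blast
    next
      case (Suc n)
      have "m = ?f (m(a := n))" using Suc by (simp add: fun_eq_iff)
      moreover have "m(a := n) \<in> partitions (insert a R) (\<gamma> - a)"
        using m Suc ext[of m n] unfolding aR_iff upd by (auto simp: scaleR_add_left)
      ultimately show ?thesis by blast
    qed
  next
    fix m assume "m \<in> ?f ` partitions (insert a R) (\<gamma> - a) \<union> ?g ` partitions R \<gamma>"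
    then consider n where "n \<in> partitions (insert a R) (\<gamma> - a)" "m = ?f n"
      | n where "n \<in> partitions R \<gamma>" "m = ?g n" by blast
    then show "m \<in> partitions (insert a R) \<gamma>"
    proof cases
      case 1
      then have "real (n a) *\<^sub>R a + s n = \<gamma> - a" "n \<in> extensional (insert a R)" unfolding aR_iff by auto
      then show ?thesis unfolding aR_iff 1(2) upd using ext by (simp add: scaleR_add_left algebra_simps)
    next
      case 2
      then show ?thesis unfolding aR_iff R_iff 2(2) upd using ext by simp
    qed
  qed
  have "inj ?f"
  proof (rule injI)
    fix x y assume e: "?f x = ?f y"
    show "x = y"
    proof
      fix z show "x z = y z" using fun_cong[OF e, of z] by (cases "z = a") auto
    qed
  qed
  then have cf: "card (?f ` partitions (insert a R) (\<gamma> - a)) = card (partitions (insert a R) (\<gamma> - a))"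
    by (rule card_image[OF inj_on_subset]) simp
  have "inj_on ?g (partitions R \<gamma>)"
  proof (rule inj_onI)
    fix x y assume m: "x \<in> partitions R \<gamma>" "y \<in> partitions R \<gamma>" and e: "?g x = ?g y"
    show "x = y"
    proof
      fix z show "x z = y z" using fun_cong[OF e, of z] m a
        by (cases "z = a") (auto simp: partitions_def PiE_iff extensional_def)
    qed
  qed
  then have cg: "card (?g ` partitions R \<gamma>) = card (partitions R \<gamma>)" by (rule card_image)
  have "?f ` partitions (insert a R) (\<gamma> - a) \<inter> ?g ` partitions R \<gamma> = {}"
    by (auto dest: fun_cong[of _ _ a])
  then show ?thesis
    unfolding split using R finite_partitions[of "insert a R"] finite_partitions[of R] cf cg
    by (subst card_Un_disjoint) auto
qed

text \<open>The product of the factors 1 - x^\<alpha> over R times the generating function of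
  partitions is 1; the induction cancels one root at a time.\<close>

lemma alternating_partitions:
  assumes "finite R" "R \<subseteq> Pos"
  shows "(\<Sum>A\<in>Pow R. (-1) ^ card A * real (card (partitions R (\<gamma> - \<Sum>A)))) = of_bool (\<gamma> = 0)"
  using assms
proof (induction R arbitrary: \<gamma> rule: finite_induct)
  case empty
  then show ?case by (auto simp: partitions_def)
next
  case (insert a R)
  let ?p = "\<lambda>\<gamma>. real (card (partitions (insert a R) \<gamma>))"
  have fin: "finite A" "a \<notin> A" if "A \<in> Pow R" for A using that insert finite_subset by auto
  have "(\<Sum>A\<in>Pow (insert a R). (-1) ^ card A * ?p (\<gamma> - \<Sum>A))
      = (\<Sum>A\<in>Pow R. (-1) ^ card A * ?p (\<gamma> - \<Sum>A)) + (\<Sum>A\<in>insert a ` Pow R. (-1) ^ card A * ?p (\<gamma> - \<Sum>A))"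
    unfolding Pow_insert by (rule sum.union_disjoint) (use insert in auto)
  also have "(\<Sum>A\<in>insert a ` Pow R. (-1) ^ card A * ?p (\<gamma> - \<Sum>A))
      = (\<Sum>A\<in>Pow R. (-1) ^ card (insert a A) * ?p (\<gamma> - \<Sum>(insert a A)))"
  proof (subst sum.reindex)
    show "inj_on (insert a) (Pow R)"
      using insert.hyps(2) by (rule_tac inj_onI) (metis PowD insert_ident subsetD)
  qed (simp add: o_def)
  also have "\<dots> = (\<Sum>A\<in>Pow R. - ((-1) ^ card A * ?p (\<gamma> - \<Sum>A - a)))"
    by (rule sum.cong) (use fin in \<open>auto simp: algebra_simps\<close>)
  also have "(\<Sum>A\<in>Pow R. (-1) ^ card A * ?p (\<gamma> - \<Sum>A)) + \<dots>
      = (\<Sum>A\<in>Pow R. (-1) ^ card A * real (card (partitions R (\<gamma> - \<Sum>A))))"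
    unfolding sum.distrib[symmetric]
    by (rule sum.cong[OF refl], subst card_partitions_insert[OF insert.prems insert.hyps(2)])
       (simp add: algebra_simps)
  also have "\<dots> = of_bool (\<gamma> = 0)" using insert by simp
  finally show ?case .
qed

text \<open>The convolution of the denominator with the partition function, which is the identity
  behind every chamber expansion.\<close>

lemma weyl_partition_sum:
  "(\<Sum>w\<in>W. weyl_sign S w * real (partition_count \<Phi> S (w \<rho> - \<rho> + \<gamma>))) = of_bool (\<gamma> = 0)"
proof -
  have "(\<Sum>w\<in>W. weyl_sign S w * real (partition_count \<Phi> S (w \<rho> - \<rho> + \<gamma>)))
      = (\<Sum>A\<in>Pow Pos. (-1) ^ card A * real (card (partitions Pos (\<gamma> - \<Sum>A))))"
    unfolding sum_sign_orbit[of "\<lambda>k. real (partition_count \<Phi> S (k - \<rho> + \<gamma>))"]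
    by (simp add: partition_count_eq algebra_simps)
  then show ?thesis by (simp add: alternating_partitions)
qed

lemma kostant_K_nonzero:
  assumes "kostant_K \<Phi> S \<beta> \<noteq> 0"
  shows "\<beta> - \<rho> \<in> nonneg_cone S"
proof -
  have "partitions Pos (\<beta> - \<rho>) \<noteq> {}" using assms by (auto simp: kostant_K_def partition_count_eq)
  then obtain m where "(\<Sum>\<alpha>\<in>Pos. real (m \<alpha>) *\<^sub>R \<alpha>) = \<beta> - \<rho>" by (auto simp: partitions_def)
  then show ?thesis using nonneg_cone_sum[of Pos "\<lambda>\<alpha>. real (m \<alpha>) *\<^sub>R \<alpha>"] nonneg_cone_scale pos_cone by metis
qed

lemma N_coeff_weyl:
  assumes u: "u \<in> W"
  shows "N_coeff \<Phi> S (u \<nu>) = weyl_sign S u * N_coeff \<Phi> S \<nu>"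
proof -
  have "weyl_sign S u * N_coeff \<Phi> S \<nu> = (\<Sum>w\<in>W. weyl_sign S u * (weyl_sign S (w \<circ> u) * real (kostant_K \<Phi> S ((w \<circ> u) \<nu>))))"
    unfolding N_coeff_def sum_distrib_left
    by (rule sum_weyl_right[OF u, of "\<lambda>w. weyl_sign S u * (weyl_sign S w * real (kostant_K \<Phi> S (w \<nu>)))", symmetric])
  also have "\<dots> = N_coeff \<Phi> S (u \<nu>)"
    unfolding N_coeff_def by (rule sum.cong) (use u weyl_sign_square[of u] in \<open>auto simp: weyl_sign_comp\<close>)
  finally show ?thesis by simp
qed

text \<open>Some translate of \<nu> lies in \<rho> plus the cone, and W preserves Q + \<rho>. This
  supplies the lattice condition for every nonzero term.\<close>

lemma N_coeff_shifted:
  assumes "N_coeff \<Phi> S \<nu> \<noteq> 0"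
  shows "\<nu> \<in> shifted_root_lattice \<Phi> S"
proof -
  obtain w where w: "w \<in> W" "kostant_K \<Phi> S (w \<nu>) \<noteq> 0"
    using assms unfolding N_coeff_def by (rule sum.not_neutral_contains_not_neutral) (use that in auto)
  then have "w \<nu> \<in> shifted_root_lattice \<Phi> S"
    using kostant_K_nonzero nonneg_cone_lattice by (simp add: shifted_iff)
  then show ?thesis using shifted_weyl_iff[OF w(1)] by simp
qed

section \<open>The longest element and the change of sign\<close>

definition w0 :: "'a \<Rightarrow> 'a" where "w0 = (SOME w. w \<in> W \<and> (\<forall>\<beta>\<in>Pos. - w \<beta> \<in> Pos))"

lemma w0: "w0 \<in> W" "\<beta> \<in> Pos \<Longrightarrow> - w0 \<beta> \<in> Pos"
  using someI_ex[of "\<lambda>w. w \<in> W \<and> (\<forall>\<beta>\<in>Pos. - w \<beta> \<in> Pos)"] longest_element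
  unfolding w0_def by blast+

text \<open>Stated for any w that makes all positive roots negative, so that it serves
  \<open>w0\<close> and \<open>inv w0\<close> alike.\<close>

lemma neg_weyl_pos_bij:
  assumes w: "w \<in> W" and p: "\<And>\<beta>. \<beta> \<in> Pos \<Longrightarrow> - w \<beta> \<in> Pos"
  shows "bij_betw (\<lambda>x. - w x) Pos Pos"
proof -
  have i: "inj_on (\<lambda>x. - w x) Pos" by (rule inj_onI) (metis neg_equal_iff_equal weyl_inv_apply(1)[OF w])
  have "(\<lambda>x. - w x) ` Pos = Pos" by (rule endo_inj_surj) (use i p in auto)
  then show ?thesis using i by (simp add: bij_betw_def)
qed

lemma neg_weyl_pos_inv:
  assumes w: "w \<in> W" and p: "\<And>\<beta>. \<beta> \<in> Pos \<Longrightarrow> - w \<beta> \<in> Pos" and b: "\<beta> \<in> Pos"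
  shows "- inv w \<beta> \<in> Pos"
proof -
  obtain \<gamma> where "\<gamma> \<in> Pos" "\<beta> = - w \<gamma>" using neg_weyl_pos_bij[OF w p] b by (auto simp: bij_betw_def)
  then show ?thesis using w weyl_group_inv[OF w] by (simp add: weyl_simps)
qed

lemma neg_weyl_weyl_vector:
  assumes w: "w \<in> W" and p: "\<And>\<beta>. \<beta> \<in> Pos \<Longrightarrow> - w \<beta> \<in> Pos"
  shows "w \<rho> = - \<rho>"
proof -
  have "w \<rho> = - ((1/2) *\<^sub>R (\<Sum>\<alpha>\<in>Pos. - w \<alpha>))"
    using w by (simp add: weyl_vector_def weyl_simps sum_negf)
  also have "(\<Sum>\<alpha>\<in>Pos. - w \<alpha>) = \<Sum>Pos" using sum.reindex_bij_betw[OF neg_weyl_pos_bij[OF w p], of "\<lambda>x. x"] .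
  finally show ?thesis by (simp add: weyl_vector_def)
qed

lemma w0_weyl_vector: "w0 \<rho> = - \<rho>"
  by (rule neg_weyl_weyl_vector) (use w0 in auto)

text \<open>The map -w permutes the positive roots, so relabelling the multiplicities embeds one set
  of partitions in the other. Used for \<open>w0\<close> and for its inverse, the inequality becomes
  an equality.\<close>

lemma partition_count_neg_le:
  assumes w: "w \<in> W" and p: "\<And>\<beta>. \<beta> \<in> Pos \<Longrightarrow> - w \<beta> \<in> Pos"
  shows "partition_count \<Phi> S (- w \<gamma>) \<le> partition_count \<Phi> S \<gamma>"
proof -
  note b = neg_weyl_pos_bij[OF w p]
  let ?h = "\<lambda>m::'a \<Rightarrow> nat. restrict (\<lambda>\<alpha>. m (- w \<alpha>)) Pos"
  have "inj_on ?h (partitions Pos (- w \<gamma>))"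
  proof (rule inj_onI)
    fix x y assume m: "x \<in> partitions Pos (- w \<gamma>)" "y \<in> partitions Pos (- w \<gamma>)" and e: "?h x = ?h y"
    show "x = y"
    proof
      fix z show "x z = y z"
      proof (cases "z \<in> Pos")
        case True
        then obtain \<alpha> where "\<alpha> \<in> Pos" "z = - w \<alpha>" using b by (auto simp: bij_betw_def)
        then show ?thesis using fun_cong[OF e, of \<alpha>] by simp
      next
        case False
        then show ?thesis using m by (auto simp: partitions_def PiE_iff extensional_def)
      qed
    qed
  qed
  moreover have "?h ` partitions Pos (- w \<gamma>) \<subseteq> partitions Pos \<gamma>"
  proof
    fix n assume "n \<in> ?h ` partitions Pos (- w \<gamma>)"
    then obtain m where m: "m \<in> partitions Pos (- w \<gamma>)" "n = ?h m" by blast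
    have "- w (\<Sum>\<alpha>\<in>Pos. real (n \<alpha>) *\<^sub>R \<alpha>) = (\<Sum>\<alpha>\<in>Pos. real (m (- w \<alpha>)) *\<^sub>R (- w \<alpha>))"
      using w m by (simp add: weyl_simps sum_negf)
    also have "\<dots> = (\<Sum>\<alpha>\<in>Pos. real (m \<alpha>) *\<^sub>R \<alpha>)"
      by (rule sum.reindex_bij_betw[OF b])
    also have "\<dots> = - w \<gamma>" using m by (simp add: partitions_def)
    finally have "w (\<Sum>\<alpha>\<in>Pos. real (n \<alpha>) *\<^sub>R \<alpha>) = w \<gamma>" by simp
    then have "(\<Sum>\<alpha>\<in>Pos. real (n \<alpha>) *\<^sub>R \<alpha>) = \<gamma>" by (metis weyl_inv_apply(1)[OF w])
    then show "n \<in> partitions Pos \<gamma>" using m by (simp add: partitions_def)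
  qed
  ultimately show ?thesis
    unfolding partition_count_eq by (intro card_inj_on_le) (auto intro: finite_partitions)
qed

lemma kostant_K_w0: "kostant_K \<Phi> S (- w0 \<beta>) = kostant_K \<Phi> S \<beta>"
proof -
  have e: "- w0 \<beta> - \<rho> = - w0 (\<beta> - \<rho>)" using w0(1) by (simp add: weyl_simps w0_weyl_vector)
  have "partition_count \<Phi> S (- w0 \<gamma>) = partition_count \<Phi> S \<gamma>" for \<gamma>
  proof (rule antisym)
    show "partition_count \<Phi> S (- w0 \<gamma>) \<le> partition_count \<Phi> S \<gamma>"
      by (rule partition_count_neg_le) (use w0 in auto)
    have "partition_count \<Phi> S (- inv w0 (- w0 \<gamma>)) \<le> partition_count \<Phi> S (- w0 \<gamma>)"
      by (rule partition_count_neg_le) (use w0 neg_weyl_pos_inv weyl_group_inv in auto)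
    then show "partition_count \<Phi> S \<gamma> \<le> partition_count \<Phi> S (- w0 \<gamma>)"
      using w0(1) weyl_group_inv[OF w0(1)] by (simp add: weyl_simps)
  qed
  then show ?thesis unfolding kostant_K_def e .
qed

text \<open>K is invariant under -w0, so the minus sign is absorbed by replacing w with w0
  w.\<close>

lemma N_coeff_uminus: "N_coeff \<Phi> S (- \<nu>) = weyl_sign S w0 * N_coeff \<Phi> S \<nu>"
proof -
  have "N_coeff \<Phi> S (- \<nu>) = (\<Sum>w\<in>W. weyl_sign S w0 * (weyl_sign S (w0 \<circ> w) * real (kostant_K \<Phi> S ((w0 \<circ> w) \<nu>))))"
    unfolding N_coeff_def
  proof (rule sum.cong)
    fix w assume w: "w \<in> W"
    have "kostant_K \<Phi> S (w (- \<nu>)) = kostant_K \<Phi> S (w0 (w \<nu>))"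
      using kostant_K_w0[of "w (- \<nu>)"] w w0(1) by (simp add: weyl_simps)
    then show "weyl_sign S w * real (kostant_K \<Phi> S (w (- \<nu>))) =
        weyl_sign S w0 * (weyl_sign S (w0 \<circ> w) * real (kostant_K \<Phi> S ((w0 \<circ> w) \<nu>)))"
      using w w0(1) by (simp add: weyl_sign_comp mult.assoc[symmetric])
  qed simp
  also have "\<dots> = weyl_sign S w0 * N_coeff \<Phi> S \<nu>"
    unfolding N_coeff_def sum_distrib_left
    by (rule sum_weyl_left[OF w0(1), of "\<lambda>w. weyl_sign S w0 * (weyl_sign S w * real (kostant_K \<Phi> S (w \<nu>)))"])
  finally show ?thesis .
qed

section \<open>Expansions of the inverse denominator\<close>

lemma series_mult_denominator:
  "series_mult (weyl_denominator \<Phi> S) A \<mu> = (\<Sum>w\<in>W. weyl_sign S w * A (\<mu> - w \<rho>))"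
proof -
  let ?D = "weyl_denominator \<Phi> S"
  have "series_mult ?D A \<mu> = (\<Sum>\<nu>\<in>(\<lambda>w. w \<rho>) ` W. ?D \<nu> * A (\<mu> - \<nu>))"
    unfolding series_mult_def
    by (rule sum.mono_neutral_left) (auto elim: weyl_denominator_nonzero)
  also have "\<dots> = (\<Sum>w\<in>W. ?D (w \<rho>) * A (\<mu> - w \<rho>))"
    by (subst sum.reindex) (auto intro: inj_onI weyl_vector_orbit_inj)
  finally show ?thesis by (simp add: weyl_denominator_orbit)
qed

text \<open>For u = id this is the geometric expansion of the inverse of x^\<rho> times the product
  of the 1 - x^(-\<alpha>), whose exponents are -\<rho> minus sums of positive roots. Antisymmetry
  of the denominator moves it to the other chambers at the cost of a sign.\<close>

definition chamber_expansion :: "('a \<Rightarrow> 'a) \<Rightarrow> 'a x_series" where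
  "chamber_expansion u \<nu> = weyl_sign S u * real (kostant_K \<Phi> S (- inv u \<nu>))"

lemma chamber_expansion_support:
  assumes u: "u \<in> W" and nz: "chamber_expansion u \<nu> \<noteq> 0"
  shows "\<exists>\<gamma>\<in>nonneg_cone S. \<nu> = - u (\<rho> + \<gamma>)"
proof -
  have "- inv u \<nu> - \<rho> \<in> nonneg_cone S" using kostant_K_nonzero nz by (auto simp: chamber_expansion_def)
  moreover have "\<nu> = - u (\<rho> + (- inv u \<nu> - \<rho>))" using u by (simp add: weyl_simps)
  ultimately show ?thesis by blast
qed

lemma chamber_expansion_inverse:
  assumes u: "u \<in> W"
  shows "series_mult (weyl_denominator \<Phi> S) (chamber_expansion u) = series_one"
proof
  fix \<mu>
  note iu = weyl_group_inv[OF u]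
  have "series_mult (weyl_denominator \<Phi> S) (chamber_expansion u) \<mu>
      = (\<Sum>w\<in>W. weyl_sign S (inv u \<circ> w) * real (partition_count \<Phi> S ((inv u \<circ> w) \<rho> - \<rho> + - inv u \<mu>)))"
    unfolding series_mult_denominator
  proof (rule sum.cong)
    fix w assume w: "w \<in> W"
    have "- inv u (\<mu> - w \<rho>) - \<rho> = (inv u \<circ> w) \<rho> - \<rho> + - inv u \<mu>"
      using iu by (simp add: weyl_simps)
    then show "weyl_sign S w * chamber_expansion u (\<mu> - w \<rho>) =
       weyl_sign S (inv u \<circ> w) * real (partition_count \<Phi> S ((inv u \<circ> w) \<rho> - \<rho> + - inv u \<mu>))"
      using u iu w by (simp only: chamber_expansion_def kostant_K_def weyl_sign_comp weyl_sign_inv) simp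
  qed simp
  also have "\<dots> = (\<Sum>w\<in>W. weyl_sign S w * real (partition_count \<Phi> S (w \<rho> - \<rho> + - inv u \<mu>)))"
    by (rule sum_weyl_left[OF iu, of "\<lambda>w. weyl_sign S w * real (partition_count \<Phi> S (w \<rho> - \<rho> + - inv u \<mu>))"])
  also have "\<dots> = of_bool (- inv u \<mu> = 0)" by (rule weyl_partition_sum)
  also have "- inv u \<mu> = 0 \<longleftrightarrow> \<mu> = 0" using weyl_inv_apply(2)[OF u, of \<mu>] linear_0[OF weyl_group_linear[OF u]] linear_0[OF weyl_group_linear[OF iu]] by auto
  finally show "series_mult (weyl_denominator \<Phi> S) (chamber_expansion u) \<mu> = series_one \<mu>"
    by (simp add: series_one_def)
qed

text \<open>A series supported in the cone of one chamber and annihilated by the denominator is zero: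
  otherwise the leading term of the denominator times a term of least height survives.\<close>

lemma denominator_cancel:
  assumes u: "u \<in> W" and supp: "\<And>\<nu>. C \<nu> \<noteq> 0 \<Longrightarrow> \<exists>\<gamma>\<in>nonneg_cone S. \<nu> = - u (\<rho> + \<gamma>)"
    and zero: "\<And>\<mu>. (\<Sum>w\<in>W. weyl_sign S w * C (\<mu> - w \<rho>)) = 0"
  shows "C \<nu> = (0::real)"
proof -
  have "\<gamma> \<in> nonneg_cone S \<Longrightarrow> C (- u (\<rho> + \<gamma>)) = 0" for \<gamma>
  proof (induction "nat \<lfloor>height \<gamma>\<rfloor>" arbitrary: \<gamma> rule: less_induct)
    case less
    \<comment> \<open>At this exponent the summand of u is the coefficient to be killed. Any other w
      leads to a cone element smaller than \<gamma> by
      \<open>\<rho> - (inv u \<circ> w) \<rho>\<close>, which is nonzero and in the cone, so the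
      induction hypothesis applies.\<close>
    let ?\<mu> = "- u (\<rho> + \<gamma>) + u \<rho>"
    have z: "C (?\<mu> - w \<rho>) = 0" if w: "w \<in> W" "w \<noteq> u" for w
    proof (rule ccontr)
      assume nz: "C (?\<mu> - w \<rho>) \<noteq> 0"
      then obtain \<gamma>' where g: "\<gamma>' \<in> nonneg_cone S" "?\<mu> - w \<rho> = - u (\<rho> + \<gamma>')" using supp by blast
      define d where "d = \<rho> - (inv u \<circ> w) \<rho>"
      have v: "inv u \<circ> w \<in> W" using u w weyl_group_comp weyl_group_inv by blast
      have d: "d \<in> nonneg_cone S" unfolding d_def by (rule weyl_vector_orbit_cone[OF v])
      have "d \<noteq> 0"
      proof
        assume "d = 0"
        then have "inv u (w \<rho>) = \<rho>" by (simp add: d_def)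
        then have "w \<rho> = u \<rho>" using u by (metis weyl_inv_apply(2))
        then show False using weyl_vector_orbit_inj u w by blast
      qed
      have "inv u (?\<mu> - w \<rho>) = inv u (- u (\<rho> + \<gamma>'))" using g by simp
      then have "\<gamma> = \<gamma>' + d" using u weyl_group_inv[OF u] by (simp add: weyl_simps d_def algebra_simps)
      then have "height \<gamma>' < height \<gamma>" using height_ge_1[OF d \<open>d \<noteq> 0\<close>] by (simp add: height_add)
      then have "nat \<lfloor>height \<gamma>'\<rfloor> < nat \<lfloor>height \<gamma>\<rfloor>"
        using height_nat[OF g(1)] height_nat[OF less.prems] by (auto elim!: Nats_cases)
      then show False using less.hyps g nz by simp
    qed
    have "(\<Sum>w\<in>W. weyl_sign S w * C (?\<mu> - w \<rho>)) = weyl_sign S u * C (?\<mu> - u \<rho>)"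
      using u z by (subst sum.remove[of W u]) (auto intro!: sum.neutral)
    then show ?case using zero weyl_sign_cases[of u] by auto
  qed
  then show ?thesis using supp by blast
qed

text \<open>Uniqueness is cancellation applied to the difference of two candidates, both supported
  in the same cone.\<close>

lemma chamber_inverse_eq:
  assumes u: "u \<in> W"
  shows "chamber_inverse \<Phi> S u = chamber_expansion u"
  unfolding chamber_inverse_def
proof (rule the_equality)
  show "(\<forall>\<nu>. chamber_expansion u \<nu> \<noteq> 0 \<longrightarrow> (\<exists>\<gamma>\<in>nonneg_cone S. \<nu> = - u (\<rho> + \<gamma>))) \<and>
     series_mult (weyl_denominator \<Phi> S) (chamber_expansion u) = series_one"
    using chamber_expansion_support[OF u] chamber_expansion_inverse[OF u] by blast
next
  fix A assume A: "(\<forall>\<nu>. A \<nu> \<noteq> 0 \<longrightarrow> (\<exists>\<gamma>\<in>nonneg_cone S. \<nu> = - u (\<rho> + \<gamma>))) \<and>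
     series_mult (weyl_denominator \<Phi> S) A = series_one"
  show "A = chamber_expansion u"
  proof
    fix \<nu>
    have "A \<nu> - chamber_expansion u \<nu> = 0"
    proof (rule denominator_cancel[OF u, of "\<lambda>\<nu>. A \<nu> - chamber_expansion u \<nu>"])
      show "\<exists>\<gamma>\<in>nonneg_cone S. \<nu> = - u (\<rho> + \<gamma>)" if "A \<nu> - chamber_expansion u \<nu> \<noteq> 0" for \<nu>
        using that A chamber_expansion_support[OF u, of \<nu>] by (cases "A \<nu> = 0") auto
      fix \<mu>
      have "series_mult (weyl_denominator \<Phi> S) A \<mu> = series_mult (weyl_denominator \<Phi> S) (chamber_expansion u) \<mu>"
        using A chamber_expansion_inverse[OF u] by simp
      then show "(\<Sum>w\<in>W. weyl_sign S w * (A (\<mu> - w \<rho>) - chamber_expansion u (\<mu> - w \<rho>))) = 0"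
        by (simp add: series_mult_denominator right_diff_distrib sum_subtractf)
    qed
    then show "A \<nu> = chamber_expansion u \<nu>" by simp
  qed
qed

lemma series_mult_one: "series_mult A series_one = A"
proof
  fix \<mu>
  have "{\<nu>. A \<nu> \<noteq> 0 \<and> series_one (\<mu> - \<nu>) \<noteq> 0} = (if A \<mu> = 0 then {} else {\<mu>})"
    by (auto simp: series_one_def)
  then show "series_mult A series_one \<mu> = A \<mu>" by (simp add: series_mult_def series_one_def)
qed

lemma denominator_power_zero: "denominator_power \<Phi> S 0 = series_one"
  by (simp add: fun_eq_iff denominator_power_def)

lemma denominator_power_one: "denominator_power \<Phi> S 1 = weyl_denominator \<Phi> S"
  by (simp add: fun_eq_iff denominator_power_def series_mult_one)

text \<open>The sum over chambers is the alternating sum of K over the translates of -\<nu> by the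
  inverses of u. It equals N at -\<nu>, which costs the sign of \<open>w0\<close>.\<close>

lemma denominator_power_minus_one:
  "denominator_power \<Phi> S (-1) \<nu> = weyl_sign S w0 * N_coeff \<Phi> S \<nu> / real (card W)"
proof -
  have "(\<Sum>u\<in>W. chamber_expansion u \<nu>) = (\<Sum>u\<in>W. weyl_sign S (inv u) * real (kostant_K \<Phi> S (inv u (- \<nu>))))"
    by (rule sum.cong)
       (simp_all add: chamber_expansion_def weyl_sign_inv linear_neg[OF weyl_group_linear[OF weyl_group_inv[of _ \<Phi>]]])
  also have "\<dots> = N_coeff \<Phi> S (- \<nu>)"
    unfolding N_coeff_def by (rule sum_weyl_inv[of "\<lambda>u. weyl_sign S u * real (kostant_K \<Phi> S (u (- \<nu>)))"])
  finally show ?thesis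
    by (simp add: denominator_power_def series_mult_one chamber_inverse_eq N_coeff_uminus)
qed

end

section \<open>Antisymmetric expansions\<close>

context based_root_system
begin

text \<open>The difference is antisymmetric; were it nonzero, it would be nonzero at some strictly
  dominant vector.\<close>

lemma antisymmetric_eqI:
  fixes f g :: "'a \<Rightarrow> real"
  assumes f: "\<And>w x. w \<in> W \<Longrightarrow> f (w x) = weyl_sign S w * f x"
    and g: "\<And>w x. w \<in> W \<Longrightarrow> g (w x) = weyl_sign S w * g x"
    and eq: "\<And>\<beta>. (\<And>\<sigma>. \<sigma> \<in> S \<Longrightarrow> \<beta> \<bullet> \<sigma> > 0) \<Longrightarrow> f \<beta> = g \<beta>"
  shows "f x = g x"
proof (rule ccontr)
  assume "f x \<noteq> g x"
  then have "f x - g x \<noteq> 0" by simp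
  moreover have "\<And>w x. w \<in> W \<Longrightarrow> f (w x) - g (w x) = weyl_sign S w * (f x - g x)"
    using f g by (simp add: right_diff_distrib)
  ultimately obtain w where w: "w \<in> W" "\<And>\<sigma>. \<sigma> \<in> S \<Longrightarrow> w x \<bullet> \<sigma> > 0"
    using antisymmetric_regular[of "\<lambda>x. f x - g x"] by blast
  then have "f (w x) = g (w x)" using eq by blast
  then show False using f[OF w(1)] g[OF w(1)] weyl_sign_cases[of w] \<open>f x \<noteq> g x\<close> by auto
qed

lemma dominant_shifted_iff:
  "\<beta> \<in> dominant_weights \<Phi> S \<inter> shifted_root_lattice \<Phi> S \<longleftrightarrow>
     \<beta> \<in> shifted_root_lattice \<Phi> S \<and> (\<forall>\<sigma>\<in>S. \<beta> \<bullet> \<sigma> \<ge> 0)"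
  using shifted_weight by (auto simp: dominant_weights_def)

abbreviation "DL \<equiv> dominant_weights \<Phi> S \<inter> shifted_root_lattice \<Phi> S"

text \<open>Given w, the weight must be \<open>inv w \<mu>\<close>, so the pairs reduce to a sum
  over W with an indicator, on which W acts by reindexing.\<close>

lemma antisymmetric_expansion_eq:
  "antisymmetric_expansion \<Phi> S f \<mu> e =
     (\<Sum>w\<in>W. of_bool (inv w \<mu> \<in> DL) * (weyl_sign S w * f (inv w \<mu>) e)) / real (card W)"
proof -
  have "(\<Sum>(\<beta>, w) | \<beta> \<in> DL \<and> w \<in> W \<and> w \<beta> = \<mu>. weyl_sign S w * f \<beta> e)
      = (\<Sum>w | w \<in> W \<and> inv w \<mu> \<in> DL. weyl_sign S w * f (inv w \<mu>) e)"
    by (rule sum.reindex_bij_witness[of _ "\<lambda>w. (inv w \<mu>, w)" snd]) auto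
  also have "\<dots> = (\<Sum>w\<in>W. of_bool (inv w \<mu> \<in> DL) * (weyl_sign S w * f (inv w \<mu>) e))"
    by (rule sum.mono_neutral_cong_left) auto
  finally show ?thesis by (simp add: antisymmetric_expansion_def)
qed

lemma antisymmetric_expansion_weyl:
  assumes u: "u \<in> W"
  shows "antisymmetric_expansion \<Phi> S f (u \<mu>) e = weyl_sign S u * antisymmetric_expansion \<Phi> S f \<mu> e"
proof -
  let ?g = "\<lambda>\<mu> w. of_bool (inv w \<mu> \<in> DL) * (weyl_sign S w * f (inv w \<mu>) e)"
  have "(\<Sum>w\<in>W. ?g (u \<mu>) w) = (\<Sum>w\<in>W. ?g (u \<mu>) (u \<circ> w))" by (rule sum_weyl_left[OF u, symmetric])
  also have "\<dots> = (\<Sum>w\<in>W. weyl_sign S u * ?g \<mu> w)"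
  proof (rule sum.cong)
    fix w assume w: "w \<in> W"
    have "inv (u \<circ> w) = inv w \<circ> inv u"
      by (rule o_inv_distrib) (use weyl_group_bij u w in auto)
    then have "inv (u \<circ> w) (u \<mu>) = inv w \<mu>" using u by simp
    then show "?g (u \<mu>) (u \<circ> w) = weyl_sign S u * ?g \<mu> w"
      by (simp only: weyl_sign_comp[OF u w]) simp
  qed simp
  finally show ?thesis
    by (simp only: antisymmetric_expansion_eq sum_distrib_left[symmetric] times_divide_eq_right)
qed

text \<open>For w other than the identity \<open>inv w \<beta>\<close> is not dominant, so a single
  summand survives and f can be read off at \<beta>.\<close>

lemma antisymmetric_expansion_dominant:
  assumes d: "\<And>\<sigma>. \<sigma> \<in> S \<Longrightarrow> \<beta> \<bullet> \<sigma> > 0"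
  shows "antisymmetric_expansion \<Phi> S f \<beta> e = of_bool (\<beta> \<in> shifted_root_lattice \<Phi> S) * f \<beta> e / real (card W)"
proof -
  have z: "inv w \<beta> \<notin> DL" if w: "w \<in> W" "w \<noteq> id" for w
  proof
    assume dl: "inv w \<beta> \<in> DL"
    note iw = weyl_group_inv[OF w(1)]
    have "inv w \<beta> \<bullet> \<sigma> > 0" if s: "\<sigma> \<in> S" for \<sigma>
    proof -
      have "\<beta> \<bullet> w \<sigma> = w (inv w \<beta>) \<bullet> w \<sigma>" using w by simp
      also have "\<dots> = inv w \<beta> \<bullet> \<sigma>" by (rule weyl_group_inner[OF w(1)])
      finally have e: "\<beta> \<bullet> w \<sigma> = inv w \<beta> \<bullet> \<sigma>" .
      \<comment> \<open>Roots never pair to 0 with a strictly dominant vector; this upgrades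
        dominance of \<open>inv w \<beta>\<close> to strict dominance.\<close>
      have "w \<sigma> \<in> \<Phi>" using weyl_root w s simple_roots by blast
      then have "w \<sigma> \<in> Pos \<or> - w \<sigma> \<in> Pos" by (rule pos_or_neg)
      then have "\<beta> \<bullet> w \<sigma> \<noteq> 0" using strictly_dominant_pos[of \<beta>] d by fastforce
      then show ?thesis using dl s e by (simp add: dominant_shifted_iff order_less_le del: Int_iff)
    qed
    then have "inv w = id" using weyl_strictly_dominant_eq[OF iw, of \<beta>] d by blast
    then have "w = id" using weyl_inv_comp(1)[OF w(1)] by simp
    then show False using w by blast
  qed
  have "(\<Sum>w\<in>W. of_bool (inv w \<beta> \<in> DL) * (weyl_sign S w * f (inv w \<beta>) e))
     = of_bool (inv id \<beta> \<in> DL) * (weyl_sign S id * f (inv id \<beta>) e)"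
    using z weyl_group_id[of \<Phi>] by (subst sum.remove[of W id]) (auto intro!: sum.neutral)
  also have "inv id \<beta> \<in> DL \<longleftrightarrow> \<beta> \<in> shifted_root_lattice \<Phi> S"
    using d by (auto simp: dominant_shifted_iff simp del: Int_iff intro: less_imp_le)
  finally show ?thesis by (simp only: antisymmetric_expansion_eq weyl_sign_id) simp
qed

text \<open>Values of f on the walls do not matter because their contributions cancel; both sides
  are antisymmetric, so strictly dominant \<beta> decide.\<close>

lemma antisymmetric_expansion_of_antisymmetric:
  assumes F: "\<And>w x. w \<in> W \<Longrightarrow> F (w x) = weyl_sign S w * F x"
    and supp: "\<And>x. F x \<noteq> 0 \<Longrightarrow> x \<in> shifted_root_lattice \<Phi> S"
    and f: "\<And>\<beta>. \<beta> \<in> shifted_root_lattice \<Phi> S \<Longrightarrow> (\<And>\<sigma>. \<sigma> \<in> S \<Longrightarrow> \<beta> \<bullet> \<sigma> > 0) \<Longrightarrow> f \<beta> e = F \<beta>"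
  shows "antisymmetric_expansion \<Phi> S f \<mu> e = F \<mu> / real (card W)"
proof (rule antisymmetric_eqI)
  fix \<beta> assume d: "\<And>\<sigma>. \<sigma> \<in> S \<Longrightarrow> \<beta> \<bullet> \<sigma> > 0"
  show "antisymmetric_expansion \<Phi> S f \<beta> e = F \<beta> / real (card W)"
    using supp[of \<beta>] f[of \<beta>] d by (auto simp: antisymmetric_expansion_dominant[OF d])
qed (simp_all add: antisymmetric_expansion_weyl F)

lemma antisymmetric_expansion_cong:
  assumes "\<And>\<beta>. \<beta> \<in> shifted_root_lattice \<Phi> S \<Longrightarrow> (\<And>\<sigma>. \<sigma> \<in> S \<Longrightarrow> \<beta> \<bullet> \<sigma> > 0) \<Longrightarrow> f \<beta> = g \<beta>"
  shows "antisymmetric_expansion \<Phi> S f = antisymmetric_expansion \<Phi> S g"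
proof (intro ext)
  fix \<mu> e
  show "antisymmetric_expansion \<Phi> S f \<mu> e = antisymmetric_expansion \<Phi> S g \<mu> e"
  proof (rule antisymmetric_eqI)
    fix \<beta> assume d: "\<And>\<sigma>. \<sigma> \<in> S \<Longrightarrow> \<beta> \<bullet> \<sigma> > 0"
    show "antisymmetric_expansion \<Phi> S f \<beta> e = antisymmetric_expansion \<Phi> S g \<beta> e"
      using assms[of \<beta>] d by (simp add: antisymmetric_expansion_dominant[OF d])
  qed (simp_all add: antisymmetric_expansion_weyl)
qed

section \<open>The coefficients of the torus knot expansion\<close>

abbreviation "QL \<equiv> shifted_root_lattice \<Phi> S"

lemma ell_arg_weyl:
  assumes "u \<in> W"
  shows "ell_arg \<Phi> S s t (u \<beta>) (u \<circ> w1) (u \<circ> w2) = u (ell_arg \<Phi> S s t \<beta> w1 w2)"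
  unfolding ell_arg_def o_apply linear_cmul[OF weyl_group_linear[OF assms]]
    linear_add[OF weyl_group_linear[OF assms]] ..

text \<open>Translate w1 and w2 simultaneously by u: their two signs of u cancel, and the one that
  remains comes from N.\<close>

lemma torus_coeff_weyl:
  assumes u: "u \<in> W"
  shows "torus_coeff \<Phi> S s t QL (u \<beta>) = weyl_sign S u * torus_coeff \<Phi> S s t QL \<beta>"
proof -
  define g where "g \<beta> w1 w2 = weyl_sign S (w1 \<circ> w2) * of_bool (ell_arg \<Phi> S s t \<beta> w1 w2 \<in> QL)
      * N_coeff \<Phi> S (ell_arg \<Phi> S s t \<beta> w1 w2)" for \<beta> and w1 w2 :: "'a \<Rightarrow> 'a"
  have T: "torus_coeff \<Phi> S s t QL \<beta> = (\<Sum>w1\<in>W. \<Sum>w2\<in>W. g \<beta> w1 w2)" for \<beta>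
    by (simp add: torus_coeff_def g_def sum.cartesian_product)
  have "(\<Sum>w1\<in>W. \<Sum>w2\<in>W. g (u \<beta>) w1 w2) = (\<Sum>w1\<in>W. \<Sum>w2\<in>W. g (u \<beta>) (u \<circ> w1) (u \<circ> w2))"
    by (simp only: sum_weyl_left[OF u, of "\<lambda>w1. \<Sum>w2\<in>W. g (u \<beta>) w1 w2"]
        sum_weyl_left[OF u, of "\<lambda>w2. g (u \<beta>) w1 w2" for w1])
  also have "\<dots> = (\<Sum>w1\<in>W. \<Sum>w2\<in>W. weyl_sign S u * g \<beta> w1 w2)"
  proof (intro sum.cong refl)
    fix w1 w2 assume w: "w1 \<in> W" "w2 \<in> W"
    have "weyl_sign S ((u \<circ> w1) \<circ> (u \<circ> w2)) = weyl_sign S (w1 \<circ> w2)"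
      using weyl_sign_square[of u] w u by (simp add: weyl_sign_comp weyl_group_comp del: weyl_sign_square)
    then show "g (u \<beta>) (u \<circ> w1) (u \<circ> w2) = weyl_sign S u * g \<beta> w1 w2"
      unfolding g_def by (simp only: ell_arg_weyl[OF u] shifted_weyl_iff[OF u] N_coeff_weyl[OF u]) simp
  qed
  finally show ?thesis by (simp add: T sum_distrib_left)
qed

text \<open>Modulo Q, \<beta> is (s t - s - t) \<rho>. Coprimality makes (s - 1)(t - 1) even, so
  this is an odd multiple of \<rho>, congruent to \<rho> because 2 \<rho> lies in Q.\<close>

lemma torus_coeff_shifted:
  assumes st: "coprime s t" "s \<ge> 1" "t \<ge> 1" and nz: "torus_coeff \<Phi> S s t QL \<beta> \<noteq> 0"
  shows "\<beta> \<in> QL"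
proof -
  obtain w1 w2 where w: "w1 \<in> W" "w2 \<in> W" and l: "ell_arg \<Phi> S s t \<beta> w1 w2 \<in> QL"
    using nz unfolding torus_coeff_def by (rule sum.not_neutral_contains_not_neutral) (use that in auto)
  let ?l = "ell_arg \<Phi> S s t \<beta> w1 w2"
  have "even ((s - 1) * (t - 1))"
  proof (rule ccontr)
    assume "odd ((s - 1) * (t - 1))"
    then have "even s" "even t" using st by auto
    then show False using st by (metis coprime_common_divisor odd_one)
  qed
  then obtain k where k: "(s - 1) * (t - 1) = 2 * k" by blast
  have "(real s - 1) * (real t - 1) = real ((s - 1) * (t - 1))" using st by (simp add: of_nat_diff)
  then have k: "(real s - 1) * (real t - 1) = 2 * real k" by (simp only: k)
  have dbl: "(real k * 2) *\<^sub>R \<rho> = real k *\<^sub>R \<rho> + real k *\<^sub>R \<rho>"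
    by (simp flip: scaleR_add_left)
  have "(real s * real t) *\<^sub>R ?l = \<beta> + real t *\<^sub>R w1 \<rho> + real s *\<^sub>R w2 \<rho>"
    using st by (simp add: ell_arg_def)
  moreover have "real s * real t - real s - real t = 2 * real k - 1" using k by (simp add: algebra_simps)
  then have "(real s * real t - real s - real t) *\<^sub>R \<rho> = (2 * real k - 1) *\<^sub>R \<rho>" by simp
  ultimately have "\<beta> - \<rho> = (real s * real t) *\<^sub>R (?l - \<rho>) - real t *\<^sub>R (w1 \<rho> - \<rho>)
      - real s *\<^sub>R (w2 \<rho> - \<rho>) + (real k - 1) *\<^sub>R (2 *\<^sub>R \<rho>)"
    by (simp add: algebra_simps scaleR_2 dbl)
  moreover have "(real s * real t) *\<^sub>R (?l - \<rho>) - real t *\<^sub>R (w1 \<rho> - \<rho>)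
      - real s *\<^sub>R (w2 \<rho> - \<rho>) + (real k - 1) *\<^sub>R (2 *\<^sub>R \<rho>) \<in> Q"
    by (intro root_lattice_add root_lattice_diff root_lattice_scale weyl_vector_diff_lattice
        double_weyl_vector_lattice l[unfolded shifted_iff] w Ints_mult Ints_diff Ints_of_nat Ints_1)
  ultimately show ?thesis by (simp add: shifted_iff)
qed

text \<open>On a simple coroot the two Weyl terms together contribute at least -s t. Strict
  dominance of \<beta> pushes the pairing of \<open>ell_arg\<close> above -1, and integrality makes
  it nonnegative.\<close>

lemma torus_coeff_dominant:
  assumes st: "s \<ge> 1" "t \<ge> 1" and b: "\<beta> \<in> QL" and d: "\<And>\<sigma>. \<sigma> \<in> S \<Longrightarrow> \<beta> \<bullet> \<sigma> > 0"
    and large: "\<And>\<alpha>. \<alpha> \<in> Pos \<Longrightarrow> (real s + real t) * coroot_pairing \<rho> \<alpha> \<le> real s * real t"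
  shows "torus_coeff \<Phi> S s t QL \<beta> = torus_coeff \<Phi> S s t DL \<beta>"
proof -
  have "ell_arg \<Phi> S s t \<beta> w1 w2 \<in> DL \<longleftrightarrow> ell_arg \<Phi> S s t \<beta> w1 w2 \<in> QL" if w: "w1 \<in> W" "w2 \<in> W" for w1 w2
  proof -
    let ?l = "ell_arg \<Phi> S s t \<beta> w1 w2"
    have "?l \<bullet> \<sigma> \<ge> 0" if l: "?l \<in> QL" and s: "\<sigma> \<in> S" for \<sigma>
    proof -
      have sr: "\<sigma> \<in> \<Phi>" using s simple_roots by auto
      let ?c = "\<lambda>x. coroot_pairing x \<sigma>"
      \<comment> \<open>The pairing is that of \<rho> with the root \<open>inv w \<sigma>\<close>:
        nonnegative if this root is positive, and bounded by the hypothesis if its negative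
        is.\<close>
      have lower: "(real s + real t) * ?c (w \<rho>) \<ge> - (real s * real t)" if w: "w \<in> W" for w
      proof -
        have e: "?c (w \<rho>) = coroot_pairing \<rho> (inv w \<sigma>)"
          using coroot_pairing_weyl[OF weyl_group_inv[OF w], of "w \<rho>" \<sigma>] w by simp
        have "inv w \<sigma> \<in> Pos \<or> - inv w \<sigma> \<in> Pos"
          using pos_or_neg weyl_root[OF weyl_group_inv[OF w] sr] by blast
        then show ?thesis
        proof
          assume p: "inv w \<sigma> \<in> Pos"
          then have "\<rho> \<bullet> inv w \<sigma> > 0" using strictly_dominant_pos weyl_vector_inner_simple by blast
          then have "coroot_pairing \<rho> (inv w \<sigma>) \<ge> 0" by (simp add: coroot_pairing_def)
          then have "(real s + real t) * ?c (w \<rho>) \<ge> 0" using e by simp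
          moreover have "real s * real t \<ge> 0" by simp
          ultimately show ?thesis by linarith
        next
          assume "- inv w \<sigma> \<in> Pos"
          from large[OF this] show ?thesis using e by (simp add: coroot_pairing_def)
        qed
      qed
      have pos: "?c \<beta> > 0" using inner_simple_sign(2)[OF s] d[OF s] by simp
      \<comment> \<open>Weighting the bounds for w1 and w2 by t and s makes the common factor s + t
        cancel from their sum.\<close>
      have "(real s + real t) * (real t * ?c (w1 \<rho>)) \<ge> real t * - (real s * real t)"
        using mult_left_mono[OF lower[OF w(1)], of "real t"] by (simp add: algebra_simps)
      moreover have "(real s + real t) * (real s * ?c (w2 \<rho>)) \<ge> real s * - (real s * real t)"
        using mult_left_mono[OF lower[OF w(2)], of "real s"] by (simp add: algebra_simps)
      ultimately have "(real s + real t) * (real t * ?c (w1 \<rho>) + real s * ?c (w2 \<rho>)) \<ge> (real s + real t) * - (real s * real t)"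
        by (simp add: algebra_simps)
      then have "real t * ?c (w1 \<rho>) + real s * ?c (w2 \<rho>) \<ge> - (real s * real t)"
        using st by (subst (asm) mult_le_cancel_left_pos) auto
      moreover have "(real s * real t) * ?c ?l = ?c \<beta> + real t * ?c (w1 \<rho>) + real s * ?c (w2 \<rho>)"
        using st by (simp add: ell_arg_def coroot_pairing_scaleR coroot_pairing_add)
      ultimately have "(real s * real t) * ?c ?l > (real s * real t) * (-1)" using pos by simp
      then have "?c ?l > -1" using st by (subst (asm) mult_less_cancel_left_pos) auto
      moreover have "?c ?l \<in> \<int>" using shifted_weight[OF l] sr by (simp add: weight_lattice_def)
      ultimately have "?c ?l \<ge> 0" by (auto elim!: Ints_cases)
      then show ?thesis using inner_simple_sign(1)[OF s] by simp
    qed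
    then show ?thesis by (auto simp: dominant_shifted_iff simp del: Int_iff)
  qed
  then show ?thesis unfolding torus_coeff_def by (intro sum.cong) (auto simp del: Int_iff)
qed

end

section \<open>Continued fractions and chains of vertices\<close>

text \<open>\<open>neg_cont_frac ks = - p / q\<close> for \<open>(p, q) = continuants ks\<close>.\<close>

primrec continuants :: "int list \<Rightarrow> int \<times> int" where
  "continuants [] = (1, 0)"
| "continuants (k # ks) = (- k * fst (continuants ks) - snd (continuants ks), fst (continuants ks))"

text \<open>As -k is at least 2, a step from (p, q) gives a numerator of at least 2 p - q > p. In
  particular the numerators never vanish.\<close>

lemma continuants_order:
  "\<forall>k\<in>set ks. k \<le> -2 \<Longrightarrow> 0 \<le> snd (continuants ks) \<and> snd (continuants ks) < fst (continuants ks)"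
proof (induction ks)
  case (Cons k ks)
  then have IH: "0 \<le> snd (continuants ks)" "snd (continuants ks) < fst (continuants ks)" and k: "k \<le> -2" by auto
  have "2 * fst (continuants ks) \<le> - k * fst (continuants ks)"
    using IH k by (intro mult_right_mono) auto
  then show ?case using IH by simp
qed simp

lemma continuants_coprime: "coprime (fst (continuants ks)) (snd (continuants ks))"
proof (induction ks)
  case (Cons k ks)
  have "gcd (- k * fst (continuants ks) - snd (continuants ks)) (fst (continuants ks))
      = gcd (snd (continuants ks)) (fst (continuants ks))"
    using gcd_add_mult[of "fst (continuants ks)" "-k" "- snd (continuants ks)"]
    by (simp add: gcd.commute)
  then show ?case using Cons by (simp add: coprime_iff_gcd_eq_1 gcd.commute)
qed simp

lemma neg_cont_frac_continuants:
  assumes "ks \<noteq> []" "\<forall>k\<in>set ks. k \<le> -2"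
  shows "neg_cont_frac ks = - (of_int (fst (continuants ks)) / of_int (snd (continuants ks)))"
  using assms
proof (induction ks rule: neg_cont_frac.induct)
  case (3 k l ks)
  have "snd (continuants (l # ks)) < fst (continuants (l # ks))" "0 \<le> snd (continuants (l # ks))"
    using continuants_order[of "l # ks"] 3 by auto
  then have p: "real_of_int (fst (continuants (l # ks))) \<noteq> 0" by linarith
  have "neg_cont_frac (k # l # ks) = of_int k + of_int (snd (continuants (l # ks))) / of_int (fst (continuants (l # ks)))"
    using 3 by (simp del: continuants.simps)
  also have "\<dots> = - (of_int (fst (continuants (k # l # ks))) / of_int (snd (continuants (k # l # ks))))"
    unfolding continuants.simps(2)[of k "l # ks"] using p by (simp add: field_simps del: continuants.simps)
  finally show ?case .
qed auto

text \<open>Both fractions are in lowest terms with positive denominators, so cross-multiplication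
  identifies them entry by entry. The empty list is excluded because its value is 0.\<close>

lemma continuants_eqI:
  fixes t t' :: nat
  assumes e: "neg_cont_frac_expansion ks (- (real t / real t'))" and "coprime t t'" "0 < t" "0 < t'"
  shows "ks \<noteq> []" "continuants ks = (int t, int t')"
proof -
  show ne: "ks \<noteq> []" using assms by (auto simp: neg_cont_frac_expansion_def)
  have k: "\<forall>k\<in>set ks. k \<le> -2" using e by (simp add: neg_cont_frac_expansion_def)
  obtain p q where pq: "continuants ks = (p, q)" by fastforce
  have o: "0 \<le> q" "q < p" "coprime p q"
    using continuants_order[OF k] continuants_coprime[of ks] pq by auto
  have f: "real_of_int p / real_of_int q = real t / real t'"
    using e neg_cont_frac_continuants[OF ne k] pq by (simp add: neg_cont_frac_expansion_def)
  have "q \<noteq> 0" using f assms by auto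
  then have "real_of_int p * real t' = real t * real_of_int q" using f assms by (simp add: field_simps)
  then have "real_of_int (p * int t') = real_of_int (int t * q)" by simp
  then have "p * int t' = int t * q" by (simp only: of_int_eq_iff)
  then have "\<bar>p\<bar> * \<bar>int t'\<bar> = \<bar>int t\<bar> * \<bar>q\<bar>" by (metis abs_mult)
  moreover have "coprime (int t) (int t')" using assms by simp
  ultimately have "\<bar>p\<bar> = \<bar>int t\<bar> \<and> \<bar>q\<bar> = \<bar>int t'\<bar>"
    using coprime_crossproduct_int[of p q "int t" "int t'"] o by (auto simp: mult.commute)
  then show "continuants ks = (int t, int t')" using pq o by auto
qed

text \<open>Here x 0 is the center, the next entries are the leg, and the entry after them is a
  fictitious vertex past its end. Elimination from the far end reproduces the recursion of the
  continuants.\<close>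

lemma chain_first:
  fixes x :: "nat \<Rightarrow> 'a::real_vector"
  assumes "\<And>i. i < length ks \<Longrightarrow> x i + real_of_int (ks ! i) *\<^sub>R x (Suc i) + x (Suc (Suc i)) = 0"
  shows "real_of_int (fst (continuants ks)) *\<^sub>R x 1
    = real_of_int (snd (continuants ks)) *\<^sub>R x 0 + x (Suc (length ks))"
  using assms
proof (induction ks arbitrary: x)
  case (Cons k ks)
  let ?p = "real_of_int (fst (continuants ks))" and ?q = "real_of_int (snd (continuants ks))"
  have IH: "?p *\<^sub>R x (Suc 1) = ?q *\<^sub>R x (Suc 0) + x (Suc (Suc (length ks)))"
    using Cons.IH[of "\<lambda>i. x (Suc i)"] Cons.prems[of "Suc i" for i] by simp
  have "x (Suc 1) = - x 0 - real_of_int k *\<^sub>R x 1"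
    using Cons.prems[of 0] by (simp add: algebra_simps eq_neg_iff_add_eq_0)
  then have "?p *\<^sub>R (- x 0 - real_of_int k *\<^sub>R x 1) = ?q *\<^sub>R x 1 + x (Suc (Suc (length ks)))"
    using IH by simp
  then have X: "x (Suc (Suc (length ks))) = ?p *\<^sub>R (- x 0 - real_of_int k *\<^sub>R x 1) - ?q *\<^sub>R x 1"
    by (metis add_diff_cancel_left')
  show ?case by (simp add: X algebra_simps)
qed simp

text \<open>The coefficient 1 of x 0 reflects that the end-to-end entry of the inverse of a
  tridiagonal matrix with off-diagonal entries 1 is, up to sign, the inverse determinant. The
  constant c may stay unspecified, as its term is later paired to 0.\<close>

lemma chain_last:
  fixes x :: "nat \<Rightarrow> 'a::real_vector"
  assumes "\<And>i. i < length ks \<Longrightarrow> x i + real_of_int (ks ! i) *\<^sub>R x (Suc i) + x (Suc (Suc i)) = 0"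
    and "\<forall>k\<in>set ks. k \<le> -2"
  shows "\<exists>c. real_of_int (fst (continuants ks)) *\<^sub>R x (length ks) = x 0 + c *\<^sub>R x (Suc (length ks))"
  using assms
proof (induction ks arbitrary: x)
  case Nil
  show ?case by (intro exI[of _ 0]) simp
next
  case (Cons k ks)
  let ?p = "real_of_int (fst (continuants ks))" and ?T = "real_of_int (fst (continuants (k # ks)))"
  let ?n = "length ks"
  obtain c where c: "?p *\<^sub>R x (Suc ?n) = x 1 + c *\<^sub>R x (Suc (Suc ?n))"
    using Cons.IH[of "\<lambda>i. x (Suc i)"] Cons.prems(1)[of "Suc i" for i] Cons.prems(2) by auto
  have p: "?p \<noteq> 0" using continuants_order[of ks] Cons.prems(2) by fastforce
  have f: "?T *\<^sub>R x 1 = ?p *\<^sub>R x 0 + x (Suc (Suc ?n))"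
    using chain_first[of "k # ks" x] Cons.prems(1) by simp
  have "?T *\<^sub>R x (Suc ?n) = (?T / ?p) *\<^sub>R (?p *\<^sub>R x (Suc ?n))" using p by simp
  also have "\<dots> = (1 / ?p) *\<^sub>R (?T *\<^sub>R x 1) + (?T / ?p * c) *\<^sub>R x (Suc (Suc ?n))"
    unfolding c by (simp add: scaleR_add_right)
  also have "\<dots> = x 0 + (1 / ?p + ?T / ?p * c) *\<^sub>R x (Suc (Suc ?n))"
    unfolding f using p by (simp add: scaleR_add_right scaleR_add_left)
  finally show ?case by auto
qed

fun chain_from :: "int list \<Rightarrow> 'a::real_vector \<Rightarrow> 'a \<Rightarrow> nat \<Rightarrow> 'a" where
  "chain_from ks a b 0 = a"
| "chain_from ks a b (Suc 0) = b"
| "chain_from ks a b (Suc (Suc i)) = - chain_from ks a b i - real_of_int (ks ! i) *\<^sub>R chain_from ks a b (Suc i)"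

lemma chain_from_unique:
  assumes "\<And>i. i < n \<Longrightarrow> x i + real_of_int (ks ! i) *\<^sub>R x (Suc i) + x (Suc (Suc i)) = 0" "i \<le> Suc n"
  shows "x i = chain_from ks (x 0) (x 1) i"
  using assms(2)
proof (induction i rule: induct_nat_012)
  case (ge2 i)
  have "x (Suc (Suc i)) = - x i - real_of_int (ks ! i) *\<^sub>R x (Suc i)"
    using assms(1)[of i] ge2(3) by (simp add: algebra_simps eq_neg_iff_add_eq_0)
  then show ?case using ge2 by simp
qed simp_all

text \<open>The value of \<open>B'\<alpha>\<close> at the vertices of a leg on which \<open>\<alpha>\<close> is \<open>y\<close>, for the value \<open>a\<close> of \<open>\<alpha>\<close> at
  the center.\<close>

definition leg_apply :: "int list \<Rightarrow> 'a::real_vector \<Rightarrow> (nat \<Rightarrow> 'a) \<Rightarrow> nat \<Rightarrow> 'a" where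
  "leg_apply ks a y i = (if i = 0 then a else y (i - 1)) + real_of_int (ks ! i) *\<^sub>R y i
     + (if Suc i < length ks then y (Suc i) else 0)"

text \<open>The second initial value is the one that \<open>chain_first\<close> forces when the
  fictitious vertex past the end carries -\<eta>. Vertex i of the leg is entry i + 1 of the
  chain.\<close>

definition leg_solution :: "int list \<Rightarrow> 'a::real_vector \<Rightarrow> 'a \<Rightarrow> nat \<Rightarrow> 'a" where
  "leg_solution ks a \<eta> i = chain_from ks a
     ((1 / real_of_int (fst (continuants ks))) *\<^sub>R (real_of_int (snd (continuants ks)) *\<^sub>R a - \<eta>)) (Suc i)"

text \<open>Placing -\<eta> at a fictitious vertex past the end makes the inhomogeneous equation
  there an instance of the homogeneous recursion.\<close>

lemma leg_equations_iff:
  fixes y :: "nat \<Rightarrow> 'a::real_vector"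
  assumes ne: "ks \<noteq> []" and k: "\<forall>k\<in>set ks. k \<le> -2"
  shows "(\<forall>i<length ks. leg_apply ks a y i = (if Suc i < length ks then 0 else \<eta>))
    \<longleftrightarrow> (\<forall>i<length ks. y i = leg_solution ks a \<eta> i)" (is "?E \<longleftrightarrow> ?S")
proof
  let ?p = "real_of_int (fst (continuants ks))" and ?q = "real_of_int (snd (continuants ks))"
  let ?n = "length ks"
  have p: "?p \<noteq> 0" using continuants_order[OF k] by linarith
  define b where "b = (1 / ?p) *\<^sub>R (?q *\<^sub>R a - \<eta>)"
  {
    assume E: ?E
    define x where "x i = (if i = 0 then a else if i \<le> ?n then y (i - 1) else - \<eta>)" for i
    have eq: "x i + real_of_int (ks ! i) *\<^sub>R x (Suc i) + x (Suc (Suc i)) = 0" if i: "i < ?n" for i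
    proof (cases "Suc i < ?n")
      case True
      then show ?thesis using E[rule_format, OF i] by (auto simp: leg_apply_def x_def)
    next
      case False
      then show ?thesis using E[rule_format, OF i] i by (auto simp: leg_apply_def x_def)
    qed
    have "?p *\<^sub>R x 1 = ?q *\<^sub>R a - \<eta>" using chain_first[of ks x, OF eq] by (simp add: x_def)
    then have "(1 / ?p) *\<^sub>R (?p *\<^sub>R x 1) = b" by (simp add: b_def)
    then have b: "x 1 = b" using p by simp
    show ?S
    proof (intro allI impI)
      fix i assume i: "i < ?n"
      have "x (Suc i) = chain_from ks (x 0) (x 1) (Suc i)"
        by (rule chain_from_unique[of ?n]) (use eq i in auto)
      then show "y i = leg_solution ks a \<eta> i" using i b by (simp add: x_def leg_solution_def b_def)
    qed
  next
    assume S: ?S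
    define x where "x = chain_from ks a b"
    have eq: "x i + real_of_int (ks ! i) *\<^sub>R x (Suc i) + x (Suc (Suc i)) = 0" for i by (simp add: x_def)
    have "?p *\<^sub>R b = ?q *\<^sub>R a + x (Suc ?n)" using chain_first[of ks x, OF eq] by (simp add: x_def)
    moreover have "?p *\<^sub>R b = ?q *\<^sub>R a - \<eta>" using p by (simp add: b_def)
    ultimately have last: "x (Suc ?n) = - \<eta>" by simp
    have y: "y i = x (Suc i)" if "i < ?n" for i using S that by (simp add: leg_solution_def x_def b_def)
    show ?E
    proof (intro allI impI)
      fix i assume i: "i < ?n"
      have 1: "leg_apply ks a y i = x i + real_of_int (ks ! i) *\<^sub>R x (Suc i) + (if Suc i < ?n then x (Suc (Suc i)) else 0)"
        using i by (cases i) (auto simp: leg_apply_def y, auto simp: x_def)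
      show "leg_apply ks a y i = (if Suc i < ?n then 0 else \<eta>)"
      proof (cases "Suc i < ?n")
        case False
        then have "Suc i = ?n" using i by simp
        then show ?thesis using 1 eq[of i] last by (simp add: eq_neg_iff_add_eq_0[symmetric])
      qed (use 1 eq in simp)
    qed
  }
qed

lemma leg_solution_first:
  "leg_solution ks a \<eta> 0 = (1 / real_of_int (fst (continuants ks))) *\<^sub>R (real_of_int (snd (continuants ks)) *\<^sub>R a - \<eta>)"
  by (simp add: leg_solution_def)

text \<open>The recursion has integer coefficients, so two consecutive values in the lattice
  suffice.\<close>

lemma leg_solution_lattice:
  assumes "a \<in> root_lattice \<Phi>" "leg_solution ks a \<eta> 0 \<in> root_lattice \<Phi>"
  shows "leg_solution ks a \<eta> i \<in> root_lattice \<Phi>"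
proof -
  have "chain_from ks a b j \<in> root_lattice \<Phi>" if "b \<in> root_lattice \<Phi>" for b j
    using that assms(1)
    by (induction ks a b j rule: chain_from.induct)
       (auto intro!: root_lattice_diff root_lattice_uminus root_lattice_scale)
  then show ?thesis using assms by (simp add: leg_solution_def)
qed

text \<open>Pairing with \<zeta> removes the fictitious vertex and with it the unspecified constant
  of \<open>chain_last\<close>. It is applied to \<eta> = w \<rho> - \<rho> and \<zeta> = w \<rho> +
  \<rho>.\<close>

lemma leg_solution_last:
  fixes a :: "'a::real_inner"
  assumes ne: "ks \<noteq> []" and k: "\<forall>k\<in>set ks. k \<le> -2" and orth: "\<eta> \<bullet> \<zeta> = 0"
  shows "real_of_int (fst (continuants ks)) * (leg_solution ks a \<eta> (length ks - 1) \<bullet> \<zeta>) = a \<bullet> \<zeta>"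
proof -
  let ?p = "real_of_int (fst (continuants ks))" and ?q = "real_of_int (snd (continuants ks))"
  let ?n = "length ks"
  have p: "?p \<noteq> 0" using continuants_order[OF k] by linarith
  define b where "b = (1 / ?p) *\<^sub>R (?q *\<^sub>R a - \<eta>)"
  define x where "x = chain_from ks a b"
  have eq: "x i + real_of_int (ks ! i) *\<^sub>R x (Suc i) + x (Suc (Suc i)) = 0" for i by (simp add: x_def)
  have "?p *\<^sub>R b = ?q *\<^sub>R a + x (Suc ?n)" using chain_first[of ks x, OF eq] by (simp add: x_def)
  moreover have "?p *\<^sub>R b = ?q *\<^sub>R a - \<eta>" using p by (simp add: b_def)
  ultimately have last: "x (Suc ?n) = - \<eta>" by simp
  obtain c where "?p *\<^sub>R x ?n = a + c *\<^sub>R x (Suc ?n)"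
    using chain_last[of ks x, OF eq k] by (auto simp: x_def)
  then have "(?p *\<^sub>R x ?n) \<bullet> \<zeta> = a \<bullet> \<zeta>" using last orth by (simp add: inner_diff_left)
  moreover have "leg_solution ks a \<eta> (?n - 1) = x ?n" using ne by (simp add: leg_solution_def x_def b_def)
  ultimately show ?thesis by simp
qed

section \<open>The plumbing tree and its series\<close>

lemma edge_iff [simp]:
  "{Leg_t i, Leg_t j} \<in> tree_edges ks ls \<longleftrightarrow> (j = Suc i \<and> j < length ks) \<or> (i = Suc j \<and> i < length ks)"
  "{Leg_s i, Leg_s j} \<in> tree_edges ks ls \<longleftrightarrow> (j = Suc i \<and> j < length ls) \<or> (i = Suc j \<and> i < length ls)"
  "{Leg_t i, Leg_s j} \<notin> tree_edges ks ls" "{Leg_s i, Leg_t j} \<notin> tree_edges ks ls"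
  "{Center, Leg_t i} \<in> tree_edges ks ls \<longleftrightarrow> i = 0" "{Leg_t i, Center} \<in> tree_edges ks ls \<longleftrightarrow> i = 0"
  "{Center, Leg_s i} \<in> tree_edges ks ls \<longleftrightarrow> i = 0" "{Leg_s i, Center} \<in> tree_edges ks ls \<longleftrightarrow> i = 0"
  "{Center, Knot} \<in> tree_edges ks ls" "{Knot, Center} \<in> tree_edges ks ls" "{Center} \<notin> tree_edges ks ls"
  "{Knot, Leg_t i} \<notin> tree_edges ks ls" "{Knot, Leg_s i} \<notin> tree_edges ks ls"
  "{Leg_t i, Knot} \<notin> tree_edges ks ls" "{Leg_s i, Knot} \<notin> tree_edges ks ls"
  by (auto simp: tree_edges_def doubleton_eq_iff)

lemma sum_inner_vertices:
  fixes f :: "tree_vertex \<Rightarrow> 'b::comm_monoid_add"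
  shows "(\<Sum>v\<in>inner_vertices ks ls. f v) = f Center + (\<Sum>i<length ks. f (Leg_t i)) + (\<Sum>i<length ls. f (Leg_s i))"
proof -
  have "inner_vertices ks ls = insert Center (Leg_t ` {..<length ks} \<union> Leg_s ` {..<length ls})"
    by (auto simp: inner_vertices_def)
  moreover have "(\<Sum>v\<in>Leg_t ` {..<length ks} \<union> Leg_s ` {..<length ls}. f v)
      = (\<Sum>i<length ks. f (Leg_t i)) + (\<Sum>i<length ls. f (Leg_s i))"
    by (subst sum.union_disjoint) (auto simp: sum.reindex inj_on_def)
  ultimately show ?thesis by (subst \<open>inner_vertices ks ls = _\<close>, subst sum.insert) (auto simp: add.assoc)
qed

lemma prod_inner_vertices:
  fixes f :: "tree_vertex \<Rightarrow> 'b::comm_monoid_mult"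
  shows "(\<Prod>v\<in>inner_vertices ks ls. f v) = f Center * (\<Prod>i<length ks. f (Leg_t i)) * (\<Prod>i<length ls. f (Leg_s i))"
proof -
  have "inner_vertices ks ls = insert Center (Leg_t ` {..<length ks} \<union> Leg_s ` {..<length ls})"
    by (auto simp: inner_vertices_def)
  moreover have "(\<Prod>v\<in>Leg_t ` {..<length ks} \<union> Leg_s ` {..<length ls}. f v)
      = (\<Prod>i<length ks. f (Leg_t i)) * (\<Prod>i<length ls. f (Leg_s i))"
    by (subst prod.union_disjoint) (auto simp: prod.reindex inj_on_def)
  ultimately show ?thesis by (subst \<open>inner_vertices ks ls = _\<close>, subst prod.insert) (auto simp: mult.assoc)
qed

lemma tree_degree_center:
  assumes "ks \<noteq> []" "ls \<noteq> []"
  shows "tree_degree ks ls Center = 3"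
proof -
  have "{u \<in> tree_vertices ks ls. {u, Center} \<in> tree_edges ks ls} = {Knot, Leg_t 0, Leg_s 0}"
    using assms by (auto simp: tree_vertices_def inner_vertices_def)
  then show ?thesis by (simp add: tree_degree_def)
qed

lemma tree_degree_leg:
  shows "i < length ks \<Longrightarrow> tree_degree ks ls (Leg_t i) = (if Suc i < length ks then 2 else 1)"
    and "i < length ls \<Longrightarrow> tree_degree ks ls (Leg_s i) = (if Suc i < length ls then 2 else 1)"
proof -
  assume i: "i < length ks"
  have "{u \<in> tree_vertices ks ls. {u, Leg_t i} \<in> tree_edges ks ls}
      = insert (if i = 0 then Center else Leg_t (i - 1)) (if Suc i < length ks then {Leg_t (Suc i)} else {})"
    using i by (auto simp: tree_vertices_def inner_vertices_def)
  then show "tree_degree ks ls (Leg_t i) = (if Suc i < length ks then 2 else 1)" by (simp add: tree_degree_def)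
next
  assume i: "i < length ls"
  have "{u \<in> tree_vertices ks ls. {u, Leg_s i} \<in> tree_edges ks ls}
      = insert (if i = 0 then Center else Leg_s (i - 1)) (if Suc i < length ls then {Leg_s (Suc i)} else {})"
    using i by (auto simp: tree_vertices_def inner_vertices_def)
  then show "tree_degree ks ls (Leg_s i) = (if Suc i < length ls then 2 else 1)" by (simp add: tree_degree_def)
qed

lemma sum_tridiagonal:
  fixes y :: "nat \<Rightarrow> 'a::real_vector"
  assumes i: "i < n" and c: "\<And>j. j < n \<Longrightarrow> c j = (if i = j then k else if j = Suc i \<or> i = Suc j then 1 else 0)"
  shows "(\<Sum>j<n. c j *\<^sub>R y j) = (if i = 0 then 0 else y (i - 1)) + k *\<^sub>R y i + (if Suc i < n then y (Suc i) else 0)"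
proof -
  have "(\<Sum>j<n. c j *\<^sub>R y j) = (\<Sum>j<n. (if j = i then k *\<^sub>R y i else 0)
      + (if j = Suc i then y (Suc i) else 0) + (if i \<noteq> 0 \<and> j = i - 1 then y (i - 1) else 0))"
    by (rule sum.cong) (auto simp: c)
  also have "\<dots> = k *\<^sub>R y i + (if Suc i < n then y (Suc i) else 0) + (if i = 0 then 0 else y (i - 1))"
    using i by (cases "i = 0") (auto simp: sum.distrib sum.delta)
  finally show ?thesis by (simp add: algebra_simps)
qed

lemma linking_apply_leg_t:
  assumes "i < length ks"
  shows "linking_apply s t ks ls \<alpha> (Leg_t i) = leg_apply ks (\<alpha> Center) (\<lambda>i. \<alpha> (Leg_t i)) i"
proof -
  have "(\<Sum>j<length ks. real_of_int (linking s t ks ls (Leg_t i) (Leg_t j)) *\<^sub>R \<alpha> (Leg_t j))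
     = (if i = 0 then 0 else \<alpha> (Leg_t (i - 1))) + real_of_int (ks ! i) *\<^sub>R \<alpha> (Leg_t i)
       + (if Suc i < length ks then \<alpha> (Leg_t (Suc i)) else 0)"
    by (rule sum_tridiagonal[OF assms]) (use assms in \<open>auto simp: linking_def\<close>)
  then show ?thesis using assms
    by (simp add: linking_apply_def sum_inner_vertices leg_apply_def linking_def)
qed

lemma linking_apply_leg_s:
  assumes "i < length ls"
  shows "linking_apply s t ks ls \<alpha> (Leg_s i) = leg_apply ls (\<alpha> Center) (\<lambda>i. \<alpha> (Leg_s i)) i"
proof -
  have "(\<Sum>j<length ls. real_of_int (linking s t ks ls (Leg_s i) (Leg_s j)) *\<^sub>R \<alpha> (Leg_s j))
     = (if i = 0 then 0 else \<alpha> (Leg_s (i - 1))) + real_of_int (ls ! i) *\<^sub>R \<alpha> (Leg_s i)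
       + (if Suc i < length ls then \<alpha> (Leg_s (Suc i)) else 0)"
    by (rule sum_tridiagonal[OF assms]) (use assms in \<open>auto simp: linking_def\<close>)
  then show ?thesis using assms
    by (simp add: linking_apply_def sum_inner_vertices leg_apply_def linking_def)
qed

lemma linking_apply_center:
  assumes "ks \<noteq> []" "ls \<noteq> []"
  shows "linking_apply s t ks ls \<alpha> Center = - \<alpha> Center + \<alpha> (Leg_t 0) + \<alpha> (Leg_s 0)"
proof -
  have *: "(\<Sum>i<n. real_of_int (if i = 0 then 1 else 0) *\<^sub>R y i) = y 0" if "n > 0" for n and y :: "nat \<Rightarrow> 'a"
  proof -
    have "(\<Sum>i<n. real_of_int (if i = 0 then 1 else 0) *\<^sub>R y i) = (\<Sum>i<n. if i = 0 then y 0 else 0)"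
      by (rule sum.cong) auto
    then show ?thesis using that by simp
  qed
  show ?thesis using assms
    by (simp add: linking_apply_def sum_inner_vertices linking_def *)
qed

lemma sum_last: "n > 0 \<Longrightarrow> (\<Sum>i<n. if Suc i < n then 0 else f i) = (f (n - 1) :: 'b::comm_monoid_add)"
  by (cases n) (auto intro!: sum.neutral)

text \<open>The shape of the product over a leg: power 0 of the denominator is an indicator, and
  only the end carries a genuine factor.\<close>

lemma prod_last:
  fixes f :: "nat \<Rightarrow> 'b::{semidom,comm_monoid_mult}"
  assumes "n > 0"
  shows "(\<Prod>i<n. if Suc i < n then of_bool (P i) else f i) = of_bool (\<forall>i. Suc i < n \<longrightarrow> P i) * f (n - 1)"
proof -
  obtain m where n: "n = Suc m" using assms by (cases n) auto
  have "(\<Prod>i<m. if Suc i < n then of_bool (P i) else f i) = (\<Prod>i<m. of_bool (P i))"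
    by (rule prod.cong) (auto simp: n)
  also have "\<dots> = of_bool (\<forall>i<m. P i)" by (induction m) (auto simp: less_Suc_eq)
  finally show ?thesis by (simp add: n)
qed

section \<open>The constant term for a torus knot\<close>

locale torus_knot_plumbing = based_root_system \<Phi> S for \<Phi> S :: "'a::euclidean_space set" +
  fixes s t s' t' :: nat and ks ls :: "int list"
  assumes st: "2 \<le> s" "2 \<le> t" "coprime s t"
    and t': "0 < t'" "t' < t" "[int s * int t' = -1] (mod int t)"
    and s': "0 < s'" "s' < s" "[int t * int s' = -1] (mod int s)"
    and ks: "neg_cont_frac_expansion ks (- (real t / real t'))"
    and ls: "neg_cont_frac_expansion ls (- (real s / real s'))"
begin

lemma dvd_t: "int t dvd int s * int t' + 1" and dvd_s: "int s dvd int t * int s' + 1"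
  using t'(3) s'(3) by (simp_all add: cong_iff_dvd_diff)

lemma coprime_legs: "coprime t t'" "coprime s s'"
proof -
  have *: "coprime a b" if "int a dvd int c * int b + 1" for a b c :: nat
  proof (rule coprimeI)
    fix d assume "d dvd a" "d dvd b"
    then have "int d dvd int c * int b + 1" "int d dvd int c * int b" using that by (auto intro: dvd_trans)
    then have "int d dvd 1" by (metis dvd_add_right_iff)
    then show "is_unit d" by simp
  qed
  show "coprime t t'" "coprime s s'" using *[OF dvd_t] *[OF dvd_s] .
qed

lemma continuants_legs: "ks \<noteq> []" "continuants ks = (int t, int t')" "ls \<noteq> []" "continuants ls = (int s, int s')"
  using continuants_eqI[OF ks coprime_legs(1)] continuants_eqI[OF ls coprime_legs(2)] st t' s' by auto

lemma weights_legs: "\<forall>k\<in>set ks. k \<le> -2" "\<forall>k\<in>set ls. k \<le> -2"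
  using ks ls by (auto simp: neg_cont_frac_expansion_def)

text \<open>The integer s t' + t s' + 1 is divisible by s and by t, hence by s t, and lies strictly
  between 0 and 2 s t. Equivalently 1 - t'/t - s'/s = 1/(s t), the source of the denominator s
  t.\<close>

lemma seifert_identity: "real s * real t' + real t * real s' = real s * real t - 1"
proof -
  let ?m = "int s * int t' + int t * int s' + 1"
  have "int t dvd ?m" using dvd_add[OF dvd_t, of "int t * int s'"] by (simp add: algebra_simps)
  moreover have "int s dvd ?m" using dvd_add[OF dvd_s, of "int s * int t'"] by (simp add: algebra_simps)
  ultimately have "int s * int t dvd ?m" using st by (intro divides_mult) auto
  then obtain k where k: "?m = int s * int t * k" by blast
  have pos: "int s * int t > 0" using st by simp
  have "int s * int t * k > 0" unfolding k[symmetric] by (simp add: add_nonneg_pos)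
  then have "k > 0" using pos by (simp add: zero_less_mult_iff)
  have "int s * int t' \<le> int s * (int t - 1)" "int t * int s' \<le> int t * (int s - 1)"
    using t' s' by (auto intro!: mult_left_mono)
  then have "?m < int s * int t * 2" using st by (simp add: algebra_simps)
  then have "k < 2" using pos unfolding k by (simp add: mult_less_cancel_left_pos)
  then have "k = 1" using \<open>k > 0\<close> by simp
  then have "real_of_int ?m = real_of_int (int s * int t)" using k by simp
  then show ?thesis by simp
qed

lemma st_pos: "real s > 0" "real t > 0" using st by auto

abbreviation "V' \<equiv> inner_vertices ks ls"
abbreviation "\<kappa> \<equiv> real s * real t - real s - real t"

definition contribution :: "(tree_vertex \<Rightarrow> 'a) \<Rightarrow> real" where
  "contribution \<alpha> = (\<Prod>v\<in>V'. denominator_power \<Phi> S (2 - int (tree_degree ks ls v))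
              (linking_apply s t ks ls \<alpha> v + delta_vec \<Phi> S ks ls v))"

lemma delta_vec_eq:
  "delta_vec \<Phi> S ks ls Center = - \<rho>"
  "i < length ks \<Longrightarrow> delta_vec \<Phi> S ks ls (Leg_t i) = (if Suc i < length ks then 0 else \<rho>)"
  "i < length ls \<Longrightarrow> delta_vec \<Phi> S ks ls (Leg_s i) = (if Suc i < length ls then 0 else \<rho>)"
  using continuants_legs by (simp_all add: delta_vec_def tree_degree_center tree_degree_leg)

definition leg_factor :: "int list \<Rightarrow> 'a \<Rightarrow> (nat \<Rightarrow> 'a) \<Rightarrow> real" where
  "leg_factor ms a y = of_bool (\<forall>i. Suc i < length ms \<longrightarrow> leg_apply ms a y i = 0)
     * weyl_denominator \<Phi> S (leg_apply ms a y (length ms - 1) + \<rho>)"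

text \<open>Degrees and exponents are abstracted so that one statement serves both legs.\<close>

lemma leg_factor_eq:
  assumes "ms \<noteq> []"
    and "\<And>i. i < length ms \<Longrightarrow> d i = (if Suc i < length ms then 2 else 1)"
    and "\<And>i. i < length ms \<Longrightarrow> v i = leg_apply ms a y i + (if Suc i < length ms then 0 else \<rho>)"
  shows "(\<Prod>i<length ms. denominator_power \<Phi> S (2 - int (d i)) (v i)) = leg_factor ms a y"
proof -
  have "(\<Prod>i<length ms. denominator_power \<Phi> S (2 - int (d i)) (v i))
     = (\<Prod>i<length ms. if Suc i < length ms then of_bool (leg_apply ms a y i = 0)
          else weyl_denominator \<Phi> S (leg_apply ms a y i + \<rho>))"
    by (rule prod.cong) (auto simp: assms denominator_power_zero denominator_power_one series_one_def)
  then show ?thesis using assms(1) by (simp add: prod_last leg_factor_def)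
qed

lemma contribution_eq:
  "contribution \<alpha> = weyl_sign S w0 * N_coeff \<Phi> S (- \<alpha> Center + \<alpha> (Leg_t 0) + \<alpha> (Leg_s 0) - \<rho>) / real (card W)
     * leg_factor ks (\<alpha> Center) (\<lambda>i. \<alpha> (Leg_t i)) * leg_factor ls (\<alpha> Center) (\<lambda>i. \<alpha> (Leg_s i))"
proof -
  have c: "denominator_power \<Phi> S (2 - int (tree_degree ks ls Center)) x = weyl_sign S w0 * N_coeff \<Phi> S x / real (card W)" for x
    using continuants_legs by (simp add: tree_degree_center denominator_power_minus_one)
  have 1: "(\<Prod>i<length ks. denominator_power \<Phi> S (2 - int (tree_degree ks ls (Leg_t i)))
      (linking_apply s t ks ls \<alpha> (Leg_t i) + delta_vec \<Phi> S ks ls (Leg_t i)))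
    = leg_factor ks (\<alpha> Center) (\<lambda>i. \<alpha> (Leg_t i))"
    by (rule leg_factor_eq) (simp_all add: continuants_legs tree_degree_leg linking_apply_leg_t delta_vec_eq)
  have 2: "(\<Prod>i<length ls. denominator_power \<Phi> S (2 - int (tree_degree ks ls (Leg_s i)))
      (linking_apply s t ks ls \<alpha> (Leg_s i) + delta_vec \<Phi> S ks ls (Leg_s i)))
    = leg_factor ls (\<alpha> Center) (\<lambda>i. \<alpha> (Leg_s i))"
    by (rule leg_factor_eq) (simp_all add: continuants_legs tree_degree_leg linking_apply_leg_s delta_vec_eq)
  show ?thesis
    unfolding contribution_def prod_inner_vertices c 1 2
    by (simp add: linking_apply_center continuants_legs delta_vec_eq)
qed

lemma leg_factor_nonzero:
  assumes ne: "ms \<noteq> []" and k: "\<forall>k\<in>set ms. k \<le> -2" and nz: "leg_factor ms a y \<noteq> 0"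
  obtains w where "w \<in> W" "\<And>i. i < length ms \<Longrightarrow> y i = leg_solution ms a (w \<rho> - \<rho>) i"
proof -
  have z: "\<And>i. Suc i < length ms \<Longrightarrow> leg_apply ms a y i = 0"
    and "weyl_denominator \<Phi> S (leg_apply ms a y (length ms - 1) + \<rho>) \<noteq> 0"
    using nz by (auto simp: leg_factor_def)
  then obtain w where w: "w \<in> W" "leg_apply ms a y (length ms - 1) + \<rho> = w \<rho>"
    using weyl_denominator_nonzero by blast
  have "leg_apply ms a y i = (if Suc i < length ms then 0 else w \<rho> - \<rho>)" if i: "i < length ms" for i
  proof (cases "Suc i < length ms")
    case False
    then have "i = length ms - 1" using i by simp
    then show ?thesis using w False by (simp add: eq_diff_eq)
  qed (simp add: z)
  then show ?thesis using leg_equations_iff[OF ne k] w(1) that by blast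
qed

lemma leg_factor_solution:
  assumes ne: "ms \<noteq> []" and k: "\<forall>k\<in>set ms. k \<le> -2" and w: "w \<in> W"
    and y: "\<And>i. i < length ms \<Longrightarrow> y i = leg_solution ms a (w \<rho> - \<rho>) i"
  shows "leg_factor ms a y = weyl_sign S w"
proof -
  have e: "leg_apply ms a y i = (if Suc i < length ms then 0 else w \<rho> - \<rho>)" if "i < length ms" for i
    using leg_equations_iff[OF ne k, of a y "w \<rho> - \<rho>"] y that by blast
  have "leg_apply ms a y (length ms - 1) = w \<rho> - \<rho>" using e[of "length ms - 1"] ne by simp
  then show ?thesis using e by (auto simp: leg_factor_def weyl_denominator_orbit[OF w])
qed

text \<open>Restricted to \<open>V'\<close> so that it can equal the summation variable, which is
  extensional, as a function.\<close>

definition leg_extension :: "'a \<Rightarrow> ('a \<Rightarrow> 'a) \<Rightarrow> ('a \<Rightarrow> 'a) \<Rightarrow> tree_vertex \<Rightarrow> 'a" where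
  "leg_extension a w1 w2 = restrict (\<lambda>v. case v of Center \<Rightarrow> a | Leg_t i \<Rightarrow> leg_solution ks a (w1 \<rho> - \<rho>) i
      | Leg_s i \<Rightarrow> leg_solution ls a (w2 \<rho> - \<rho>) i | Knot \<Rightarrow> undefined) V'"

lemma leg_extension_simps [simp]:
  "leg_extension a w1 w2 Center = a"
  "i < length ks \<Longrightarrow> leg_extension a w1 w2 (Leg_t i) = leg_solution ks a (w1 \<rho> - \<rho>) i"
  "i < length ls \<Longrightarrow> leg_extension a w1 w2 (Leg_s i) = leg_solution ls a (w2 \<rho> - \<rho>) i"
  by (auto simp: leg_extension_def inner_vertices_def)

text \<open>The value of B' \<alpha> + \<delta> at the center: weight -1, one neighbour in each leg,
  and \<delta> = -\<rho> because the degree there is 3.\<close>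

definition center_arg :: "'a \<Rightarrow> ('a \<Rightarrow> 'a) \<Rightarrow> ('a \<Rightarrow> 'a) \<Rightarrow> 'a" where
  "center_arg a w1 w2 = - a + leg_solution ks a (w1 \<rho> - \<rho>) 0 + leg_solution ls a (w2 \<rho> - \<rho>) 0 - \<rho>"

lemma contribution_leg_extension:
  assumes "w1 \<in> W" "w2 \<in> W"
  shows "contribution (leg_extension a w1 w2) =
    weyl_sign S w0 * N_coeff \<Phi> S (center_arg a w1 w2) / real (card W) * weyl_sign S w1 * weyl_sign S w2"
  unfolding contribution_eq using continuants_legs weights_legs assms
  by (simp add: leg_factor_solution center_arg_def)

lemma contribution_nonzero:
  assumes ext: "\<alpha> \<in> V' \<rightarrow>\<^sub>E Q" and nz: "contribution \<alpha> \<noteq> 0"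
  obtains w1 w2 where "w1 \<in> W" "w2 \<in> W" "\<alpha> = leg_extension (\<alpha> Center) w1 w2"
proof -
  have nz1: "leg_factor ks (\<alpha> Center) (\<lambda>i. \<alpha> (Leg_t i)) \<noteq> 0"
    and nz2: "leg_factor ls (\<alpha> Center) (\<lambda>i. \<alpha> (Leg_s i)) \<noteq> 0"
    using nz by (auto simp: contribution_eq)
  obtain w1 where w1: "w1 \<in> W"
    and 1: "\<And>i. i < length ks \<Longrightarrow> \<alpha> (Leg_t i) = leg_solution ks (\<alpha> Center) (w1 \<rho> - \<rho>) i"
    using leg_factor_nonzero[OF continuants_legs(1) weights_legs(1) nz1] by blast
  obtain w2 where w2: "w2 \<in> W"
    and 2: "\<And>i. i < length ls \<Longrightarrow> \<alpha> (Leg_s i) = leg_solution ls (\<alpha> Center) (w2 \<rho> - \<rho>) i"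
    using leg_factor_nonzero[OF continuants_legs(3) weights_legs(2) nz2] by blast
  have "\<alpha> v = leg_extension (\<alpha> Center) w1 w2 v" for v
  proof (cases "v \<in> V'")
    case True
    then show ?thesis using 1 2 by (auto simp: inner_vertices_def)
  next
    case False
    then show ?thesis using ext by (simp add: leg_extension_def PiE_arb[OF ext])
  qed
  then show ?thesis using that[OF w1 w2] by blast
qed

text \<open>By \<open>seifert_identity\<close> the coefficient of a collapses to -1/(s t), and the
  multiples of \<rho> combine to the same factor times \<open>\<kappa>\<close>.\<close>

lemma center_arg_eq:
  "center_arg a w1 w2 = - (1 / (real s * real t)) *\<^sub>R (a + \<kappa> *\<^sub>R \<rho>) - (1 / real t) *\<^sub>R w1 \<rho> - (1 / real s) *\<^sub>R w2 \<rho>"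
proof -
  have 1: "center_arg a w1 w2 = (-1 + real t' / real t + real s' / real s) *\<^sub>R a
      + (-1 + 1 / real t + 1 / real s) *\<^sub>R \<rho> - (1 / real t) *\<^sub>R w1 \<rho> - (1 / real s) *\<^sub>R w2 \<rho>"
    by (simp add: center_arg_def leg_solution_first continuants_legs algebra_simps)
  have 2: "-1 + real t' / real t + real s' / real s = - (1 / (real s * real t))"
  proof -
    have "-1 + real t' / real t + real s' / real s
        = (real s * real t' + real t * real s' - real s * real t) / (real s * real t)"
      using st_pos by (simp add: field_simps)
    then show ?thesis unfolding seifert_identity by simp
  qed
  have 3: "-1 + 1 / real t + 1 / real s = - (1 / (real s * real t)) * \<kappa>"
    using st_pos by (simp add: field_simps)
  show ?thesis unfolding 1 2 3 by (simp add: scaleR_add_right)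
qed

text \<open>Solving for a exhibits it as an integral combination of q and the two displacements of
  \<rho>. The first vertex of a leg requires division by t or s, which the congruences for t' and s'
  make possible.\<close>

lemma leg_extension_lattice:
  assumes w: "w1 \<in> W" "w2 \<in> W" and c: "center_arg a w1 w2 \<in> QL"
  shows "leg_extension a w1 w2 \<in> V' \<rightarrow>\<^sub>E Q"
proof -
  define q where "q = center_arg a w1 w2 + \<rho>"
  let ?e1 = "w1 \<rho> - \<rho>" and ?e2 = "w2 \<rho> - \<rho>"
  have e: "?e1 \<in> Q" "?e2 \<in> Q" using w weyl_vector_diff_lattice by auto
  have "q = (center_arg a w1 w2 - \<rho>) + 2 *\<^sub>R \<rho>" by (simp add: q_def scaleR_2)
  also have "\<dots> \<in> Q"
    by (rule root_lattice_add[OF _ double_weyl_vector_lattice]) (use c in \<open>simp add: shifted_iff\<close>)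
  finally have q: "q \<in> Q" .
  have sq: "(real s * real t) *\<^sub>R q = - a - real s *\<^sub>R ?e1 - real t *\<^sub>R ?e2"
  proof -
    have "(real s * real t) *\<^sub>R q = - (a + \<kappa> *\<^sub>R \<rho>) - real s *\<^sub>R w1 \<rho> - real t *\<^sub>R w2 \<rho> + (real s * real t) *\<^sub>R \<rho>"
      unfolding q_def center_arg_eq using st_pos by (simp add: scaleR_diff_right scaleR_add_right)
    then show ?thesis by (simp add: algebra_simps)
  qed
  then have a: "a = - ((real s * real t) *\<^sub>R q) - real s *\<^sub>R ?e1 - real t *\<^sub>R ?e2" by (simp add: algebra_simps)
  have aQ: "a \<in> Q"
    by (subst a) (intro root_lattice_diff root_lattice_uminus root_lattice_scale q e Ints_mult Ints_of_nat)
  obtain k where k: "int s * int t' + 1 = int t * k" using dvd_t by blast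
  obtain l where l: "int t * int s' + 1 = int s * l" using dvd_s by blast
  have "real_of_int (int s * int t' + 1) = real_of_int (int t * k)" using k by simp
  then have k: "real s * real t' + 1 = real t * real_of_int k" by simp
  have "real_of_int (int t * int s' + 1) = real_of_int (int s * l)" using l by simp
  then have l: "real t * real s' + 1 = real s * real_of_int l" by simp
  \<comment> \<open>After substituting a, the coefficient of \<open>?e1\<close> is -(s t' + 1) = -t
    k; the other coefficients are visibly multiples of t.\<close>
  have "real t' *\<^sub>R a - ?e1 = - (real t' * (real s * real t)) *\<^sub>R q - (real s * real t' + 1) *\<^sub>R ?e1 - (real t * real t') *\<^sub>R ?e2"
    by (subst a) (simp add: algebra_simps)
  also have "\<dots> = real t *\<^sub>R (- (real t' * real s) *\<^sub>R q - real_of_int k *\<^sub>R ?e1 - real t' *\<^sub>R ?e2)"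
    unfolding k by (simp add: algebra_simps)
  finally have "leg_solution ks a ?e1 0 = - (real t' * real s) *\<^sub>R q - real_of_int k *\<^sub>R ?e1 - real t' *\<^sub>R ?e2"
    using st_pos by (simp add: leg_solution_first continuants_legs)
  also have "\<dots> \<in> Q" by (intro root_lattice_diff root_lattice_scale q e Ints_mult Ints_of_nat Ints_of_int Ints_minus)
  finally have 1: "leg_solution ks a ?e1 i \<in> Q" for i by (rule leg_solution_lattice[OF aQ])
  have "real s' *\<^sub>R a - ?e2 = - (real s' * (real s * real t)) *\<^sub>R q - (real s * real s') *\<^sub>R ?e1 - (real t * real s' + 1) *\<^sub>R ?e2"
    by (subst a) (simp add: algebra_simps)
  also have "\<dots> = real s *\<^sub>R (- (real s' * real t) *\<^sub>R q - real s' *\<^sub>R ?e1 - real_of_int l *\<^sub>R ?e2)"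
    unfolding l by (simp add: algebra_simps)
  finally have "leg_solution ls a ?e2 0 = - (real s' * real t) *\<^sub>R q - real s' *\<^sub>R ?e1 - real_of_int l *\<^sub>R ?e2"
    using st_pos by (simp add: leg_solution_first continuants_legs)
  also have "\<dots> \<in> Q" by (intro root_lattice_diff root_lattice_scale q e Ints_mult Ints_of_nat Ints_of_int Ints_minus)
  finally have 2: "leg_solution ls a ?e2 i \<in> Q" for i by (rule leg_solution_lattice[OF aQ])
  show ?thesis unfolding leg_extension_def
    by (rule restrict_PiE_iff[THEN iffD2]) (use 1 2 aQ in \<open>auto simp: inner_vertices_def\<close>)
qed

text \<open>The value of B' \<alpha> at the end of a leg is w \<rho> - \<rho>, which determines
  w.\<close>

lemma leg_extension_inj:
  assumes w: "w1 \<in> W" "w2 \<in> W" "u1 \<in> W" "u2 \<in> W" and e: "leg_extension a w1 w2 = leg_extension a u1 u2"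
  shows "w1 = u1 \<and> w2 = u2"
proof -
  have *: "w = u" if ne: "ms \<noteq> []" and k: "\<forall>k\<in>set ms. k \<le> -2" and wu: "w \<in> W" "u \<in> W"
    and e: "\<And>i. i < length ms \<Longrightarrow> leg_solution ms a (w \<rho> - \<rho>) i = leg_solution ms a (u \<rho> - \<rho>) i" for ms w u
  proof -
    let ?y = "leg_solution ms a (w \<rho> - \<rho>)" and ?i = "length ms - 1"
    have "\<forall>i<length ms. leg_apply ms a ?y i = (if Suc i < length ms then 0 else w \<rho> - \<rho>)"
      using leg_equations_iff[OF ne k, of a ?y "w \<rho> - \<rho>"] by simp
    moreover have "\<forall>i<length ms. leg_apply ms a ?y i = (if Suc i < length ms then 0 else u \<rho> - \<rho>)"
      using leg_equations_iff[OF ne k, of a ?y "u \<rho> - \<rho>"] e by simp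
    moreover have "?i < length ms" "\<not> Suc ?i < length ms" using ne by auto
    ultimately have "leg_apply ms a ?y ?i = w \<rho> - \<rho>" "leg_apply ms a ?y ?i = u \<rho> - \<rho>" by metis+
    then show ?thesis using weyl_vector_orbit_inj wu by simp
  qed
  have "leg_solution ks a (w1 \<rho> - \<rho>) i = leg_solution ks a (u1 \<rho> - \<rho>) i" if "i < length ks" for i
    using fun_cong[OF e, of "Leg_t i"] that by simp
  then have "w1 = u1" by (rule *[OF continuants_legs(1) weights_legs(1) w(1,3)])
  have "leg_solution ls a (w2 \<rho> - \<rho>) i = leg_solution ls a (u2 \<rho> - \<rho>) i" if "i < length ls" for i
    using fun_cong[OF e, of "Leg_s i"] that by simp
  then have "w2 = u2" by (rule *[OF continuants_legs(3) weights_legs(2) w(2,4)])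
  then show ?thesis using \<open>w1 = u1\<close> by blast
qed

text \<open>Only the center and the two ends contribute, as B' \<alpha> and \<delta> vanish in
  between. At an end the quadratic and linear parts combine to a pairing with w \<rho> + \<rho>,
  which \<open>leg_solution_last\<close> expresses through the center.\<close>

lemma theta_leg_extension:
  assumes w: "w1 \<in> W" "w2 \<in> W"
  shows "theta_q_exponent \<Phi> S s t ks ls (leg_extension (- \<mu> - \<kappa> *\<^sub>R \<rho>) w1 w2)
    = (\<mu> \<bullet> \<mu>) / (2 * real s * real t) - \<kappa>\<^sup>2 * (\<rho> \<bullet> \<rho>) / (2 * real s * real t)"
proof -
  define a where "a = - \<mu> - \<kappa> *\<^sub>R \<rho>"
  let ?\<alpha> = "leg_extension a w1 w2"
  let ?e1 = "w1 \<rho> - \<rho>" and ?e2 = "w2 \<rho> - \<rho>"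
  define y1 y2 where "y1 = leg_solution ks a ?e1 (length ks - 1)" and "y2 = leg_solution ls a ?e2 (length ls - 1)"
  have n: "length ks > 0" "length ls > 0" using continuants_legs by auto
  have l1: "leg_apply ks a (\<lambda>i. ?\<alpha> (Leg_t i)) i = (if Suc i < length ks then 0 else ?e1)" if "i < length ks" for i
    using leg_equations_iff[OF continuants_legs(1) weights_legs(1), of a "\<lambda>i. ?\<alpha> (Leg_t i)" ?e1] that by simp
  have l2: "leg_apply ls a (\<lambda>i. ?\<alpha> (Leg_s i)) i = (if Suc i < length ls then 0 else ?e2)" if "i < length ls" for i
    using leg_equations_iff[OF continuants_legs(3) weights_legs(2), of a "\<lambda>i. ?\<alpha> (Leg_s i)" ?e2] that by simp
  have B: "(\<Sum>v\<in>V'. ?\<alpha> v \<bullet> linking_apply s t ks ls ?\<alpha> v) = a \<bullet> (center_arg a w1 w2 + \<rho>) + y1 \<bullet> ?e1 + y2 \<bullet> ?e2"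
  proof -
    have "(\<Sum>i<length ks. ?\<alpha> (Leg_t i) \<bullet> linking_apply s t ks ls ?\<alpha> (Leg_t i))
       = (\<Sum>i<length ks. if Suc i < length ks then 0 else leg_solution ks a ?e1 i \<bullet> ?e1)"
      by (rule sum.cong) (auto simp: linking_apply_leg_t l1)
    moreover have "(\<Sum>i<length ls. ?\<alpha> (Leg_s i) \<bullet> linking_apply s t ks ls ?\<alpha> (Leg_s i))
       = (\<Sum>i<length ls. if Suc i < length ls then 0 else leg_solution ls a ?e2 i \<bullet> ?e2)"
      by (rule sum.cong) (auto simp: linking_apply_leg_s l2)
    ultimately show ?thesis using n
      by (simp add: sum_inner_vertices sum_last y1_def y2_def linking_apply_center center_arg_def)
  qed
  have D: "(\<Sum>v\<in>V'. ?\<alpha> v \<bullet> delta_vec \<Phi> S ks ls v) = - (a \<bullet> \<rho>) + y1 \<bullet> \<rho> + y2 \<bullet> \<rho>"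
  proof -
    have "(\<Sum>i<length ks. ?\<alpha> (Leg_t i) \<bullet> delta_vec \<Phi> S ks ls (Leg_t i))
       = (\<Sum>i<length ks. if Suc i < length ks then 0 else leg_solution ks a ?e1 i \<bullet> \<rho>)"
      by (rule sum.cong) (auto simp: delta_vec_eq)
    moreover have "(\<Sum>i<length ls. ?\<alpha> (Leg_s i) \<bullet> delta_vec \<Phi> S ks ls (Leg_s i))
       = (\<Sum>i<length ls. if Suc i < length ls then 0 else leg_solution ls a ?e2 i \<bullet> \<rho>)"
      by (rule sum.cong) (auto simp: delta_vec_eq)
    ultimately show ?thesis using n
      by (simp add: sum_inner_vertices sum_last y1_def y2_def delta_vec_eq)
  qed
  \<comment> \<open>Equality of the norms of w \<rho> and \<rho>, in polarised form.\<close>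
  have orth: "(w \<rho> - \<rho>) \<bullet> (w \<rho> + \<rho>) = 0" if "w \<in> W" for w
    using weyl_group_inner[OF that, of \<rho> \<rho>] by (simp add: inner_diff_left inner_add_right inner_commute[of \<rho> "w \<rho>"])
  have z1: "y1 \<bullet> ?e1 + 2 * (y1 \<bullet> \<rho>) = a \<bullet> ((1 / real t) *\<^sub>R (w1 \<rho> + \<rho>))"
  proof -
    have "real t * (y1 \<bullet> (w1 \<rho> + \<rho>)) = a \<bullet> (w1 \<rho> + \<rho>)"
      using leg_solution_last[OF continuants_legs(1) weights_legs(1) orth[OF w(1)], of a] by (simp add: continuants_legs y1_def)
    then have "y1 \<bullet> (w1 \<rho> + \<rho>) = a \<bullet> ((1 / real t) *\<^sub>R (w1 \<rho> + \<rho>))" using st_pos by (simp only: inner_scaleR_right) (simp add: field_simps del: inner_add_right)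
    then show ?thesis by (simp add: inner_diff_right inner_add_right)
  qed
  have z2: "y2 \<bullet> ?e2 + 2 * (y2 \<bullet> \<rho>) = a \<bullet> ((1 / real s) *\<^sub>R (w2 \<rho> + \<rho>))"
  proof -
    have "real s * (y2 \<bullet> (w2 \<rho> + \<rho>)) = a \<bullet> (w2 \<rho> + \<rho>)"
      using leg_solution_last[OF continuants_legs(3) weights_legs(2) orth[OF w(2)], of a] by (simp add: continuants_legs y2_def)
    then have "y2 \<bullet> (w2 \<rho> + \<rho>) = a \<bullet> ((1 / real s) *\<^sub>R (w2 \<rho> + \<rho>))" using st_pos by (simp only: inner_scaleR_right) (simp add: field_simps del: inner_add_right)
    then show ?thesis by (simp add: inner_diff_right inner_add_right)
  qed
  \<comment> \<open>The Weyl terms of the center cancel against those of the ends, so the exponent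
    of q does not depend on w1 and w2.\<close>
  have v: "center_arg a w1 w2 - \<rho> + (1 / real t) *\<^sub>R (w1 \<rho> + \<rho>) + (1 / real s) *\<^sub>R (w2 \<rho> + \<rho>)
      = (1 / (real s * real t)) *\<^sub>R (\<mu> - \<kappa> *\<^sub>R \<rho>)"
  proof -
    have "center_arg a w1 w2 - \<rho> + (1 / real t) *\<^sub>R (w1 \<rho> + \<rho>) + (1 / real s) *\<^sub>R (w2 \<rho> + \<rho>)
      = (1 / (real s * real t)) *\<^sub>R \<mu> + (-1 + 1 / real t + 1 / real s) *\<^sub>R \<rho>"
      by (simp add: center_arg_eq a_def algebra_simps)
    moreover have "-1 + 1 / real t + 1 / real s = - (1 / (real s * real t)) * \<kappa>"
      using st_pos by (simp add: field_simps)
    ultimately show ?thesis by (simp add: scaleR_diff_right)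
  qed
  have "theta_q_exponent \<Phi> S s t ks ls ?\<alpha>
      = - (1/2) * (a \<bullet> (center_arg a w1 w2 - \<rho>) + (y1 \<bullet> ?e1 + 2 * (y1 \<bullet> \<rho>)) + (y2 \<bullet> ?e2 + 2 * (y2 \<bullet> \<rho>)))"
    unfolding theta_q_exponent_def B D inner_add_right inner_diff_right[of a] by (simp add: algebra_simps)
  also have "\<dots> = - (1/2) * (a \<bullet> (center_arg a w1 w2 - \<rho> + (1 / real t) *\<^sub>R (w1 \<rho> + \<rho>) + (1 / real s) *\<^sub>R (w2 \<rho> + \<rho>)))"
    unfolding z1 z2 inner_add_right ..
  \<comment> \<open>The factors are opposite shifts of \<mu>, so no term linear in \<mu> remains:
    this is the effect of centering by \<open>\<kappa>\<close>.\<close>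
  also have "\<dots> = (1/2) * (1 / (real s * real t)) * ((\<mu> + \<kappa> *\<^sub>R \<rho>) \<bullet> (\<mu> - \<kappa> *\<^sub>R \<rho>))"
  proof -
    have "a = - (\<mu> + \<kappa> *\<^sub>R \<rho>)" by (simp add: a_def)
    then show ?thesis unfolding v inner_scaleR_right by (simp only: inner_minus_left)
  qed
  also have "(\<mu> + \<kappa> *\<^sub>R \<rho>) \<bullet> (\<mu> - \<kappa> *\<^sub>R \<rho>) = \<mu> \<bullet> \<mu> - \<kappa>\<^sup>2 * (\<rho> \<bullet> \<rho>)"
    unfolding inner_add_left inner_diff_right inner_scaleR_left inner_scaleR_right power2_eq_square
    by (simp only: inner_commute[of \<rho> \<mu>] distrib_left)
  finally show ?thesis unfolding a_def using st_pos by (simp add: field_simps)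
qed

section \<open>Evaluation of the series and of its coefficients\<close>

abbreviation "q_shift \<equiv> \<kappa>\<^sup>2 * (\<rho> \<bullet> \<rho>) / (2 * real s * real t)"

text \<open>For the fixed value at the center, pairs (w1, w2) with nonzero N and the right power of
  q correspond one to one to the contributing \<alpha>.\<close>

lemma torus_knot_F_eq:
  "torus_knot_F \<Phi> S s t ks ls \<mu> e = weyl_sign S w0 *
     (q_monomial (torus_coeff \<Phi> S s t QL \<mu>) ((\<mu> \<bullet> \<mu>) / (2 * real s * real t)) (e + q_shift) / real (card W))"
proof -
  define a where "a = - \<mu> - \<kappa> *\<^sub>R \<rho>"
  let ?E = "(\<mu> \<bullet> \<mu>) / (2 * real s * real t) - q_shift"
  let ?N = "\<lambda>w1 w2. N_coeff \<Phi> S (center_arg a w1 w2)"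
  define P where "P = {(w1, w2) \<in> W \<times> W. ?N w1 w2 \<noteq> 0 \<and> e = ?E}"
  let ?X = "{\<alpha>. \<alpha> \<in> V' \<rightarrow>\<^sub>E Q \<and> - \<alpha> Center - \<rho> = \<mu> + (\<kappa> - 1) *\<^sub>R \<rho>
     \<and> theta_q_exponent \<Phi> S s t ks ls \<alpha> = e \<and> contribution \<alpha> \<noteq> 0}"
  let ?c = "\<lambda>w1 w2. weyl_sign S w0 * ?N w1 w2 / real (card W) * weyl_sign S w1 * weyl_sign S w2"
  \<comment> \<open>The normalization shifts by \<open>\<kappa> - 1\<close> times \<rho> and the
    theta series by one more \<rho>; together they put a at the center.\<close>
  have center: "- b - \<rho> = \<mu> + (\<kappa> - 1) *\<^sub>R \<rho> \<longleftrightarrow> b = a" for b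
    unfolding a_def scaleR_diff_left by (auto simp: algebra_simps)
  have th: "theta_q_exponent \<Phi> S s t ks ls (leg_extension a w1 w2) = ?E" if "w1 \<in> W" "w2 \<in> W" for w1 w2
    unfolding a_def by (rule theta_leg_extension[OF that])
  have X: "?X = (\<lambda>(w1, w2). leg_extension a w1 w2) ` P"
  proof (intro equalityI subsetI)
    fix \<alpha> assume \<alpha>: "\<alpha> \<in> ?X"
    then have "\<alpha> Center = a" using center by blast
    then obtain w1 w2 where w: "w1 \<in> W" "w2 \<in> W" "\<alpha> = leg_extension a w1 w2"
      using contribution_nonzero[of \<alpha>] \<alpha> by blast
    then have "?N w1 w2 \<noteq> 0" "e = ?E" using \<alpha> th contribution_leg_extension[OF w(1,2), of a] by auto
    then show "\<alpha> \<in> (\<lambda>(w1, w2). leg_extension a w1 w2) ` P" using w by (auto simp: P_def)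
  next
    fix \<alpha> assume "\<alpha> \<in> (\<lambda>(w1, w2). leg_extension a w1 w2) ` P"
    then obtain w1 w2 where w: "w1 \<in> W" "w2 \<in> W" "?N w1 w2 \<noteq> 0" "e = ?E" "\<alpha> = leg_extension a w1 w2"
      by (auto simp: P_def)
    have "contribution \<alpha> \<noteq> 0"
      unfolding w(5) contribution_leg_extension[OF w(1,2)]
      using w(3) card_weyl_pos weyl_sign_cases[of w0] weyl_sign_cases[of w1] weyl_sign_cases[of w2] by auto
    moreover have "\<alpha> \<in> V' \<rightarrow>\<^sub>E Q" using leg_extension_lattice[OF w(1,2)] N_coeff_shifted w by blast
    ultimately show "\<alpha> \<in> ?X" using w th center by simp
  qed
  have inj: "inj_on (\<lambda>(w1, w2). leg_extension a w1 w2) P"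
    by (rule inj_onI) (use leg_extension_inj in \<open>auto simp: P_def\<close>)
  have "torus_knot_F \<Phi> S s t ks ls \<mu> e = (\<Sum>\<alpha>\<in>?X. contribution \<alpha>)"
    by (simp add: torus_knot_F_def plumbing_series_def contribution_def algebra_simps)
  also have "\<dots> = (\<Sum>(w1, w2)\<in>P. ?c w1 w2)"
    unfolding X sum.reindex[OF inj] by (rule sum.cong) (auto simp: P_def contribution_leg_extension)
  also have "\<dots> = (\<Sum>(w1, w2)\<in>W \<times> W. of_bool (e = ?E) * ?c w1 w2)"
    by (rule sum.mono_neutral_cong_left) (auto simp: P_def)
  also have "\<dots> = of_bool (e = ?E) * (\<Sum>w1\<in>W. \<Sum>w2\<in>W. ?c w1 w2)"
    by (simp only: sum.cartesian_product[symmetric] sum_distrib_left)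
  \<comment> \<open>Since \<open>w0\<close> sends \<rho> to -\<rho>, this reverses the sign of both
    Weyl terms, while the two signs of \<open>w0\<close> cancel.\<close>
  also have "(\<Sum>w1\<in>W. \<Sum>w2\<in>W. ?c w1 w2) = (\<Sum>w1\<in>W. \<Sum>w2\<in>W. ?c (w1 \<circ> w0) (w2 \<circ> w0))"
    by (simp only: sum_weyl_right[OF w0(1), of "\<lambda>w1. \<Sum>w2\<in>W. ?c w1 w2"]
        sum_weyl_right[OF w0(1), of "\<lambda>w2. ?c w1 w2" for w1])
  \<comment> \<open>The arguments trade places: the first Weyl term is divided by t in
    \<open>center_arg\<close> but by s in \<open>ell_arg\<close>.\<close>
  also have "\<dots> = (\<Sum>w1\<in>W. \<Sum>w2\<in>W. weyl_sign S w0 / real (card W) * (weyl_sign S (w2 \<circ> w1)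
      * of_bool (ell_arg \<Phi> S s t \<mu> w2 w1 \<in> QL) * N_coeff \<Phi> S (ell_arg \<Phi> S s t \<mu> w2 w1)))"
  proof (intro sum.cong refl)
    fix w1 w2 assume w: "w1 \<in> W" "w2 \<in> W"
    have "center_arg a (w1 \<circ> w0) (w2 \<circ> w0) = ell_arg \<Phi> S s t \<mu> w2 w1"
      unfolding center_arg_eq ell_arg_def a_def using st_pos linear_neg[OF weyl_group_linear[OF w(1)]] linear_neg[OF weyl_group_linear[OF w(2)]]
      by (simp add: w0_weyl_vector scaleR_add_right)
    moreover have "weyl_sign S (w1 \<circ> w0) * weyl_sign S (w2 \<circ> w0) = weyl_sign S (w2 \<circ> w1)"
      using w w0(1) weyl_sign_square[of w0] by (simp add: weyl_sign_comp mult_ac del: weyl_sign_square)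
    ultimately show "?c (w1 \<circ> w0) (w2 \<circ> w0) = weyl_sign S w0 / real (card W) * (weyl_sign S (w2 \<circ> w1)
      * of_bool (ell_arg \<Phi> S s t \<mu> w2 w1 \<in> QL) * N_coeff \<Phi> S (ell_arg \<Phi> S s t \<mu> w2 w1))"
      using N_coeff_shifted[of "ell_arg \<Phi> S s t \<mu> w2 w1"] by (auto simp: mult_ac)
  qed
  also have "\<dots> = (\<Sum>w2\<in>W. \<Sum>w1\<in>W. weyl_sign S w0 / real (card W) * (weyl_sign S (w2 \<circ> w1)
      * of_bool (ell_arg \<Phi> S s t \<mu> w2 w1 \<in> QL) * N_coeff \<Phi> S (ell_arg \<Phi> S s t \<mu> w2 w1)))"
    by (rule sum.swap)
  also have "\<dots> = weyl_sign S w0 / real (card W) * torus_coeff \<Phi> S s t QL \<mu>"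
    by (simp only: torus_coeff_def sum.cartesian_product[symmetric] sum_distrib_left[symmetric])
  finally show ?thesis by (auto simp: q_monomial_def)
qed

text \<open>The coefficient is antisymmetric, because W preserves (\<mu>, \<mu>), and supported in Q
  + \<rho>; the expansion therefore returns it up to 1/|W|.\<close>

lemma monomial_coeff_expansion:
  "antisymmetric_expansion \<Phi> S (\<lambda>\<beta>. q_monomial (torus_coeff \<Phi> S s t QL \<beta>) ((\<beta> \<bullet> \<beta>) / (2 * real s * real t))) \<mu> e
    = q_monomial (torus_coeff \<Phi> S s t QL \<mu>) ((\<mu> \<bullet> \<mu>) / (2 * real s * real t)) e / real (card W)"
proof (rule antisymmetric_expansion_of_antisymmetric)
  show "q_monomial (torus_coeff \<Phi> S s t QL (w x)) ((w x \<bullet> w x) / (2 * real s * real t)) e =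
      weyl_sign S w * q_monomial (torus_coeff \<Phi> S s t QL x) ((x \<bullet> x) / (2 * real s * real t)) e" if "w \<in> W" for w x
    using that by (simp add: q_monomial_def torus_coeff_weyl weyl_group_inner)
  show "x \<in> QL" if "q_monomial (torus_coeff \<Phi> S s t QL x) ((x \<bullet> x) / (2 * real s * real t)) e \<noteq> 0" for x
    using that st torus_coeff_shifted[of s t x] by (auto simp: q_monomial_def split: if_splits)
qed simp

lemma torus_knot_F_expansion:
  "torus_knot_F \<Phi> S s t ks ls \<mu> e = weyl_sign S w0 * antisymmetric_expansion \<Phi> S
     (\<lambda>\<beta>. q_monomial (torus_coeff \<Phi> S s t QL \<beta>) ((\<beta> \<bullet> \<beta>) / (2 * real s * real t))) \<mu> (e - (- q_shift))"
  by (simp add: torus_knot_F_eq monomial_coeff_expansion)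

lemma torus_knot_F_congruent:
  "torus_knot_F \<Phi> S s t ks ls \<cong>\<^sub>q antisymmetric_expansion \<Phi> S
     (\<lambda>\<beta>. q_monomial (torus_coeff \<Phi> S s t QL \<beta>) ((\<beta> \<bullet> \<beta>) / (2 * real s * real t)))"
  unfolding eq_up_to_sign_qpower_def
proof (intro bexI[of _ "weyl_sign S w0"] exI[of _ "- q_shift"] allI)
  show "weyl_sign S w0 \<in> {1, -1}" using weyl_sign_cases[of w0] by simp
qed (rule torus_knot_F_expansion)

lemma torus_knot_F_congruent_dominant:
  assumes "\<forall>\<alpha>\<in>Pos. (real s + real t) * coroot_pairing \<rho> \<alpha> \<le> real s * real t"
  shows "torus_knot_F \<Phi> S s t ks ls \<cong>\<^sub>q antisymmetric_expansion \<Phi> S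
     (\<lambda>\<beta>. q_monomial (torus_coeff \<Phi> S s t DL \<beta>) ((\<beta> \<bullet> \<beta>) / (2 * real s * real t)))"
proof -
  have "antisymmetric_expansion \<Phi> S (\<lambda>\<beta>. q_monomial (torus_coeff \<Phi> S s t DL \<beta>) ((\<beta> \<bullet> \<beta>) / (2 * real s * real t)))
     = antisymmetric_expansion \<Phi> S (\<lambda>\<beta>. q_monomial (torus_coeff \<Phi> S s t QL \<beta>) ((\<beta> \<bullet> \<beta>) / (2 * real s * real t)))"
    by (rule antisymmetric_expansion_cong) (use assms st torus_coeff_dominant[of s t] in simp)
  then show ?thesis using torus_knot_F_congruent by simp
qed

text \<open>The sign and the shift of the power of q are absorbed into f.\<close>

lemma torus_knot_F_expandable: "\<exists>f. torus_knot_F \<Phi> S s t ks ls = antisymmetric_expansion \<Phi> S f"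
proof (intro exI ext)
  fix \<mu> e
  let ?f = "\<lambda>\<beta> e. weyl_sign S w0 * q_monomial (torus_coeff \<Phi> S s t QL \<beta>) ((\<beta> \<bullet> \<beta>) / (2 * real s * real t)) (e + q_shift)"
  have "antisymmetric_expansion \<Phi> S ?f \<mu> e = weyl_sign S w0 * antisymmetric_expansion \<Phi> S
     (\<lambda>\<beta>. q_monomial (torus_coeff \<Phi> S s t QL \<beta>) ((\<beta> \<bullet> \<beta>) / (2 * real s * real t))) \<mu> (e + q_shift)"
    unfolding antisymmetric_expansion_eq times_divide_eq_right sum_distrib_left
    by (intro arg_cong2[of _ _ _ _ "(/)"] sum.cong refl) (simp add: mult_ac)
  then show "torus_knot_F \<Phi> S s t ks ls \<mu> e = antisymmetric_expansion \<Phi> S ?f \<mu> e"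
    by (simp add: torus_knot_F_expansion)
qed

text \<open>At a regular dominant \<beta> the coefficient of x^\<beta> is f at \<beta> divided by
  |W|, for any admissible f. On a wall the terms cancel and impose no condition on f.\<close>

lemma expansion_coeff_monomial:
  assumes f: "torus_knot_F \<Phi> S s t ks ls = antisymmetric_expansion \<Phi> S f"
    and b: "\<beta> \<in> DL" "\<forall>\<alpha>\<in>S. \<beta> \<bullet> \<alpha> \<noteq> 0"
  shows "\<exists>a. f \<beta> = q_monomial a ((\<beta> \<bullet> \<beta>) / (2 * real s * real t) + - q_shift)"
proof (intro exI ext)
  fix e
  have d: "\<And>\<sigma>. \<sigma> \<in> S \<Longrightarrow> \<beta> \<bullet> \<sigma> > 0" and q: "\<beta> \<in> QL"
    using b unfolding dominant_shifted_iff by (auto simp: order_less_le)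
  have "f \<beta> e / real (card W) = torus_knot_F \<Phi> S s t ks ls \<beta> e"
    unfolding f using q by (simp add: antisymmetric_expansion_dominant[OF d])
  then have "f \<beta> e = weyl_sign S w0 * q_monomial (torus_coeff \<Phi> S s t QL \<beta>) ((\<beta> \<bullet> \<beta>) / (2 * real s * real t)) (e + q_shift)"
    using card_weyl_pos by (simp only: torus_knot_F_eq times_divide_eq_right) (auto simp: card_gt_0_iff)
  then show "f \<beta> e = q_monomial (weyl_sign S w0 * torus_coeff \<Phi> S s t QL \<beta>)
      ((\<beta> \<bullet> \<beta>) / (2 * real s * real t) + - q_shift) e"
    by (auto simp: q_monomial_def)
qed

end

theorem theorem3p3:
  fixes \<Phi> S :: "'a::euclidean_space set"
    and s t s' t' :: nat
    and ks ls :: "int list"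
  assumes "root_system \<Phi>" and "simple_system \<Phi> S" and "standard_normalization \<Phi>"
    and "2 \<le> s" and "2 \<le> t" and "coprime s t"
    and "0 < t'" and "t' < t" and "[int s * int t' = -1] (mod int t)"
    and "0 < s'" and "s' < s" and "[int t * int s' = -1] (mod int s)"
    and "neg_cont_frac_expansion ks (- (real t / real t'))"
    and "neg_cont_frac_expansion ls (- (real s / real s'))"
  shows
    "(\<exists>f. torus_knot_F \<Phi> S s t ks ls = antisymmetric_expansion \<Phi> S f) \<and>
     (\<exists>c. \<forall>f. torus_knot_F \<Phi> S s t ks ls = antisymmetric_expansion \<Phi> S f \<longrightarrow>
        (\<forall>\<beta> \<in> dominant_weights \<Phi> S \<inter> shifted_root_lattice \<Phi> S. (\<forall>\<alpha>\<in>S. \<beta> \<bullet> \<alpha> \<noteq> 0) \<longrightarrow>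
           (\<exists>a. f \<beta> = q_monomial a ((\<beta> \<bullet> \<beta>) / (2 * real s * real t) + c)))) \<and>
     torus_knot_F \<Phi> S s t ks ls \<cong>\<^sub>q
       antisymmetric_expansion \<Phi> S
         (\<lambda>\<beta>. q_monomial (torus_coeff \<Phi> S s t (shifted_root_lattice \<Phi> S) \<beta>)
                ((\<beta> \<bullet> \<beta>) / (2 * real s * real t))) \<and>
     ((\<forall>\<alpha>\<in>positive_roots \<Phi> S.
         (real s + real t) * coroot_pairing (weyl_vector \<Phi> S) \<alpha> \<le> real s * real t) \<longrightarrow>
      torus_knot_F \<Phi> S s t ks ls \<cong>\<^sub>q
        antisymmetric_expansion \<Phi> S
          (\<lambda>\<beta>. q_monomial
                 (torus_coeff \<Phi> S s t (dominant_weights \<Phi> S \<inter> shifted_root_lattice \<Phi> S) \<beta>)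
                 ((\<beta> \<bullet> \<beta>) / (2 * real s * real t))))"
proof -
  interpret torus_knot_plumbing \<Phi> S s t s' t' ks ls
    using assms by unfold_locales auto
  show ?thesis
    using torus_knot_F_expandable torus_knot_F_congruent torus_knot_F_congruent_dominant
      expansion_coeff_monomial by blast
qed

end
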